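(* For a spinning test body in the Schwarzschild metric (variables $(\vec L,\vec M,P_\alpha,y^\alpha)$, Poisson bracket, Hamiltonian $H$ and total angular momentum vector $\vec Q$ as in the context), let $\vec Q\neq0$. On the region $L_2^2+L_3^2\neq0$, $\sin\theta\neq0$, choose as new variables $r$, $P_r$ and $$\vec E=\Big(L_1,\ \frac{L_3P_\theta}{\sqrt{L_2^2+L_3^2}}+L_2\frac{L_1\cos\theta-P_\varphi}{\sin\theta\sqrt{L_2^2+L_3^2}},\ -\frac{L_2P_\theta}{\sqrt{L_2^2+L_3^2}}+L_3\frac{L_1\cos\theta-P_\varphi}{\sin\theta\sqrt{L_2^2+L_3^2}}\Big),$$ $$\vec Z=\Big(-\frac{M_1\sqrt{(\vec L,\vec L)}}{\sqrt{L_2^2+L_3^2}},\ \sqrt{(\vec L,\vec L)},\ \frac{M_2L_3-M_3L_2}{\sqrt{L_2^2+L_3^2}}\Big).$$ (1) On the level set $C_\star=(\vec L,\vec M)=0$ the nonzero Poisson brackets among $E_1,E_2,E_3,Z_1,Z_2,Z_3,r,P_r$ are $$\{E_1,E_2\}=E_3,\quad \{E_1,E_3\}=-E_2,\quad \{E_2,E_3\}=E_1,$$ $$\{Z_1,Z_2\}=Z_3,\quad \{Z_1,Z_3\}=Z_2,\quad \{Z_2,Z_3\}=Z_1,\qquad \{r,P_r\}=1.$$ (2) The matrix of this reduced bracket has rank six, and hence the bracket has two Casimir functions, namely $C_\circ=(\vec L,\vec L)-(\vec M,\vec M)$ and $F=(\vec Q,\vec Q)=P_\theta^2+P_\varphi^2+\frac{(L_1-P_\varphi\cos\theta)^2}{\sin^2\theta}$,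 which in the new variables have the form $$C_\circ=-Z_1^2+Z_2^2-Z_3^2,\qquad F=E_1^2+E_2^2+E_3^2.$$ (3) In the new variables, with $\mathcal E=-P_t$ the constant energy, the Hamiltonian becomes $$\begin{aligned} H=&\ \frac{a(r)}{m}\Big[\frac12+\frac{2\Theta^2+Z_2^2-E_1^2}{V}\Big]P_r^2+\frac{\Gamma+E_2}{mrV}\Big[E_1E_3\Big(\frac{Z_1^2}{Z_2^2}-1\Big)-Z_3E_2\frac{Z_1}{Z_2}\Big]P_r\\ &+\frac{Z_2^2-E_1^2}{mr^3V}\big[r\Gamma^2+\mu Z_1^2\big]-\frac{(\mu\Theta-r^2\mathcal E)^2}{mr^3(r-2\mu)}\Big[\frac12-\frac{Z_1^2+Z_3^2-3\Theta^2}{V}\Big]\\ &+\frac{\sqrt{Z_2^2-E_1^2}}{mrV}\big[Z_3(\Theta-2r\mathcal E)P_r-Z_1Z_2\mathcal E\big]+\frac{E_3^2+\Gamma^2}{mr^2}\Big[\frac12-\frac{2E_1^2}{V}\Big]\\ &-\frac{\mu\Theta-r^2\mathcal E}{mr^2V\sqrt{r(r-2\mu)}}\big[E_1E_3Z_3+Z_1Z_2E_2\big]-\frac{1}{mr^2V}\Big[\frac{Z_1}{Z_2}E_1E_3+Z_3\Gamma\Big]^2, \end{aligned}$$ where $$V=\frac{m^2}{\mu}r^3-2Z_1^2-Z_2^2+Z_3^2+3E_1^2\Big(1+\frac{Z_1^2}{Z_2^2}\Big),\quad \Gamma=\sqrt{a(r)(Z_2^2-E_1^2)}-E_2,\quad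 \Theta=\frac{Z_1}{Z_2}\sqrt{Z_2^2-E_1^2}.$$ (4) The equations of motion reduce to the following Hamiltonian system with three degrees of freedom: $$\frac{d\vec E}{d\tau}=\vec E\times\frac{\partial H}{\partial\vec E},\quad \frac{d\vec Z}{d\tau}=(\mathbf J\vec Z)\times\frac{\partial H}{\partial\vec Z},\quad \frac{dP_r}{d\tau}=-\frac{\partial H}{\partial r},\quad\frac{dr}{d\tau}=\frac{\partial H}{\partial P_r},\qquad \mathbf J=\mathrm{diag}(1,-1,1),$$ where, in computing the partial derivatives of $H$, one must explicitly substitute into the function $V$ the relation $$m^2=-a(r)P_r^2+\frac{(\mu\Theta-\mathcal E r^2)^2}{r^3(r-2\mu)}-\frac{E_3^2+\Gamma^2}{r^2}.$$ Since $C_\circ>0$, the trajectories of this system lie on the family of symplectic leaves $$\mathcal S^6_c=\{(\vec E,\vec Z,r,P_r)\ |\ C_\circ(\vec Z)=c^2,\ F(\vec E)=\ell\}.$$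
   Context: Schwarzschild metric, coordinates $y^\alpha=(t,r,\theta,\varphi)$, $r>2\mu$: $ds^2=-a\,dt^2+a^{-1}dr^2+r^2(d\theta^2+\sin^2\theta\,d\varphi^2)$, $a=a(r)=1-2\mu/r$, $\mu>0$ the mass of the black hole. Orthonormal tetrad: $e_0=a^{-1/2}\partial_t$, $e_1=a^{1/2}\partial_r$, $e_2=r^{-1}\partial_\theta$, $e_3=(r\sin\theta)^{-1}\partial_\varphi$. Phase variables: $\vec L,\vec M\in\mathbb R^3$, $P_\alpha$, $y^\alpha$, with the only nonzero Poisson brackets $$\{L_i,L_j\}=\varepsilon_{ijk}L_k,\quad \{L_i,M_j\}=\varepsilon_{ijk}M_k,\quad \{M_i,M_j\}=-\varepsilon_{ijk}L_k,\quad \{y^\alpha,P_\beta\}=\delta^\alpha_\beta.$$ Its Casimir functions are $C_\star=(\vec L,\vec M)$ and $C_\circ=(\vec L,\vec L)-(\vec M,\vec M)$. Here $(\cdot,\cdot)$ and $\times$ are the Euclidean scalar and vector products in $\mathbb R^3$. The trajectories of interest have $C_\star=0$ and $C_\circ=c^2>0$, where $c$ is the spin magnitude. The equations of motion are $\frac{d\mathfrak X}{d\tau}=\{\mathfrak X,H\}$ for every phase variable $\mathfrak X$. The spin tensor is $S^{\alpha\beta}=S^{AB}e_A{}^\alpha e_B{}^\beta$ with $S^{AB}$ antisymmetric, $S^{0i}=M_i$, $S^{23}=L_1$, $S^{31}=L_2$, $S^{12}=L_3$; the momentum is $p_t=P_t-\frac{\mu}{r^2}M_1$, $p_r=P_r$,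 $p_\theta=P_\theta-\sqrt a\,L_3$, $p_\varphi=P_\varphi+\sqrt a\sin\theta\,L_2-\cos\theta\,L_1$. With $m>0$ the constant mass of the body, $m^2=-p_\alpha p^\alpha$, the Hamiltonian is $$H=\frac{p^\alpha p_\alpha}{2m}-\frac{\mathcal D^{\alpha\beta}p_\alpha p_\beta}{m(d+2p_\alpha p^\alpha)},\qquad \mathcal D^\alpha{}_\beta=S^{\alpha\gamma}R_{\gamma\beta\mu\nu}S^{\mu\nu},\quad d=\tfrac12\mathcal D^\alpha{}_\alpha,$$ where indices are raised and lowered with the metric $g$ and $[\nabla_\alpha,\nabla_\beta]A^\mu=R^\mu{}_{\nu\alpha\beta}A^\nu$. The system has the integrals $\mathcal E=-P_t$ (energy) and $\vec Q=(Q_1,Q_2,P_\varphi)$ (total angular momentum vector), where $$Q_1=\frac{\cos\varphi}{\sin\theta}(L_1-P_\varphi\cos\theta)-P_\theta\sin\varphi,\qquad Q_2=\frac{\sin\varphi}{\sin\theta}(L_1-P_\varphi\cos\theta)+P_\theta\cos\varphi.$$ The value of the integral $F=(\vec Q,\vec Q)$ is denoted by $\ell$.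
   Formalization: In (4) the two vector products are taken in the opposite order, dE/dτ = ∂H/∂E × E and dZ/dτ = ∂H/∂Z × (JZ), since the printed order contradicts the brackets in (1) with dX/dτ = {X,H}; each symplectic leaf is a connected component of the printed level set. *)

theory Defs
  imports "HOL-Analysis.Analysis"
begin

definition gradient :: "(real^'n \<Rightarrow> real) \<Rightarrow> real^'n \<Rightarrow> real^'n" where
  "gradient f x = (\<chi> i. frechet_derivative f (at x) (axis i 1))"


section \<open>The Schwarzschild metric\<close>

(* The coordinates y = (t, r, theta, phi) have the indices 0, 1, 2, 3 of the type 4. *)

definition schw_a :: "real \<Rightarrow> real \<Rightarrow> real" where
  "schw_a \<mu> r = 1 - 2 * \<mu> / r"

definition schw_metric :: "real \<Rightarrow> real^4 \<Rightarrow> real^4^4" where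
  "schw_metric \<mu> y = (\<chi> \<alpha> \<beta>.
     if \<alpha> \<noteq> \<beta> then 0
     else if \<alpha> = 0 then - schw_a \<mu> (y $ 1)
     else if \<alpha> = 1 then 1 / schw_a \<mu> (y $ 1)
     else if \<alpha> = 2 then (y $ 1)\<^sup>2
     else (y $ 1)\<^sup>2 * (sin (y $ 2))\<^sup>2)"

definition inv_metric :: "real \<Rightarrow> real^4 \<Rightarrow> real^4^4" where
  "inv_metric \<mu> y = matrix_inv (schw_metric \<mu> y)"

(* christoffel mu l a b y  =  Gamma^l_{ab} *)
definition christoffel :: "real \<Rightarrow> 4 \<Rightarrow> 4 \<Rightarrow> 4 \<Rightarrow> real^4 \<Rightarrow> real" where
  "christoffel \<mu> l \<alpha> \<beta> y = (1/2) * (\<Sum>\<nu>\<in>UNIV. inv_metric \<mu> y $ l $ \<nu> *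
     (gradient (\<lambda>z. schw_metric \<mu> z $ \<nu> $ \<beta>) y $ \<alpha>
    + gradient (\<lambda>z. schw_metric \<mu> z $ \<nu> $ \<alpha>) y $ \<beta>
    - gradient (\<lambda>z. schw_metric \<mu> z $ \<alpha> $ \<beta>) y $ \<nu>))"

(* riemann_up mu k n a b y  =  R^k_{n a b}, with the sign convention
   [nabla_a, nabla_b] A^k = R^k_{n a b} A^n *)
definition riemann_up :: "real \<Rightarrow> 4 \<Rightarrow> 4 \<Rightarrow> 4 \<Rightarrow> 4 \<Rightarrow> real^4 \<Rightarrow> real" where
  "riemann_up \<mu> \<kappa> \<nu> \<alpha> \<beta> y =
     gradient (christoffel \<mu> \<kappa> \<beta> \<nu>) y $ \<alpha>
   - gradient (christoffel \<mu> \<kappa> \<alpha> \<nu>) y $ \<beta>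
   + (\<Sum>l\<in>UNIV. christoffel \<mu> \<kappa> \<alpha> l y * christoffel \<mu> l \<beta> \<nu> y
               - christoffel \<mu> \<kappa> \<beta> l y * christoffel \<mu> l \<alpha> \<nu> y)"

definition riemann :: "real \<Rightarrow> 4 \<Rightarrow> 4 \<Rightarrow> 4 \<Rightarrow> 4 \<Rightarrow> real^4 \<Rightarrow> real" where
  "riemann \<mu> \<gamma> \<nu> \<alpha> \<beta> y =
     (\<Sum>\<kappa>\<in>UNIV. schw_metric \<mu> y $ \<gamma> $ \<kappa> * riemann_up \<mu> \<kappa> \<nu> \<alpha> \<beta> y)"

(* tetrad mu y $ A $ a  =  e_A^a *)
definition tetrad :: "real \<Rightarrow> real^4 \<Rightarrow> real^4^4" where
  "tetrad \<mu> y = (\<chi> A \<alpha>.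
     if A \<noteq> \<alpha> then 0
     else if A = 0 then 1 / sqrt (schw_a \<mu> (y $ 1))
     else if A = 1 then sqrt (schw_a \<mu> (y $ 1))
     else if A = 2 then 1 / (y $ 1)
     else 1 / (y $ 1 * sin (y $ 2)))"


section \<open>Phase space and Poisson bracket\<close>

(* (L, M, P, y) *)
type_synonym phase = "(real^3) \<times> (real^3) \<times> (real^4) \<times> (real^4)"

definition phL :: "phase \<Rightarrow> real^3" where "phL x = fst x"
definition phM :: "phase \<Rightarrow> real^3" where "phM x = fst (snd x)"
definition phP :: "phase \<Rightarrow> real^4" where "phP x = fst (snd (snd x))"
definition phy :: "phase \<Rightarrow> real^4" where "phy x = snd (snd (snd x))"

definition gradL :: "(phase \<Rightarrow> real) \<Rightarrow> phase \<Rightarrow> real^3" where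
  "gradL f x = gradient (\<lambda>l. f (l, phM x, phP x, phy x)) (phL x)"
definition gradM :: "(phase \<Rightarrow> real) \<Rightarrow> phase \<Rightarrow> real^3" where
  "gradM f x = gradient (\<lambda>q. f (phL x, q, phP x, phy x)) (phM x)"
definition gradP :: "(phase \<Rightarrow> real) \<Rightarrow> phase \<Rightarrow> real^4" where
  "gradP f x = gradient (\<lambda>p. f (phL x, phM x, p, phy x)) (phP x)"
definition grady :: "(phase \<Rightarrow> real) \<Rightarrow> phase \<Rightarrow> real^4" where
  "grady f x = gradient (\<lambda>z. f (phL x, phM x, phP x, z)) (phy x)"

(* The extension by the Leibniz rule of the brackets of the phase variables, with
   eps_{ijk} L_k written as the triple product L . (e_i x e_j). The brackets of the
   phase variables themselves are the lemmas pbracket_LL to pbracket_yP below. *)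
definition pbracket :: "(phase \<Rightarrow> real) \<Rightarrow> (phase \<Rightarrow> real) \<Rightarrow> phase \<Rightarrow> real" where
  "pbracket f g x =
     phL x \<bullet> (cross3 (gradL f x) (gradL g x) - cross3 (gradM f x) (gradM g x))
   + phM x \<bullet> (cross3 (gradL f x) (gradM g x) + cross3 (gradM f x) (gradL g x))
   + (grady f x \<bullet> gradP g x - gradP f x \<bullet> grady g x)"

definition levi_civita :: "3 \<Rightarrow> 3 \<Rightarrow> 3 \<Rightarrow> real" where
  "levi_civita i j k =
     (if (i, j, k) \<in> {(1,2,3), (2,3,1), (3,1,2)} then 1
      else if (i, j, k) \<in> {(1,3,2), (3,2,1), (2,1,3)} then -1 else 0)"

lemma gradient_component:
  fixes z :: "real^'n"
  shows "gradient (\<lambda>x. x $ i) z = axis i 1"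
proof -
  have "((\<lambda>x::real^'n. x $ i) has_derivative (\<lambda>x. x $ i)) (at z)"
    by (intro bounded_linear_imp_has_derivative bounded_linear_vec_nth)
  then have "frechet_derivative (\<lambda>x::real^'n. x $ i) (at z) = (\<lambda>x. x $ i)"
    by (rule frechet_derivative_at[symmetric])
  then show ?thesis
    by (simp add: gradient_def vec_eq_iff axis_def)
qed

lemma gradient_const: "gradient (\<lambda>x. k) z = 0"
  by (simp add: gradient_def vec_eq_iff)

lemmas phase_grad_simps = gradL_def gradM_def gradP_def grady_def phL_def phM_def phP_def phy_def
  gradient_component gradient_const

lemma cross3_axis:
  "v \<bullet> cross3 (axis i 1) (axis j 1) = (\<Sum>k\<in>UNIV. levi_civita i j k * v $ k)"
  using exhaust_3[of i] exhaust_3[of j]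
  by (auto simp: cross3_def levi_civita_def inner_vec_def sum_3 axis_def)

lemma cross3_zero_simps: "cross3 0 v = 0" "cross3 v 0 = 0"
  by (simp_all add: cross3_def vec_eq_iff forall_3)

lemma pbracket_LL: "pbracket (\<lambda>x. phL x $ i) (\<lambda>x. phL x $ j) x
    = (\<Sum>k\<in>UNIV. levi_civita i j k * phL x $ k)"
  and pbracket_LM: "pbracket (\<lambda>x. phL x $ i) (\<lambda>x. phM x $ j) x
    = (\<Sum>k\<in>UNIV. levi_civita i j k * phM x $ k)"
  and pbracket_MM: "pbracket (\<lambda>x. phM x $ i) (\<lambda>x. phM x $ j) x
    = - (\<Sum>k\<in>UNIV. levi_civita i j k * phL x $ k)"
  and pbracket_LP: "pbracket (\<lambda>x. phL x $ i) (\<lambda>x. phP x $ \<alpha>) x = 0"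
  and pbracket_Ly: "pbracket (\<lambda>x. phL x $ i) (\<lambda>x. phy x $ \<alpha>) x = 0"
  and pbracket_MP: "pbracket (\<lambda>x. phM x $ i) (\<lambda>x. phP x $ \<alpha>) x = 0"
  and pbracket_My: "pbracket (\<lambda>x. phM x $ i) (\<lambda>x. phy x $ \<alpha>) x = 0"
  and pbracket_PP: "pbracket (\<lambda>x. phP x $ \<alpha>) (\<lambda>x. phP x $ \<beta>) x = 0"
  and pbracket_yy: "pbracket (\<lambda>x. phy x $ \<alpha>) (\<lambda>x. phy x $ \<beta>) x = 0"
  and pbracket_yP: "pbracket (\<lambda>x. phy x $ \<alpha>) (\<lambda>x. phP x $ \<beta>) x = (if \<alpha> = \<beta> then 1 else 0)"
  by (simp_all add: pbracket_def phase_grad_simps cross3_axis cross3_zero_simps inner_axis_axis)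

definition C_star :: "phase \<Rightarrow> real" where
  "C_star x = phL x \<bullet> phM x"

definition C_circ :: "phase \<Rightarrow> real" where
  "C_circ x = phL x \<bullet> phL x - phM x \<bullet> phM x"

definition energy :: "phase \<Rightarrow> real" where
  "energy x = - phP x $ 0"

definition Qvec :: "phase \<Rightarrow> real^3" where
  "Qvec x = (let L = phL x; P = phP x; \<theta> = phy x $ 2; \<phi> = phy x $ 3 in
     vector [cos \<phi> / sin \<theta> * (L $ 1 - P $ 3 * cos \<theta>) - P $ 2 * sin \<phi>,
             sin \<phi> / sin \<theta> * (L $ 1 - P $ 3 * cos \<theta>) + P $ 2 * cos \<phi>,
             P $ 3])"

definition F_int :: "phase \<Rightarrow> real" where
  "F_int x = Qvec x \<bullet> Qvec x"


section \<open>The Hamiltonian\<close>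

(* S^{AB}, the antisymmetrization of its entries above the diagonal and S^{31} *)
definition spin_frame :: "phase \<Rightarrow> 4 \<Rightarrow> 4 \<Rightarrow> real" where
  "spin_frame x A B = (let L = phL x; M = phM x;
     u = (\<lambda>A B::4. if (A, B) = (0, 1) then M $ 1
                   else if (A, B) = (0, 2) then M $ 2
                   else if (A, B) = (0, 3) then M $ 3
                   else if (A, B) = (2, 3) then L $ 1
                   else if (A, B) = (3, 1) then L $ 2
                   else if (A, B) = (1, 2) then L $ 3 else 0)
     in u A B - u B A)"

definition spin :: "real \<Rightarrow> phase \<Rightarrow> 4 \<Rightarrow> 4 \<Rightarrow> real" where
  "spin \<mu> x \<alpha> \<beta> = (\<Sum>A\<in>UNIV. \<Sum>B\<in>UNIV.
     spin_frame x A B * tetrad \<mu> (phy x) $ A $ \<alpha> * tetrad \<mu> (phy x) $ B $ \<beta>)"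

(* the covariant components p_alpha *)
definition momentum :: "real \<Rightarrow> phase \<Rightarrow> real^4" where
  "momentum \<mu> x = (let L = phL x; M = phM x; P = phP x; r = phy x $ 1; \<theta> = phy x $ 2;
      a = schw_a \<mu> r in
     \<chi> \<alpha>. if \<alpha> = 0 then P $ 0 - \<mu> / r\<^sup>2 * M $ 1
          else if \<alpha> = 1 then P $ 1
          else if \<alpha> = 2 then P $ 2 - sqrt a * L $ 3
          else P $ 3 + sqrt a * sin \<theta> * L $ 2 - cos \<theta> * L $ 1)"

definition p_sq :: "real \<Rightarrow> phase \<Rightarrow> real" where
  "p_sq \<mu> x = (\<Sum>\<alpha>\<in>UNIV. \<Sum>\<beta>\<in>UNIV.
     inv_metric \<mu> (phy x) $ \<alpha> $ \<beta> * momentum \<mu> x $ \<alpha> * momentum \<mu> x $ \<beta>)"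

(* Dmix is D^a_b, Dup is D^{ab} *)
definition Dmix :: "real \<Rightarrow> phase \<Rightarrow> 4 \<Rightarrow> 4 \<Rightarrow> real" where
  "Dmix \<mu> x \<alpha> \<beta> = (\<Sum>\<gamma>\<in>UNIV. \<Sum>\<kappa>\<in>UNIV. \<Sum>\<nu>\<in>UNIV.
     spin \<mu> x \<alpha> \<gamma> * riemann \<mu> \<gamma> \<beta> \<kappa> \<nu> (phy x) * spin \<mu> x \<kappa> \<nu>)"

definition Dup :: "real \<Rightarrow> phase \<Rightarrow> 4 \<Rightarrow> 4 \<Rightarrow> real" where
  "Dup \<mu> x \<alpha> \<beta> = (\<Sum>\<gamma>\<in>UNIV. Dmix \<mu> x \<alpha> \<gamma> * inv_metric \<mu> (phy x) $ \<gamma> $ \<beta>)"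

definition d_scal :: "real \<Rightarrow> phase \<Rightarrow> real" where
  "d_scal \<mu> x = (1/2) * (\<Sum>\<alpha>\<in>UNIV. Dmix \<mu> x \<alpha> \<alpha>)"

definition Ham :: "real \<Rightarrow> real \<Rightarrow> phase \<Rightarrow> real" where
  "Ham \<mu> m x = p_sq \<mu> x / (2 * m)
     - (\<Sum>\<alpha>\<in>UNIV. \<Sum>\<beta>\<in>UNIV. Dup \<mu> x \<alpha> \<beta> * momentum \<mu> x $ \<alpha> * momentum \<mu> x $ \<beta>)
       / (m * (d_scal \<mu> x + 2 * p_sq \<mu> x))"

(* X is a solution of dX/dtau = {X, H} on the open time set T. *)
definition solves_eom :: "real \<Rightarrow> real \<Rightarrow> real set \<Rightarrow> (real \<Rightarrow> phase) \<Rightarrow> bool" where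
  "solves_eom \<mu> m T X \<longleftrightarrow> (\<forall>\<tau>\<in>T.
     (\<forall>i. ((\<lambda>s. phL (X s) $ i) has_real_derivative
             pbracket (\<lambda>x. phL x $ i) (Ham \<mu> m) (X \<tau>)) (at \<tau>)) \<and>
     (\<forall>i. ((\<lambda>s. phM (X s) $ i) has_real_derivative
             pbracket (\<lambda>x. phM x $ i) (Ham \<mu> m) (X \<tau>)) (at \<tau>)) \<and>
     (\<forall>\<alpha>. ((\<lambda>s. phP (X s) $ \<alpha>) has_real_derivative
             pbracket (\<lambda>x. phP x $ \<alpha>) (Ham \<mu> m) (X \<tau>)) (at \<tau>)) \<and>
     (\<forall>\<alpha>. ((\<lambda>s. phy (X s) $ \<alpha>) has_real_derivative
             pbracket (\<lambda>x. phy x $ \<alpha>) (Ham \<mu> m) (X \<tau>)) (at \<tau>)))"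


section \<open>The new variables and the reduced bracket\<close>

definition chart_region :: "real \<Rightarrow> phase set" where
  "chart_region \<mu> = {x. phy x $ 1 > 2 * \<mu> \<and> sin (phy x $ 2) \<noteq> 0 \<and>
     (phL x $ 2)\<^sup>2 + (phL x $ 3)\<^sup>2 \<noteq> 0 \<and> Qvec x \<noteq> 0}"

(* where the denominator of the Hamiltonian does not vanish *)
definition ham_domain :: "real \<Rightarrow> phase set" where
  "ham_domain \<mu> = {x. d_scal \<mu> x + 2 * p_sq \<mu> x \<noteq> 0}"

definition newE :: "phase \<Rightarrow> real^3" where
  "newE x = (let L = phL x; P = phP x; \<theta> = phy x $ 2; s = sqrt ((L $ 2)\<^sup>2 + (L $ 3)\<^sup>2) in
     vector [L $ 1,
             L $ 3 * P $ 2 / s + L $ 2 * ((L $ 1 * cos \<theta> - P $ 3) / (sin \<theta> * s)),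
             - L $ 2 * P $ 2 / s + L $ 3 * ((L $ 1 * cos \<theta> - P $ 3) / (sin \<theta> * s))])"

definition newZ :: "phase \<Rightarrow> real^3" where
  "newZ x = (let L = phL x; M = phM x; s = sqrt ((L $ 2)\<^sup>2 + (L $ 3)\<^sup>2) in
     vector [- M $ 1 * sqrt (L \<bullet> L) / s,
             sqrt (L \<bullet> L),
             (M $ 2 * L $ 3 - M $ 3 * L $ 2) / s])"

definition rad :: "phase \<Rightarrow> real" where "rad x = phy x $ 1"
definition radP :: "phase \<Rightarrow> real" where "radP x = phP x $ 1"

(* The reduced phase space is real^8 with the coordinates
   w $ 1, ..., w $ 8  =  E_1, E_2, E_3, Z_1, Z_2, Z_3, r, P_r. *)
definition pack :: "real^3 \<Rightarrow> real^3 \<Rightarrow> real \<Rightarrow> real \<Rightarrow> real^8" where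
  "pack E Z r p = vector [E $ 1, E $ 2, E $ 3, Z $ 1, Z $ 2, Z $ 3, r, p]"

definition unpackE :: "real^8 \<Rightarrow> real^3" where "unpackE w = vector [w $ 1, w $ 2, w $ 3]"
definition unpackZ :: "real^8 \<Rightarrow> real^3" where "unpackZ w = vector [w $ 4, w $ 5, w $ 6]"

definition newvars :: "phase \<Rightarrow> real^8" where
  "newvars x = pack (newE x) (newZ x) (rad x) (radP x)"

(* poisson_matrix w $ i $ j  =  {w_i, w_j} *)
definition poisson_matrix :: "real^8 \<Rightarrow> real^8^8" where
  "poisson_matrix w = (let
     u = (\<lambda>i j::8. if (i, j) = (1, 2) then w $ 3
                   else if (i, j) = (1, 3) then - w $ 2
                   else if (i, j) = (2, 3) then w $ 1
                   else if (i, j) = (4, 5) then w $ 6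
                   else if (i, j) = (4, 6) then w $ 5
                   else if (i, j) = (5, 6) then w $ 4
                   else if (i, j) = (7, 8) then 1 else 0)
     in \<chi> i j. u i j - u j i)"

definition red_bracket :: "(real^8 \<Rightarrow> real) \<Rightarrow> (real^8 \<Rightarrow> real) \<Rightarrow> real^8 \<Rightarrow> real" where
  "red_bracket f g w =
     (\<Sum>i\<in>UNIV. \<Sum>j\<in>UNIV. poisson_matrix w $ i $ j * gradient f w $ i * gradient g w $ j)"

definition C_circ_red :: "real^8 \<Rightarrow> real" where
  "C_circ_red w = - (w $ 4)\<^sup>2 + (w $ 5)\<^sup>2 - (w $ 6)\<^sup>2"

definition F_red :: "real^8 \<Rightarrow> real" where
  "F_red w = (w $ 1)\<^sup>2 + (w $ 2)\<^sup>2 + (w $ 3)\<^sup>2"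

definition leaf_level :: "real \<Rightarrow> real \<Rightarrow> (real^8) set" where
  "leaf_level c l = {pack E Z r p | E Z r p.
     C_circ_red (pack E Z r p) = c\<^sup>2 \<and> F_red (pack E Z r p) = l}"

(* The symplectic leaf through w consists of the points that can be joined to w by finitely
   many arcs of trajectories of Hamiltonian vector fields. The arcs are parametrized by
   {0..1}, which a rescaling of h achieves. *)
definition ham_arc :: "real^8 \<Rightarrow> real^8 \<Rightarrow> bool" where
  "ham_arc w w' \<longleftrightarrow> (\<exists>h \<gamma>.
     (\<forall>u. h differentiable (at u)) \<and> continuous_on UNIV (gradient h) \<and>
     \<gamma> 0 = w \<and> \<gamma> 1 = w' \<and>
     (\<forall>t\<in>{0..1}. (\<gamma> has_vector_derivative poisson_matrix (\<gamma> t) *v gradient h (\<gamma> t))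
                  (at t within {0..1})))"

definition symplectic_leaf :: "real^8 \<Rightarrow> (real^8) set" where
  "symplectic_leaf w = {w'. ham_arc\<^sup>*\<^sup>* w w'}"


section \<open>The Hamiltonian in the new variables\<close>

definition Theta :: "real^3 \<Rightarrow> real^3 \<Rightarrow> real" where
  "Theta E Z = Z $ 1 / Z $ 2 * sqrt ((Z $ 2)\<^sup>2 - (E $ 1)\<^sup>2)"

definition Gam :: "real \<Rightarrow> real^3 \<Rightarrow> real^3 \<Rightarrow> real \<Rightarrow> real" where
  "Gam \<mu> E Z r = sqrt (schw_a \<mu> r * ((Z $ 2)\<^sup>2 - (E $ 1)\<^sup>2)) - E $ 2"

(* The argument msq stands for m^2. *)
definition Vfun :: "real \<Rightarrow> real \<Rightarrow> real^3 \<Rightarrow> real^3 \<Rightarrow> real \<Rightarrow> real" where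
  "Vfun \<mu> msq E Z r = msq / \<mu> * r ^ 3 - 2 * (Z $ 1)\<^sup>2 - (Z $ 2)\<^sup>2 + (Z $ 3)\<^sup>2
     + 3 * (E $ 1)\<^sup>2 * (1 + (Z $ 1)\<^sup>2 / (Z $ 2)\<^sup>2)"

(* The argument V is the value of the function V. *)
definition Ham_new ::
  "real \<Rightarrow> real \<Rightarrow> real \<Rightarrow> real \<Rightarrow> real^3 \<Rightarrow> real^3 \<Rightarrow> real \<Rightarrow> real \<Rightarrow> real" where
  "Ham_new \<mu> m \<E> V E Z r p = (let
      a = schw_a \<mu> r; \<Theta> = Theta E Z; \<Gamma> = Gam \<mu> E Z r;
      E1 = E $ 1; E2 = E $ 2; E3 = E $ 3; Z1 = Z $ 1; Z2 = Z $ 2; Z3 = Z $ 3 in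
      a / m * (1/2 + (2 * \<Theta>\<^sup>2 + Z2\<^sup>2 - E1\<^sup>2) / V) * p\<^sup>2
    + (\<Gamma> + E2) / (m * r * V) * (E1 * E3 * (Z1\<^sup>2 / Z2\<^sup>2 - 1) - Z3 * E2 * (Z1 / Z2)) * p
    + (Z2\<^sup>2 - E1\<^sup>2) / (m * r ^ 3 * V) * (r * \<Gamma>\<^sup>2 + \<mu> * Z1\<^sup>2)
    - (\<mu> * \<Theta> - r\<^sup>2 * \<E>)\<^sup>2 / (m * r ^ 3 * (r - 2 * \<mu>))
        * (1/2 - (Z1\<^sup>2 + Z3\<^sup>2 - 3 * \<Theta>\<^sup>2) / V)
    + sqrt (Z2\<^sup>2 - E1\<^sup>2) / (m * r * V) * (Z3 * (\<Theta> - 2 * r * \<E>) * p - Z1 * Z2 * \<E>)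
    + (E3\<^sup>2 + \<Gamma>\<^sup>2) / (m * r\<^sup>2) * (1/2 - 2 * E1\<^sup>2 / V)
    - (\<mu> * \<Theta> - r\<^sup>2 * \<E>) / (m * r\<^sup>2 * V * sqrt (r * (r - 2 * \<mu>)))
        * (E1 * E3 * Z3 + Z1 * Z2 * E2)
    - 1 / (m * r\<^sup>2 * V) * (Z1 / Z2 * E1 * E3 + Z3 * \<Gamma>)\<^sup>2)"

definition mass_sq :: "real \<Rightarrow> real \<Rightarrow> real^3 \<Rightarrow> real^3 \<Rightarrow> real \<Rightarrow> real \<Rightarrow> real" where
  "mass_sq \<mu> \<E> E Z r p =
     - schw_a \<mu> r * p\<^sup>2 + (\<mu> * Theta E Z - \<E> * r\<^sup>2)\<^sup>2 / (r ^ 3 * (r - 2 * \<mu>))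
     - ((E $ 3)\<^sup>2 + (Gam \<mu> E Z r)\<^sup>2) / r\<^sup>2"

(* The prefactors keep the constant m; only the m^2 inside V is substituted. *)
definition Ham_red :: "real \<Rightarrow> real \<Rightarrow> real \<Rightarrow> real^3 \<Rightarrow> real^3 \<Rightarrow> real \<Rightarrow> real \<Rightarrow> real" where
  "Ham_red \<mu> m \<E> E Z r p =
     Ham_new \<mu> m \<E> (Vfun \<mu> (mass_sq \<mu> \<E> E Z r p) E Z r) E Z r p"

definition Jmat :: "real^3^3" where
  "Jmat = (\<chi> i j. if i \<noteq> j then 0 else if i = 2 then -1 else 1)"

(* The equations of motion of the reduced system at time tau. The order of the factors in the
   two vector products is the one for which the right-hand sides are {E_i, H} and {Z_i, H}:
   for instance {E_1, H} = E_3 dH/dE_2 - E_2 dH/dE_3 because {E_1, E_2} = E_3 and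
   {E_1, E_3} = - E_2, and this is (dH/dE) x E. *)
definition reduced_eom :: "(real^3 \<Rightarrow> real^3 \<Rightarrow> real \<Rightarrow> real \<Rightarrow> real) \<Rightarrow>
    (real \<Rightarrow> real^3) \<Rightarrow> (real \<Rightarrow> real^3) \<Rightarrow> (real \<Rightarrow> real) \<Rightarrow> (real \<Rightarrow> real) \<Rightarrow> real \<Rightarrow> bool" where
  "reduced_eom H E Z r p \<tau> \<longleftrightarrow>
     (E has_vector_derivative
        cross3 (gradient (\<lambda>e. H e (Z \<tau>) (r \<tau>) (p \<tau>)) (E \<tau>)) (E \<tau>)) (at \<tau>) \<and>
     (Z has_vector_derivative
        cross3 (gradient (\<lambda>z. H (E \<tau>) z (r \<tau>) (p \<tau>)) (Z \<tau>)) (Jmat *v Z \<tau>)) (at \<tau>) \<and>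
     (p has_real_derivative - deriv (\<lambda>s. H (E \<tau>) (Z \<tau>) s (p \<tau>)) (r \<tau>)) (at \<tau>) \<and>
     (r has_real_derivative deriv (\<lambda>s. H (E \<tau>) (Z \<tau>) (r \<tau>) s) (p \<tau>)) (at \<tau>)"

end

theory Submission
  imports Defs
begin

text \<open>The curvature operator of the Schwarzschild metric is diagonal in the orthonormal frame, so the
  Hamiltonian is an explicit rational function of \<open>L\<close>, \<open>M\<close> and the frame momentum, invariant under
  rotations of the last two frame directions; this leaves only the new variables. The new variables
  close under the bracket on the level set of the Casimir function \<open>(L, M)\<close>, and the derivative of \<open>H\<close>
  along their Hamiltonian vector fields, which are tangent to the level set, may be computed from the
  reduced Hamiltonian. On the leaves, the Hamiltonians linear in the variables generate rotations of
  \<open>E\<close>, pseudo-rotations of \<open>Z\<close> and translations of \<open>(r, P_r)\<close>. These act transitively on each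
  component of a level set of the two Casimir functions, the component being determined by the sign
  of \<open>Z_2\<close>.\<close>

text \<open>The factor \<open>2 \<mu> / r^3\<close> of the curvature splits off from both
  \<open>D^{\<alpha>\<beta>} p_\<alpha> p_\<beta>\<close> and \<open>d\<close>, and
  \<open>d + 2 p^2\<close> equals \<open>- (2 \<mu> / r^3) V\<close> with \<open>- p^2\<close> in
  the place of \<open>m^2\<close>. This is the origin of \<open>V\<close> and the reason for the
  substitution of \<open>m^2\<close>: with the function \<open>mass_sq\<close> in \<open>V\<close>
  the two Hamiltonians agree on every mass shell at once, so that their derivatives can be compared,
  whereas with a constant \<open>m^2\<close> they agree on one shell only. \<open>P_t\<close> is not
  among the new variables; it survives as the parameter energy, which is conserved. The
  computational obstacle is that the new variables contain square roots and reciprocals. Each of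
  these is given a name together with a polynomial relation, and the identities become polynomial
  identities modulo these relations.\<close>

lemma UNIV_4_0: "(UNIV::4 set) = {0, 1, 2, 3}"
  unfolding UNIV_4 by auto

lemma exhaust_4_0: fixes i :: 4 obtains "i = 0" | "i = 1" | "i = 2" | "i = 3"
  using UNIV_4_0 by blast

lemma forall_4_0: "(\<forall>i::4. P i) \<longleftrightarrow> P 0 \<and> P 1 \<and> P 2 \<and> P 3"
  by (metis exhaust_4_0)

lemma sum_4_0: "sum f (UNIV::4 set) = f 0 + f 1 + f 2 + f 3"
  unfolding UNIV_4_0 by (simp add: ac_simps)

lemma UNIV_8: "(UNIV::8 set) = {1, 2, 3, 4, 5, 6, 7, 8}"
proof -
  have "card {1, 2, 3, 4, 5, 6, 7, 8::8} = CARD(8)" by simp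
  then show ?thesis by (metis card_eq_UNIV_imp_eq_UNIV finite)
qed

lemma exhaust_8:
  fixes i :: 8
  obtains "i = 1" | "i = 2" | "i = 3" | "i = 4" | "i = 5" | "i = 6" | "i = 7" | "i = 8"
proof -
  have "i \<in> {1, 2, 3, 4, 5, 6, 7, 8}"
    by (simp only: UNIV_8[symmetric] UNIV_I)
  then show ?thesis using that by (elim insertE emptyE)
qed

lemma forall_8: "(\<forall>i::8. P i) \<longleftrightarrow> P 1 \<and> P 2 \<and> P 3 \<and> P 4 \<and> P 5 \<and> P 6 \<and> P 7 \<and> P 8"
  unfolding ball_UNIV[of P, symmetric] UNIV_8 by simp

lemma sum_8: "sum f (UNIV::8 set) = f 1 + f 2 + f 3 + f 4 + f 5 + f 6 + f 7 + f 8"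
  unfolding UNIV_8 by (simp add: ac_simps)

lemma pack_nth [simp]:
  "pack E Z r p $ 1 = E $ 1" "pack E Z r p $ 2 = E $ 2" "pack E Z r p $ 3 = E $ 3"
  "pack E Z r p $ 4 = Z $ 1" "pack E Z r p $ 5 = Z $ 2" "pack E Z r p $ 6 = Z $ 3"
  "pack E Z r p $ 7 = r" "pack E Z r p $ 8 = p"
  unfolding pack_def vector_def by simp_all

section \<open>Gradients as coordinates of derivatives\<close>

lemma gradient_nth:
  assumes "(f has_derivative f') (at x)"
  shows "gradient f x $ i = f' (axis i 1)"
  using frechet_derivative_at[OF assms] by (simp add: gradient_def)

lemma linear_axis_sum:
  fixes f :: "real^'n \<Rightarrow> real"
  assumes "linear f"
  shows "f h = (\<Sum>i\<in>UNIV. f (axis i 1) * h $ i)"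
proof -
  have "f h = f (\<Sum>i\<in>UNIV. h $ i *\<^sub>R axis i 1)"
    by (simp add: basis_expansion flip: scalar_mult_eq_scaleR)
  also have "\<dots> = (\<Sum>i\<in>UNIV. f (axis i 1) * h $ i)"
    by (simp add: linear_sum[OF assms] linear_cmul[OF assms] mult.commute)
  finally show ?thesis .
qed

lemma has_derivative_gradient:
  fixes f :: "real^'n \<Rightarrow> real"
  assumes "f differentiable (at x)"
  shows "(f has_derivative (\<lambda>h. gradient f x \<bullet> h)) (at x)"
proof -
  from assms have f: "(f has_derivative frechet_derivative f (at x)) (at x)"
    by (simp add: frechet_derivative_works)
  have "frechet_derivative f (at x) h = gradient f x \<bullet> h" for h
    by (subst linear_axis_sum[OF has_derivative_linear[OF f]]) (simp add: gradient_def inner_vec_def)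
  then have "frechet_derivative f (at x) = (\<lambda>h. gradient f x \<bullet> h)" ..
  with f show ?thesis by simp
qed

lemma gradient_eqI:
  fixes f :: "real^'n \<Rightarrow> real"
  assumes "(f has_derivative (\<lambda>h. g \<bullet> h)) (at x)"
  shows "gradient f x = g"
  by (simp add: vec_eq_iff gradient_nth[OF assms] inner_axis)

text \<open>The two functions have the same derivatives at \<open>x\<close>, so the choice operator
  behind \<open>frechet_derivative\<close> selects the same one, whether or not a derivative exists.
  In this way formulas valid on an open set pass to gradients, as is done for the metric and for the
  Christoffel symbols.\<close>

lemma gradient_cong:
  assumes "\<And>z. z \<in> S \<Longrightarrow> f z = g z" and "open S" and "x \<in> S"
  shows "gradient f x = gradient g x"
proof -
  have "(f has_derivative D) (at x) \<longleftrightarrow> (g has_derivative D) (at x)" for D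
    using has_derivative_transform_within_open[OF _ assms(2,3)] assms(1) by metis
  then show ?thesis by (simp add: gradient_def frechet_derivative_def)
qed


lemma has_derivative_vec_nth_comp [derivative_intros]:
  assumes "(f has_derivative f') F"
  shows "((\<lambda>x. f x $ i) has_derivative (\<lambda>h. f' h $ i)) F"
  using bounded_linear.has_derivative[OF bounded_linear_vec_nth assms] .


section \<open>The curvature of the Schwarzschild metric\<close>

text \<open>The coordinate domain of metric and tetrad, as a condition on \<open>y\<close> alone. It
  is open, so formulas that hold at each of its points can be differentiated there.\<close>

definition exterior :: "real \<Rightarrow> (real^4) set" where
  "exterior \<mu> = {y. y $ 1 > 2 * \<mu> \<and> sin (y $ 2) \<noteq> 0}"

lemma open_exterior: "open (exterior \<mu>)"
proof -
  have "open {y::real^4. 2 * \<mu> < y $ 1}"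
    by (intro open_Collect_less continuous_intros)
  moreover have "open {y::real^4. sin (y $ 2) \<noteq> 0}"
    by (intro open_Collect_neq continuous_intros)
  ultimately have "open ({y::real^4. 2 * \<mu> < y $ 1} \<inter> {y. sin (y $ 2) \<noteq> 0})"
    by (rule open_Int)
  then show ?thesis by (simp add: exterior_def Collect_conj_eq)
qed

text \<open>Unlike \<^const>\<open>schw_metric\<close>, the entry 11 is written without the nested quotient \<open>1 / (1 - 2 \<mu> / r)\<close>;
  the two agree only where \<open>r\<close> does not vanish.\<close>

definition metric_diag :: "real \<Rightarrow> 4 \<Rightarrow> real^4 \<Rightarrow> real" where
  "metric_diag \<mu> i y =
     (if i = 0 then - (1 - 2 * \<mu> / y $ 1)
      else if i = 1 then y $ 1 / (y $ 1 - 2 * \<mu>)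
      else if i = 2 then (y $ 1)\<^sup>2
      else (y $ 1)\<^sup>2 * (sin (y $ 2))\<^sup>2)"

lemma schw_metric_nth:
  assumes "y \<in> exterior \<mu>" "\<mu> > 0"
  shows "schw_metric \<mu> y $ i $ j = (if i = j then metric_diag \<mu> i y else 0)"
  using assms by (auto simp: schw_metric_def metric_diag_def schw_a_def exterior_def field_simps)

lemma metric_diag_nonzero:
  assumes "y \<in> exterior \<mu>" "\<mu> > 0"
  shows "metric_diag \<mu> i y \<noteq> 0"
  using assms by (auto simp: metric_diag_def exterior_def field_simps)

lemma inv_metric_nth:
  assumes "y \<in> exterior \<mu>" "\<mu> > 0"
  shows "inv_metric \<mu> y $ i $ j = (if i = j then 1 / metric_diag \<mu> i y else 0)"
proof -
  let ?B = "\<chi> i j. if i = j then 1 / metric_diag \<mu> i y else 0"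
  have AB: "schw_metric \<mu> y ** ?B = mat 1" "?B ** schw_metric \<mu> y = mat 1"
    using metric_diag_nonzero[OF assms]
    by (simp_all add: matrix_matrix_mult_def schw_metric_nth[OF assms] mat_def vec_eq_iff
          forall_4_0 sum_4_0)
  \<comment> \<open>\<open>matrix_inv\<close> is a choice among two-sided inverses. The matrix
    \<open>?B\<close> shows that there is one, and associativity identifies the chosen matrix with
    \<open>?B\<close>.\<close>
  have "\<exists>B. schw_metric \<mu> y ** B = mat 1 \<and> B ** schw_metric \<mu> y = mat 1"
    by (intro exI[of _ ?B] conjI AB)
  from someI_ex[OF this] have inv: "schw_metric \<mu> y ** matrix_inv (schw_metric \<mu> y) = mat 1"
    unfolding matrix_inv_def by (rule conjunct1)
  have "matrix_inv (schw_metric \<mu> y) = (?B ** schw_metric \<mu> y) ** matrix_inv (schw_metric \<mu> y)"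
    unfolding AB(2) by (rule matrix_mul_lid[symmetric])
  also have "\<dots> = ?B"
    by (simp only: matrix_mul_assoc[symmetric] inv matrix_mul_rid)
  finally show ?thesis by (simp add: inv_metric_def)
qed

definition metric_diag_grad :: "real \<Rightarrow> 4 \<Rightarrow> 4 \<Rightarrow> real^4 \<Rightarrow> real" where
  "metric_diag_grad \<mu> i \<nu> y =
     (if (i, \<nu>) = (0, 1) then - (2 * \<mu> / (y $ 1)\<^sup>2)
      else if (i, \<nu>) = (1, 1) then - (2 * \<mu> / (y $ 1 - 2 * \<mu>)\<^sup>2)
      else if (i, \<nu>) = (2, 1) then 2 * y $ 1
      else if (i, \<nu>) = (3, 1) then 2 * y $ 1 * (sin (y $ 2))\<^sup>2
      else if (i, \<nu>) = (3, 2) then 2 * (y $ 1)\<^sup>2 * sin (y $ 2) * cos (y $ 2)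
      else 0)"

lemma metric_diag_has_derivative:
  assumes "y \<in> exterior \<mu>" "\<mu> > 0"
  shows "(metric_diag \<mu> i has_derivative
     (\<lambda>h. metric_diag_grad \<mu> i 1 y * h $ 1 + metric_diag_grad \<mu> i 2 y * h $ 2)) (at y)"
proof -
  have nz: "y $ 1 \<noteq> 0" "y $ 1 - 2 * \<mu> \<noteq> 0" using assms by (auto simp: exterior_def)
  show ?thesis
  proof (cases i rule: exhaust_4_0)
    case 1
    show ?thesis unfolding metric_diag_def metric_diag_grad_def 1
      using nz by (auto intro!: derivative_eq_intros ext simp: field_simps power2_eq_square)
  next
    case 2
    show ?thesis unfolding metric_diag_def metric_diag_grad_def 2
      using nz by (auto intro!: derivative_eq_intros ext simp: divide_simps power2_eq_square)
        (simp_all add: algebra_simps)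
  next
    case 3
    show ?thesis unfolding metric_diag_def metric_diag_grad_def 3
      using nz by (auto intro!: derivative_eq_intros ext simp: field_simps power2_eq_square)
  next
    case 4
    show ?thesis unfolding metric_diag_def metric_diag_grad_def 4
      using nz by (auto intro!: derivative_eq_intros ext simp: field_simps power2_eq_square)
  qed
qed

lemma gradient_schw_metric:
  assumes "y \<in> exterior \<mu>" "\<mu> > 0"
  shows "gradient (\<lambda>z. schw_metric \<mu> z $ i $ j) y $ \<nu>
    = (if i = j then metric_diag_grad \<mu> i \<nu> y else 0)"
proof -
  have "gradient (\<lambda>z. schw_metric \<mu> z $ i $ j) y
      = gradient (\<lambda>z. if i = j then metric_diag \<mu> i z else 0) y"
    by (rule gradient_cong[OF _ open_exterior assms(1)]) (simp add: schw_metric_nth assms(2))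
  moreover have "gradient (metric_diag \<mu> i) y $ \<nu> = metric_diag_grad \<mu> i \<nu> y"
    unfolding gradient_nth[OF metric_diag_has_derivative[OF assms]]
    by (cases \<nu> rule: exhaust_4_0) (auto simp: axis_def metric_diag_grad_def)
  ultimately show ?thesis by (cases "i = j") (simp_all add: gradient_const)
qed

text \<open>The classical list of Christoffel symbols of the Schwarzschild metric.
  \<open>\<Gamma>^l_{1l} = 1/r\<close> for \<open>l = 2\<close> and \<open>l = 3\<close> shares one
  branch, tested before the branches specific to these two values.\<close>

definition christoffel_table :: "real \<Rightarrow> 4 \<Rightarrow> 4 \<Rightarrow> 4 \<Rightarrow> real^4 \<Rightarrow> real" where
  "christoffel_table \<mu> l \<alpha> \<beta> y = (if l = 0 then
       (if \<alpha> = 0 \<and> \<beta> = 1 \<or> \<alpha> = 1 \<and> \<beta> = 0 then \<mu> / (y $ 1 * (y $ 1 - 2 * \<mu>)) else 0)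
     else if l = 1 then
       (if \<alpha> \<noteq> \<beta> then 0
        else if \<alpha> = 0 then \<mu> * (y $ 1 - 2 * \<mu>) / (y $ 1) ^ 3
        else if \<alpha> = 1 then - (\<mu> / (y $ 1 * (y $ 1 - 2 * \<mu>)))
        else if \<alpha> = 2 then - (y $ 1 - 2 * \<mu>)
        else - (y $ 1 - 2 * \<mu>) * (sin (y $ 2))\<^sup>2)
     else if \<alpha> = 1 \<and> \<beta> = l \<or> \<alpha> = l \<and> \<beta> = 1 then 1 / y $ 1
     else if l = 2 then (if \<alpha> = 3 \<and> \<beta> = 3 then - (sin (y $ 2) * cos (y $ 2)) else 0)
     else (if \<alpha> = 2 \<and> \<beta> = 3 \<or> \<alpha> = 3 \<and> \<beta> = 2 then cos (y $ 2) / sin (y $ 2) else 0))"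

lemma christoffel_eq:
  assumes "y \<in> exterior \<mu>" "\<mu> > 0"
  shows "christoffel \<mu> l \<alpha> \<beta> y = christoffel_table \<mu> l \<alpha> \<beta> y"
proof -
  have nz: "y $ 1 \<noteq> 0" "y $ 1 - 2 * \<mu> \<noteq> 0" "sin (y $ 2) \<noteq> 0" "y $ 1 \<noteq> 2 * \<mu>"
    using assms by (auto simp: exterior_def)
  \<comment> \<open>For a diagonal metric the contraction over \<open>\<nu>\<close> keeps only
    \<open>\<nu> = l\<close>, and each of the three derivative terms survives only when its two
    metric indices coincide.\<close>
  have "christoffel \<mu> l \<alpha> \<beta> y = 1 / (2 * metric_diag \<mu> l y) *
     ((if l = \<beta> then metric_diag_grad \<mu> l \<alpha> y else 0) + (if l = \<alpha> then metric_diag_grad \<mu> l \<beta> y else 0)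
      - (if \<alpha> = \<beta> then metric_diag_grad \<mu> \<alpha> l y else 0))"
    by (cases l rule: exhaust_4_0)
      (simp_all add: christoffel_def sum_4_0 inv_metric_nth[OF assms] gradient_schw_metric[OF assms])
  also have "\<dots> = christoffel_table \<mu> l \<alpha> \<beta> y"
  proof (cases l rule: exhaust_4_0)
    case 1
    show ?thesis unfolding 1
      by (cases \<alpha> rule: exhaust_4_0; cases \<beta> rule: exhaust_4_0)
        (use nz in \<open>simp_all add: christoffel_table_def metric_diag_def metric_diag_grad_def divide_simps power2_eq_square\<close>)
  next
    case 2
    show ?thesis unfolding 2
      by (cases \<alpha> rule: exhaust_4_0; cases \<beta> rule: exhaust_4_0)
        (use nz in \<open>simp_all add: christoffel_table_def metric_diag_def metric_diag_grad_def divide_simps eval_nat_numeral,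
          simp add: algebra_simps\<close>)
  next
    case 3
    show ?thesis unfolding 3
      by (cases \<alpha> rule: exhaust_4_0; cases \<beta> rule: exhaust_4_0)
        (use nz in \<open>simp_all add: christoffel_table_def metric_diag_def metric_diag_grad_def divide_simps power2_eq_square\<close>)
  next
    case 4
    show ?thesis unfolding 4
      by (cases \<alpha> rule: exhaust_4_0; cases \<beta> rule: exhaust_4_0)
        (use nz in \<open>simp_all add: christoffel_table_def metric_diag_def metric_diag_grad_def divide_simps power2_eq_square\<close>)
  qed
  finally show ?thesis .
qed

text \<open>\<open>\<nu>\<close> is the direction of differentiation. The symbols depend on
  \<open>r\<close> and \<open>\<theta>\<close> alone, so the directions 0 and 3 give 0.\<close>

definition christoffel_grad_table :: "real \<Rightarrow> 4 \<Rightarrow> 4 \<Rightarrow> 4 \<Rightarrow> 4 \<Rightarrow> real^4 \<Rightarrow> real" where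
  "christoffel_grad_table \<mu> l \<alpha> \<beta> \<nu> y = (if \<nu> = 1 then
       (if l = 0 then
          (if \<alpha> = 0 \<and> \<beta> = 1 \<or> \<alpha> = 1 \<and> \<beta> = 0 then - (2 * \<mu> * (y $ 1 - \<mu>) / (y $ 1 * (y $ 1 - 2 * \<mu>))\<^sup>2)
           else 0)
        else if l = 1 then
          (if \<alpha> \<noteq> \<beta> then 0
           else if \<alpha> = 0 then 2 * \<mu> * (3 * \<mu> - y $ 1) / (y $ 1) ^ 4
           else if \<alpha> = 1 then 2 * \<mu> * (y $ 1 - \<mu>) / (y $ 1 * (y $ 1 - 2 * \<mu>))\<^sup>2
           else if \<alpha> = 2 then - 1
           else - (sin (y $ 2))\<^sup>2)
        else if \<alpha> = 1 \<and> \<beta> = l \<or> \<alpha> = l \<and> \<beta> = 1 then - (1 / (y $ 1)\<^sup>2)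
        else 0)
     else if \<nu> = 2 then
       (if l = 1 \<and> \<alpha> = 3 \<and> \<beta> = 3 then - 2 * (y $ 1 - 2 * \<mu>) * sin (y $ 2) * cos (y $ 2)
        else if l = 2 \<and> \<alpha> = 3 \<and> \<beta> = 3 then (sin (y $ 2))\<^sup>2 - (cos (y $ 2))\<^sup>2
        else if l = 3 \<and> (\<alpha> = 2 \<and> \<beta> = 3 \<or> \<alpha> = 3 \<and> \<beta> = 2) then - (1 / (sin (y $ 2))\<^sup>2)
        else 0)
     else 0)"

lemma christoffel_table_has_derivative:
  assumes "y \<in> exterior \<mu>" "\<mu> > 0"
  shows "(christoffel_table \<mu> l \<alpha> \<beta> has_derivative
     (\<lambda>h. christoffel_grad_table \<mu> l \<alpha> \<beta> 1 y * h $ 1 + christoffel_grad_table \<mu> l \<alpha> \<beta> 2 y * h $ 2)) (at y)"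
proof -
  have nz: "y $ 1 \<noteq> 0" "y $ 1 - 2 * \<mu> \<noteq> 0" "sin (y $ 2) \<noteq> 0" "y $ 1 \<noteq> 2 * \<mu>"
    using assms by (auto simp: exterior_def)
  \<comment> \<open>Apart from zero entries, the table contains only the eight functions
    differentiated in \<open>d1\<close> to \<open>d8\<close>.\<close>
  have d1: "((\<lambda>y::real^4. \<mu> / (y $ 1 * (y $ 1 - 2 * \<mu>))) has_derivative
      (\<lambda>h. - (2 * \<mu> * (y $ 1 - \<mu>) / (y $ 1 * (y $ 1 - 2 * \<mu>))\<^sup>2) * h $ 1)) (at y)"
    using nz by (auto intro!: derivative_eq_intros ext simp: divide_simps)
       (simp_all add: algebra_simps power2_eq_square)
  have d2: "((\<lambda>y::real^4. \<mu> * (y $ 1 - 2 * \<mu>) / y $ 1 ^ 3) has_derivative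
      (\<lambda>h. 2 * \<mu> * (3 * \<mu> - y $ 1) / y $ 1 ^ 4 * h $ 1)) (at y)"
    using nz by (auto intro!: derivative_eq_intros ext simp: divide_simps)
       (simp_all add: algebra_simps power2_eq_square eval_nat_numeral)
  have d3: "((\<lambda>y::real^4. 1 / y $ 1) has_derivative (\<lambda>h. - (1 / (y $ 1)\<^sup>2) * h $ 1)) (at y)"
    using nz by (auto intro!: derivative_eq_intros ext simp: divide_simps)
       (simp_all add: algebra_simps power2_eq_square)
  have sc: "cos (y $ 2) * cos (y $ 2) = 1 - sin (y $ 2) * sin (y $ 2)"
    using sin_cos_squared_add[of "y $ 2"] by (simp add: power2_eq_square)
  have d4: "((\<lambda>y::real^4. cos (y $ 2) / sin (y $ 2)) has_derivative
      (\<lambda>h. - (1 / (sin (y $ 2))\<^sup>2) * h $ 2)) (at y)"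
    using nz by (auto intro!: derivative_eq_intros ext simp: divide_simps power2_eq_square)
       (simp_all add: algebra_simps sc)
  have d5: "((\<lambda>y::real^4. - (sin (y $ 2) * cos (y $ 2))) has_derivative
      (\<lambda>h. ((sin (y $ 2))\<^sup>2 - (cos (y $ 2))\<^sup>2) * h $ 2)) (at y)"
    using nz by (auto intro!: derivative_eq_intros ext simp: power2_eq_square algebra_simps)
  have d6: "((\<lambda>y::real^4. - (y $ 1 - 2 * \<mu>) * (sin (y $ 2))\<^sup>2) has_derivative
      (\<lambda>h. - (sin (y $ 2))\<^sup>2 * h $ 1 + - 2 * (y $ 1 - 2 * \<mu>) * sin (y $ 2) * cos (y $ 2) * h $ 2)) (at y)"
    using nz by (auto intro!: derivative_eq_intros ext simp: power2_eq_square algebra_simps)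
  have d7: "((\<lambda>y::real^4. - (\<mu> / (y $ 1 * (y $ 1 - 2 * \<mu>)))) has_derivative
      (\<lambda>h. 2 * \<mu> * (y $ 1 - \<mu>) / (y $ 1 * (y $ 1 - 2 * \<mu>))\<^sup>2 * h $ 1)) (at y)"
    using has_derivative_minus[OF d1] by simp
  have d8: "((\<lambda>y::real^4. - (y $ 1 - 2 * \<mu>)) has_derivative (\<lambda>h. - 1 * h $ 1)) (at y)"
    by (auto intro!: derivative_eq_intros ext)
  show ?thesis
  proof (cases l rule: exhaust_4_0)
    case 1
    show ?thesis unfolding 1 using d1
      by (cases \<alpha> rule: exhaust_4_0; cases \<beta> rule: exhaust_4_0)
        (simp_all add: christoffel_table_def[abs_def] christoffel_grad_table_def)
  next
    case 2
    show ?thesis unfolding 2 using d2 d6 d7 d8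
      by (cases \<alpha> rule: exhaust_4_0; cases \<beta> rule: exhaust_4_0)
        (simp_all add: christoffel_table_def[abs_def] christoffel_grad_table_def)
  next
    case 3
    show ?thesis unfolding 3 using d3 d5
      by (cases \<alpha> rule: exhaust_4_0; cases \<beta> rule: exhaust_4_0)
        (simp_all add: christoffel_table_def[abs_def] christoffel_grad_table_def)
  next
    case 4
    show ?thesis unfolding 4 using d3 d4
      by (cases \<alpha> rule: exhaust_4_0; cases \<beta> rule: exhaust_4_0)
        (simp_all add: christoffel_table_def[abs_def] christoffel_grad_table_def)
  qed
qed

lemma gradient_christoffel:
  assumes "y \<in> exterior \<mu>" "\<mu> > 0"
  shows "gradient (christoffel \<mu> l \<alpha> \<beta>) y $ \<nu> = christoffel_grad_table \<mu> l \<alpha> \<beta> \<nu> y"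
proof -
  have "gradient (christoffel \<mu> l \<alpha> \<beta>) y = gradient (christoffel_table \<mu> l \<alpha> \<beta>) y"
    by (rule gradient_cong[OF _ open_exterior assms(1)]) (simp add: christoffel_eq assms(2))
  then show ?thesis
    unfolding gradient_nth[OF christoffel_table_has_derivative[OF assms]]
    by (cases \<nu> rule: exhaust_4_0) (simp_all add: gradient_nth[OF christoffel_table_has_derivative[OF assms]] axis_def christoffel_grad_table_def)
qed

text \<open>The curvature operator of the Schwarzschild metric is diagonal in the orthonormal frame, with the
  eigenvalues \<open>2 \<mu> / r^3\<close> on the planes 01 and 23, and \<open>- \<mu> / r^3\<close> on the four other coordinate planes.\<close>

definition curvature_factor :: "4 \<Rightarrow> 4 \<Rightarrow> real" where
  "curvature_factor i j = (if i = j then 0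
     else if i = 0 \<and> j = 1 \<or> i = 1 \<and> j = 0 \<or> i = 2 \<and> j = 3 \<or> i = 3 \<and> j = 2 then 2
     else - 1)"

text \<open>The curvature operator is diagonal, so a component survives only if the pairs
  \<open>(\<kappa>, \<nu>)\<close> and \<open>(\<alpha>, \<beta>)\<close> span the same coordinate
  plane; the result has the shape of a constant curvature tensor whose curvature depends on the
  plane. All \<open>4^4\<close> index combinations are compared with the tables.\<close>

lemma riemann_up_eq:
  assumes "y \<in> exterior \<mu>" "\<mu> > 0"
  shows "riemann_up \<mu> \<kappa> \<nu> \<alpha> \<beta> y =
     \<mu> / (y $ 1) ^ 3 * curvature_factor \<kappa> \<nu> * metric_diag \<mu> \<nu> y *
     ((if \<kappa> = \<alpha> \<and> \<nu> = \<beta> then 1 else 0) - (if \<kappa> = \<beta> \<and> \<nu> = \<alpha> then 1 else 0))"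
proof -
  have nz: "y $ 1 \<noteq> 0" "y $ 1 \<noteq> 2 * \<mu>" "sin (y $ 2) \<noteq> 0"
    using assms by (auto simp: exterior_def)
  have sc: "cos (y $ 2) * cos (y $ 2) = 1 - sin (y $ 2) * sin (y $ 2)"
    using sin_cos_squared_add[of "y $ 2"] by (simp add: power2_eq_square)
  show ?thesis
    unfolding riemann_up_def gradient_christoffel[OF assms] christoffel_eq[OF assms] sum_4_0
    by (cases \<kappa> rule: exhaust_4_0; cases \<nu> rule: exhaust_4_0;
        cases \<alpha> rule: exhaust_4_0; cases \<beta> rule: exhaust_4_0;
        simp add: christoffel_table_def christoffel_grad_table_def metric_diag_def curvature_factor_def;
        (simp add: nz sc eval_nat_numeral; (simp add: divide_simps nz; simp add: algebra_simps sc)?)?)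
qed

lemma riemann_eq:
  assumes "y \<in> exterior \<mu>" "\<mu> > 0"
  shows "riemann \<mu> \<gamma> \<nu> \<alpha> \<beta> y =
     \<mu> / (y $ 1) ^ 3 * curvature_factor \<gamma> \<nu> * metric_diag \<mu> \<gamma> y * metric_diag \<mu> \<nu> y *
     ((if \<gamma> = \<alpha> \<and> \<nu> = \<beta> then 1 else 0) - (if \<gamma> = \<beta> \<and> \<nu> = \<alpha> then 1 else 0))"
proof -
  have "riemann \<mu> \<gamma> \<nu> \<alpha> \<beta> y = metric_diag \<mu> \<gamma> y * riemann_up \<mu> \<gamma> \<nu> \<alpha> \<beta> y"
    unfolding riemann_def
    by (cases \<gamma> rule: exhaust_4_0) (simp_all add: sum_4_0 schw_metric_nth[OF assms])
  then show ?thesis by (simp add: riemann_up_eq[OF assms])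
qed


section \<open>The Hamiltonian in the orthonormal frame\<close>

definition eta :: "4 \<Rightarrow> real" where "eta i = (if i = 0 then - 1 else 1)"

text \<open>The components \<open>p_A = e_A^\<alpha> p_\<alpha>\<close>; the tetrad is diagonal, so
  each has a single term.\<close>

definition frame_momentum :: "real \<Rightarrow> phase \<Rightarrow> 4 \<Rightarrow> real" where
  "frame_momentum \<mu> x i = tetrad \<mu> (phy x) $ i $ i * momentum \<mu> x $ i"

text \<open>Orthonormality of the tetrad. Through it the coordinate factors of the metric cancel and
  only the Minkowski signs \<open>eta\<close> remain.\<close>

lemma tetrad_metric:
  assumes "y \<in> exterior \<mu>" "\<mu> > 0"
  shows "(tetrad \<mu> y $ i $ i)\<^sup>2 * metric_diag \<mu> i y = eta i"
proof -
  have "y $ 1 > 0" "y $ 1 > 2 * \<mu>" "sin (y $ 2) \<noteq> 0"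
    using assms by (auto simp: exterior_def)
  then show ?thesis
    by (cases i rule: exhaust_4_0)
      (simp_all add: tetrad_def metric_diag_def eta_def schw_a_def power_divide power_mult_distrib divide_simps)
qed

lemma spin_eq: "spin \<mu> x \<alpha> \<beta> = spin_frame x \<alpha> \<beta> * tetrad \<mu> (phy x) $ \<alpha> $ \<alpha> * tetrad \<mu> (phy x) $ \<beta> $ \<beta>"
proof -
  have tet: "tetrad \<mu> (phy x) $ A $ \<alpha> = (if A = \<alpha> then tetrad \<mu> (phy x) $ \<alpha> $ \<alpha> else 0)" for A \<alpha>
    by (auto simp: tetrad_def)
  have "spin \<mu> x \<alpha> \<beta> = (\<Sum>A\<in>UNIV. \<Sum>B\<in>UNIV. if B = \<beta> then (if A = \<alpha> then
     spin_frame x A \<beta> * tetrad \<mu> (phy x) $ \<alpha> $ \<alpha> * tetrad \<mu> (phy x) $ \<beta> $ \<beta> else 0) else 0)"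
    unfolding spin_def by (intro sum.cong refl) (subst (1 2) tet, simp)
  then show ?thesis by simp
qed

lemma inverse_metric_eq:
  assumes "y \<in> exterior \<mu>" "\<mu> > 0"
  shows "1 / metric_diag \<mu> i y = eta i * (tetrad \<mu> y $ i $ i)\<^sup>2"
  using tetrad_metric[OF assms, of i] metric_diag_nonzero[OF assms, of i]
  by (auto simp: divide_simps eta_def split: if_splits)

lemma sum_sum_delta_4:
  fixes a b :: 4
  shows "(\<Sum>\<kappa>\<in>UNIV. \<Sum>\<nu>\<in>UNIV. if \<kappa> = a then if \<nu> = b then c else 0 else 0) = (c::real)"
  by (cases a rule: exhaust_4_0; cases b rule: exhaust_4_0) (simp_all add: sum_4_0)

text \<open>The two delta terms of the curvature tensor contract with the antisymmetric
  \<open>spin\<close> to equal contributions, which gives the factor 2. The metric factor of the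
  summation index is absorbed by the two tetrad factors with the same index and leaves
  \<open>eta \<gamma>\<close>.\<close>

lemma Dmix_eq:
  assumes "phy x \<in> exterior \<mu>" "\<mu> > 0"
  shows "Dmix \<mu> x \<alpha> \<beta> = 2 * \<mu> / (rad x) ^ 3 * metric_diag \<mu> \<beta> (phy x) *
     tetrad \<mu> (phy x) $ \<alpha> $ \<alpha> * tetrad \<mu> (phy x) $ \<beta> $ \<beta> *
     (\<Sum>\<gamma>\<in>UNIV. curvature_factor \<gamma> \<beta> * eta \<gamma> * spin_frame x \<alpha> \<gamma> * spin_frame x \<gamma> \<beta>)"
proof -
  have "(\<Sum>\<kappa>\<in>UNIV. \<Sum>\<nu>\<in>UNIV. spin \<mu> x \<alpha> \<gamma> * riemann \<mu> \<gamma> \<beta> \<kappa> \<nu> (phy x) * spin \<mu> x \<kappa> \<nu>)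
      = 2 * \<mu> / (rad x) ^ 3 * metric_diag \<mu> \<beta> (phy x) *
     tetrad \<mu> (phy x) $ \<alpha> $ \<alpha> * tetrad \<mu> (phy x) $ \<beta> $ \<beta> *
     (curvature_factor \<gamma> \<beta> * eta \<gamma> * spin_frame x \<alpha> \<gamma> * spin_frame x \<gamma> \<beta>)" for \<gamma>
  proof -
    have anti: "spin \<mu> x \<beta> \<gamma> = - spin \<mu> x \<gamma> \<beta>"
      by (simp add: spin_eq spin_frame_def Let_def)
    have "(\<Sum>\<kappa>\<in>UNIV. \<Sum>\<nu>\<in>UNIV. spin \<mu> x \<alpha> \<gamma> * riemann \<mu> \<gamma> \<beta> \<kappa> \<nu> (phy x) * spin \<mu> x \<kappa> \<nu>)
      = (\<Sum>\<kappa>\<in>UNIV. \<Sum>\<nu>\<in>UNIV. (if \<kappa> = \<gamma> then if \<nu> = \<beta> then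
          spin \<mu> x \<alpha> \<gamma> * (\<mu> / (rad x) ^ 3 * curvature_factor \<gamma> \<beta> * metric_diag \<mu> \<gamma> (phy x) * metric_diag \<mu> \<beta> (phy x)) * spin \<mu> x \<gamma> \<beta> else 0 else 0))
       - (\<Sum>\<kappa>\<in>UNIV. \<Sum>\<nu>\<in>UNIV. (if \<kappa> = \<beta> then if \<nu> = \<gamma> then
          spin \<mu> x \<alpha> \<gamma> * (\<mu> / (rad x) ^ 3 * curvature_factor \<gamma> \<beta> * metric_diag \<mu> \<gamma> (phy x) * metric_diag \<mu> \<beta> (phy x)) * spin \<mu> x \<beta> \<gamma> else 0 else 0))"
      unfolding sum_subtractf[symmetric] riemann_eq[OF assms] rad_def
      by (intro sum.cong refl) (auto simp: algebra_simps)
    also have "\<dots> = spin \<mu> x \<alpha> \<gamma> * (\<mu> / (rad x) ^ 3 * curvature_factor \<gamma> \<beta> * metric_diag \<mu> \<gamma> (phy x) * metric_diag \<mu> \<beta> (phy x))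
        * (2 * spin \<mu> x \<gamma> \<beta>)"
      unfolding sum_sum_delta_4 by (simp add: anti)
    also have "\<dots> = 2 * \<mu> / (rad x) ^ 3 * metric_diag \<mu> \<beta> (phy x) *
     tetrad \<mu> (phy x) $ \<alpha> $ \<alpha> * tetrad \<mu> (phy x) $ \<beta> $ \<beta> *
     (curvature_factor \<gamma> \<beta> * ((tetrad \<mu> (phy x) $ \<gamma> $ \<gamma>)\<^sup>2 * metric_diag \<mu> \<gamma> (phy x)) * spin_frame x \<alpha> \<gamma> * spin_frame x \<gamma> \<beta>)"
      by (simp add: spin_eq power2_eq_square)
    finally show ?thesis unfolding tetrad_metric[OF assms] .
  qed
  then show ?thesis
    unfolding Dmix_def by (simp add: sum_distrib_left)
qed

text \<open>The frame expression of \<open>D^{AB} q_A q_B\<close> without the factor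
  \<open>2 \<mu> / r^3\<close>. \<open>D^{AB}\<close> need not be symmetric; each mixed coefficient
  is the sum of the entries \<open>AB\<close> and \<open>BA\<close>.\<close>

definition spin_quad :: "real^3 \<Rightarrow> real^3 \<Rightarrow> (4 \<Rightarrow> real) \<Rightarrow> real" where
  "spin_quad L M q =
     (- 2 * (M $ 1)\<^sup>2 + (M $ 2)\<^sup>2 + (M $ 3)\<^sup>2) * (q 0)\<^sup>2
   + (2 * (M $ 1)\<^sup>2 + (L $ 2)\<^sup>2 + (L $ 3)\<^sup>2) * (q 1)\<^sup>2
   + ((L $ 3)\<^sup>2 - (M $ 2)\<^sup>2 - 2 * (L $ 1)\<^sup>2) * (q 2)\<^sup>2
   + ((L $ 2)\<^sup>2 - (M $ 3)\<^sup>2 - 2 * (L $ 1)\<^sup>2) * (q 3)\<^sup>2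
   + 2 * (M $ 2 * L $ 3 - M $ 3 * L $ 2) * q 0 * q 1
   + (M $ 1 * L $ 3 - M $ 3 * L $ 1) * q 0 * q 2
   + (M $ 2 * L $ 1 - M $ 1 * L $ 2) * q 0 * q 3
   + (M $ 1 * M $ 2 + L $ 1 * L $ 2) * q 1 * q 2
   + (M $ 1 * M $ 3 + L $ 1 * L $ 3) * q 1 * q 3
   - 2 * (M $ 2 * M $ 3 + L $ 2 * L $ 3) * q 2 * q 3"

text \<open>The scalar \<open>d\<close> without the factor \<open>2 \<mu> / r^3\<close>.\<close>

definition spin_trace :: "real^3 \<Rightarrow> real^3 \<Rightarrow> real" where
  "spin_trace L M = 2 * (M $ 1)\<^sup>2 - (M $ 2)\<^sup>2 - (M $ 3)\<^sup>2 - 2 * (L $ 1)\<^sup>2 + (L $ 2)\<^sup>2 + (L $ 3)\<^sup>2"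

lemma spin_frame_values:
  "spin_frame x 0 1 = phM x $ 1" "spin_frame x 0 2 = phM x $ 2" "spin_frame x 0 3 = phM x $ 3"
  "spin_frame x 1 0 = - phM x $ 1" "spin_frame x 2 0 = - phM x $ 2" "spin_frame x 3 0 = - phM x $ 3"
  "spin_frame x 2 3 = phL x $ 1" "spin_frame x 3 1 = phL x $ 2" "spin_frame x 1 2 = phL x $ 3"
  "spin_frame x 3 2 = - phL x $ 1" "spin_frame x 1 3 = - phL x $ 2" "spin_frame x 2 1 = - phL x $ 3"
  "spin_frame x A A = 0"
  by (simp_all add: spin_frame_def)

lemma d_scal_eq:
  assumes "phy x \<in> exterior \<mu>" "\<mu> > 0"
  shows "d_scal \<mu> x = 2 * \<mu> / (rad x) ^ 3 * spin_trace (phL x) (phM x)"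
proof -
  have "Dmix \<mu> x \<alpha> \<alpha> = 2 * \<mu> / (rad x) ^ 3 * (eta \<alpha> *
     (\<Sum>\<gamma>\<in>UNIV. curvature_factor \<gamma> \<alpha> * eta \<gamma> * spin_frame x \<alpha> \<gamma> * spin_frame x \<gamma> \<alpha>))" for \<alpha>
    unfolding Dmix_eq[OF assms] tetrad_metric[OF assms, symmetric] by (simp add: power2_eq_square)
  moreover have "(\<Sum>\<alpha>\<in>UNIV. eta \<alpha> *
     (\<Sum>\<gamma>\<in>UNIV. curvature_factor \<gamma> \<alpha> * eta \<gamma> * spin_frame x \<alpha> \<gamma> * spin_frame x \<gamma> \<alpha>))
     = 2 * spin_trace (phL x) (phM x)"
    by (simp add: sum_4_0 spin_frame_values curvature_factor_def eta_def spin_trace_def power2_eq_square)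
  ultimately show ?thesis
    by (simp only: d_scal_def sum_distrib_left[symmetric])
qed

lemma p_sq_frame:
  assumes "phy x \<in> exterior \<mu>" "\<mu> > 0"
  shows "p_sq \<mu> x = - (frame_momentum \<mu> x 0)\<^sup>2 + (frame_momentum \<mu> x 1)\<^sup>2
     + (frame_momentum \<mu> x 2)\<^sup>2 + (frame_momentum \<mu> x 3)\<^sup>2"
  unfolding p_sq_def inv_metric_nth[OF assms] inverse_metric_eq[OF assms]
  by (simp add: sum_4_0 frame_momentum_def eta_def power2_eq_square)

lemma Dup_frame:
  assumes "phy x \<in> exterior \<mu>" "\<mu> > 0"
  shows "(\<Sum>\<alpha>\<in>UNIV. \<Sum>\<beta>\<in>UNIV. Dup \<mu> x \<alpha> \<beta> * momentum \<mu> x $ \<alpha> * momentum \<mu> x $ \<beta>)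
     = 2 * \<mu> / (rad x) ^ 3 * spin_quad (phL x) (phM x) (frame_momentum \<mu> x)"
proof -
  have "Dup \<mu> x \<alpha> \<beta> * momentum \<mu> x $ \<alpha> * momentum \<mu> x $ \<beta> = 2 * \<mu> / (rad x) ^ 3 *
     ((\<Sum>\<gamma>\<in>UNIV. curvature_factor \<gamma> \<beta> * eta \<gamma> * spin_frame x \<alpha> \<gamma> * spin_frame x \<gamma> \<beta>)
      * frame_momentum \<mu> x \<alpha> * frame_momentum \<mu> x \<beta>)" for \<alpha> \<beta>
  proof -
    have "Dup \<mu> x \<alpha> \<beta> = Dmix \<mu> x \<alpha> \<beta> / metric_diag \<mu> \<beta> (phy x)"
      unfolding Dup_def inv_metric_nth[OF assms]
      by (cases \<beta> rule: exhaust_4_0) (simp_all add: sum_4_0)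
    also have "\<dots> = 2 * \<mu> / (rad x) ^ 3 *
     tetrad \<mu> (phy x) $ \<alpha> $ \<alpha> * tetrad \<mu> (phy x) $ \<beta> $ \<beta> *
     (\<Sum>\<gamma>\<in>UNIV. curvature_factor \<gamma> \<beta> * eta \<gamma> * spin_frame x \<alpha> \<gamma> * spin_frame x \<gamma> \<beta>)"
      unfolding Dmix_eq[OF assms] using metric_diag_nonzero[OF assms, of \<beta>] by simp
    finally show ?thesis by (simp add: frame_momentum_def)
  qed
  moreover have "(\<Sum>\<alpha>\<in>UNIV. \<Sum>\<beta>\<in>UNIV.
     (\<Sum>\<gamma>\<in>UNIV. curvature_factor \<gamma> \<beta> * eta \<gamma> * spin_frame x \<alpha> \<gamma> * spin_frame x \<gamma> \<beta>)
      * frame_momentum \<mu> x \<alpha> * frame_momentum \<mu> x \<beta>)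
      = spin_quad (phL x) (phM x) (frame_momentum \<mu> x)"
    by (simp add: sum_4_0 spin_frame_values curvature_factor_def eta_def spin_quad_def)
      (simp add: algebra_simps power2_eq_square)
  ultimately show ?thesis
    by (simp only: sum_distrib_left[symmetric])
qed

lemma Ham_frame:
  assumes "phy x \<in> exterior \<mu>" "\<mu> > 0"
  shows "Ham \<mu> m x = p_sq \<mu> x / (2 * m)
     - 2 * \<mu> / (rad x) ^ 3 * spin_quad (phL x) (phM x) (frame_momentum \<mu> x)
       / (m * (d_scal \<mu> x + 2 * p_sq \<mu> x))"
  by (simp add: Ham_def Dup_frame[OF assms])

lemma frame_momentum_values:
  "frame_momentum \<mu> x 0 = (phP x $ 0 - \<mu> / (rad x)\<^sup>2 * phM x $ 1) / sqrt (schw_a \<mu> (rad x))"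
  "frame_momentum \<mu> x 1 = sqrt (schw_a \<mu> (rad x)) * radP x"
  "frame_momentum \<mu> x 2 = (phP x $ 2 - sqrt (schw_a \<mu> (rad x)) * phL x $ 3) / rad x"
  "frame_momentum \<mu> x 3 = (phP x $ 3 + sqrt (schw_a \<mu> (rad x)) * sin (phy x $ 2) * phL x $ 2
      - cos (phy x $ 2) * phL x $ 1) / (rad x * sin (phy x $ 2))"
  by (simp_all add: frame_momentum_def tetrad_def momentum_def rad_def radP_def Let_def)


section \<open>The Hamiltonian in the new variables\<close>

text \<open>\<open>spin_quad\<close> is invariant under rotations of the frame directions 2 and 3. Rotating the
  transversal part of \<open>L\<close> into direction 2 makes \<open>L = (e, s, 0)\<close> and, by \<open>(L, M) = 0\<close>,
  \<open>M = (- z s, e z, - k)\<close> with \<open>z = Z_1 / Z_2\<close> and \<open>k = Z_3\<close>; the frame momentum becomes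
  \<open>(q_0, q_1, - E_3 / r, \<Gamma> / r)\<close>.\<close>

definition spin_quad_red :: "real \<Rightarrow> real \<Rightarrow> real \<Rightarrow> real \<Rightarrow> real \<Rightarrow> real \<Rightarrow> real \<Rightarrow> real \<Rightarrow> real" where
  "spin_quad_red e s z k q0 q1 q2 q3 =
     (- 2 * z\<^sup>2 * s\<^sup>2 + e\<^sup>2 * z\<^sup>2 + k\<^sup>2) * q0\<^sup>2 + (2 * z\<^sup>2 * s\<^sup>2 + s\<^sup>2) * q1\<^sup>2
   - (e\<^sup>2 * z\<^sup>2 + 2 * e\<^sup>2) * q2\<^sup>2 + (s\<^sup>2 - k\<^sup>2 - 2 * e\<^sup>2) * q3\<^sup>2
   + 2 * k * s * q0 * q1 + k * e * q0 * q2 + (e\<^sup>2 * z + z * s\<^sup>2) * q0 * q3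
   + (e * s - z\<^sup>2 * s * e) * q1 * q2 + z * s * k * q1 * q3 + 2 * e * z * k * q2 * q3"

text \<open>\<open>(u, v)\<close> is the direction of the transversal part of \<open>L\<close>. The
  substitution for \<open>q 2\<close> and \<open>q 3\<close> is a reflection, while the rotated
  transversal momentum is \<open>(q2, - q3)\<close>; hence the sign in the first conclusion. All
  three identities are polynomial modulo \<open>u^2 + v^2 = 1\<close>.\<close>

lemma spin_quad_rotate:
  assumes "u\<^sup>2 + v\<^sup>2 = 1"
    and "L $ 1 = e" "L $ 2 = s * u" "L $ 3 = s * v"
    and "M $ 1 = - (z * s)" "M $ 2 = e * z * u + k * v" "M $ 3 = e * z * v - k * u"
    and "q 2 = u * q2 + v * q3" "q 3 = v * q2 - u * q3"
  shows "spin_quad L M q = spin_quad_red e s z k (q 0) (q 1) q2 (- q3)"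
    and "spin_trace L M = 2 * z\<^sup>2 * s\<^sup>2 - e\<^sup>2 * z\<^sup>2 - k\<^sup>2 - 2 * e\<^sup>2 + s\<^sup>2"
    and "(q 2)\<^sup>2 + (q 3)\<^sup>2 = q2\<^sup>2 + q3\<^sup>2"
proof -
  show "spin_trace L M = 2 * z\<^sup>2 * s\<^sup>2 - e\<^sup>2 * z\<^sup>2 - k\<^sup>2 - 2 * e\<^sup>2 + s\<^sup>2"
    unfolding spin_trace_def assms(2-) using assms(1) by algebra
  show "(q 2)\<^sup>2 + (q 3)\<^sup>2 = q2\<^sup>2 + q3\<^sup>2"
    unfolding assms(2-) using assms(1) by algebra
  show "spin_quad L M q = spin_quad_red e s z k (q 0) (q 1) q2 (- q3)"
    unfolding spin_quad_def spin_quad_red_def assms(2-) using assms(1) by algebra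
qed

text \<open>A purely algebraic comparison for free \<open>E\<close> and \<open>Z\<close>, without
  reference to a phase point. \<open>A\<close> is the root of \<open>a(r)\<close>, \<open>s\<close>
  stands for the length of the transversal part of the spin, \<open>G\<close> for
  \<open>\<Gamma>\<close> and \<open>q0\<close> for the time component of the frame momentum, so
  that \<open>\<mu> \<Theta> - r^2 \<E> = r^2 A q0\<close>.\<close>

lemma Ham_new_eq:
  fixes E Z :: "real^3"
  assumes "V \<noteq> 0" "m \<noteq> 0" "\<mu> > 0" "r > 2 * \<mu>"
    and s: "s > 0" "s\<^sup>2 = (Z $ 2)\<^sup>2 - (E $ 1)\<^sup>2" and "Z $ 2 > 0"
    and "z = Z $ 1 / Z $ 2" "A = sqrt (schw_a \<mu> r)"
    and "q0 = (\<mu> * z * s - r\<^sup>2 * \<E>) / (r\<^sup>2 * A)" "G = A * s - E $ 2"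
  shows "Ham_new \<mu> m \<E> V E Z r p =
     ((- q0\<^sup>2 + (A * p)\<^sup>2 + (E $ 3 / r)\<^sup>2 + (G / r)\<^sup>2) / 2
      + spin_quad_red (E $ 1) s z (Z $ 3) q0 (A * p) (- (E $ 3 / r)) (G / r) / V) / m"
    and "mass_sq \<mu> \<E> E Z r p = q0\<^sup>2 - (A * p)\<^sup>2 - (E $ 3 / r)\<^sup>2 - (G / r)\<^sup>2"
    and "Vfun \<mu> msq E Z r = msq / \<mu> * r ^ 3
       - (2 * z\<^sup>2 * s\<^sup>2 - (E $ 1)\<^sup>2 * z\<^sup>2 - (Z $ 3)\<^sup>2 - 2 * (E $ 1)\<^sup>2 + s\<^sup>2)"
proof -
  have r: "r > 0" "r - 2 * \<mu> > 0" using assms by auto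
  have apos: "schw_a \<mu> r > 0" using r by (simp add: schw_a_def field_simps)
  have A: "A > 0" "A\<^sup>2 = schw_a \<mu> r" using apos assms by auto
  \<comment> \<open>With this identity both \<open>r - 2 \<mu>\<close> and the root of
    \<open>r (r - 2 \<mu>)\<close> become monomials in \<open>A\<close> and
    \<open>r\<close>.\<close>
  have rA: "r - 2 * \<mu> = A\<^sup>2 * r" using r unfolding A by (simp add: schw_a_def field_simps)
  have Z1: "Z $ 1 = z * Z $ 2" using assms by simp
  have s': "sqrt ((Z $ 2)\<^sup>2 - (E $ 1)\<^sup>2) = s"
    using s by (metis real_sqrt_unique less_imp_le)
  have Th: "Theta E Z = z * s" using assms(8) s' by (simp add: Theta_def)
  have Gm: "Gam \<mu> E Z r = G"
    unfolding Gam_def assms(9,11) by (simp add: real_sqrt_mult s')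
  have sq: "sqrt (r * (r - 2 * \<mu>)) = A * r"
    unfolding rA by (rule real_sqrt_unique) (use A r in \<open>simp_all add: power2_eq_square\<close>)
  have Z2: "(Z $ 2)\<^sup>2 = s\<^sup>2 + (E $ 1)\<^sup>2" using s by simp
  have q0: "\<mu> * (z * s) - r\<^sup>2 * \<E> = r\<^sup>2 * A * q0" using assms(10) r A by simp
  show "mass_sq \<mu> \<E> E Z r p = q0\<^sup>2 - (A * p)\<^sup>2 - (E $ 3 / r)\<^sup>2 - (G / r)\<^sup>2"
  proof -
    have "\<mu> * (z * s) - \<E> * r\<^sup>2 = r\<^sup>2 * A * q0" using q0 by (simp add: mult.commute)
    then show ?thesis
      unfolding mass_sq_def Th Gm rA A(2)[symmetric]
      using r A(1) by (simp add: divide_simps eval_nat_numeral)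
  qed
  show "Vfun \<mu> msq E Z r = msq / \<mu> * r ^ 3
       - (2 * z\<^sup>2 * s\<^sup>2 - (E $ 1)\<^sup>2 * z\<^sup>2 - (Z $ 3)\<^sup>2 - 2 * (E $ 1)\<^sup>2 + s\<^sup>2)"
  proof -
    have "(z * Z $ 2)\<^sup>2 / (Z $ 2)\<^sup>2 = z\<^sup>2"
      using assms(7) by (simp add: power_mult_distrib)
    then show ?thesis
      unfolding Vfun_def Z1 by (simp only: power_mult_distrib Z2) (simp add: algebra_simps)
  qed
  let ?e = "E $ 1" let ?f = "E $ 2" let ?g = "E $ 3" let ?k = "Z $ 3"
  have z: "(Z $ 1)\<^sup>2 / (Z $ 2)\<^sup>2 = z\<^sup>2" "Z $ 1 / Z $ 2 = z" "(Z $ 1)\<^sup>2 = z\<^sup>2 * (s\<^sup>2 + ?e\<^sup>2)"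
    "Z $ 1 * Z $ 2 = z * (s\<^sup>2 + ?e\<^sup>2)"
    subgoal by (simp add: assms(8) power_divide)
    subgoal by (simp add: assms(8))
    subgoal by (simp only: Z1 power_mult_distrib Z2)
    subgoal unfolding Z2[symmetric] Z1 by (simp add: power2_eq_square)
    done
  have H: "Ham_new \<mu> m \<E> V E Z r p = A\<^sup>2 / m * (1/2 + (2 * (z * s)\<^sup>2 + s\<^sup>2) / V) * p\<^sup>2
    + A * s / (m * r * V) * (?e * ?g * (z\<^sup>2 - 1) - ?k * ?f * z) * p
    + s\<^sup>2 / (m * r ^ 3 * V) * (r * G\<^sup>2 + \<mu> * (z\<^sup>2 * (s\<^sup>2 + ?e\<^sup>2)))
    - (r\<^sup>2 * A * q0)\<^sup>2 / (m * r ^ 3 * (A\<^sup>2 * r))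
        * (1/2 - (z\<^sup>2 * (s\<^sup>2 + ?e\<^sup>2) + ?k\<^sup>2 - 3 * (z * s)\<^sup>2) / V)
    + s / (m * r * V) * (?k * (z * s - 2 * r * \<E>) * p - z * (s\<^sup>2 + ?e\<^sup>2) * \<E>)
    + (?g\<^sup>2 + G\<^sup>2) / (m * r\<^sup>2) * (1/2 - 2 * ?e\<^sup>2 / V)
    - (r\<^sup>2 * A * q0) / (m * r\<^sup>2 * V * (A * r))
        * (?e * ?g * ?k + z * (s\<^sup>2 + ?e\<^sup>2) * ?f)
    - 1 / (m * r\<^sup>2 * V) * (z * ?e * ?g + ?k * G)\<^sup>2"
    unfolding Ham_new_def Let_def Th Gm A(2)[symmetric] s' sq z(1,2)
    by (simp add: z(3,4) q0 rA Z2 assms(11))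
  \<comment> \<open>Each of the eight summands is brought to the form
    \<open>(kinetic part + x / V) / m\<close>. Kinetic parts occur in \<open>t1\<close>,
    \<open>t4\<close> and \<open>t6\<close> only; the signed numerators \<open>x\<close> have to add
    up to \<open>spin_quad_red\<close>, which is the content of \<open>W\<close>.\<close>
  have t1: "A\<^sup>2 / m * (1/2 + (2 * (z * s)\<^sup>2 + s\<^sup>2) / V) * p\<^sup>2
     = ((A * p)\<^sup>2 / 2 + (2 * z\<^sup>2 * s\<^sup>2 + s\<^sup>2) * (A * p)\<^sup>2 / V) / m"
    by (simp add: field_simps)
  have t2: "A * s / (m * r * V) * (?e * ?g * (z\<^sup>2 - 1) - ?k * ?f * z) * p
     = (A * s * (?e * ?g * (z\<^sup>2 - 1) - ?k * ?f * z) * p / r) / V / m"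
    by (simp add: field_simps)
  have t3: "s\<^sup>2 / (m * r ^ 3 * V) * (r * G\<^sup>2 + \<mu> * (z\<^sup>2 * (s\<^sup>2 + ?e\<^sup>2)))
     = (s\<^sup>2 * (r * G\<^sup>2 + \<mu> * (z\<^sup>2 * (s\<^sup>2 + ?e\<^sup>2))) / r ^ 3) / V / m"
    by (simp add: field_simps)
  have t4: "(r\<^sup>2 * A * q0)\<^sup>2 / (m * r ^ 3 * (A\<^sup>2 * r))
        * (1/2 - (z\<^sup>2 * (s\<^sup>2 + ?e\<^sup>2) + ?k\<^sup>2 - 3 * (z * s)\<^sup>2) / V)
     = (q0\<^sup>2 / 2 - q0\<^sup>2 * (z\<^sup>2 * (s\<^sup>2 + ?e\<^sup>2) + ?k\<^sup>2 - 3 * (z * s)\<^sup>2) / V) / m"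
  proof -
    have "(r\<^sup>2 * A * q0)\<^sup>2 / (m * r ^ 3 * (A\<^sup>2 * r)) = q0\<^sup>2 / m"
      using r A(1) assms(2) by (simp add: divide_simps eval_nat_numeral)
    then show ?thesis by (simp add: diff_divide_distrib right_diff_distrib mult.commute)
  qed
  have t5: "s / (m * r * V) * (?k * (z * s - 2 * r * \<E>) * p - z * (s\<^sup>2 + ?e\<^sup>2) * \<E>)
     = (s * (?k * (z * s - 2 * r * \<E>) * p - z * (s\<^sup>2 + ?e\<^sup>2) * \<E>) / r) / V / m"
    by (simp add: field_simps)
  have t6: "(?g\<^sup>2 + G\<^sup>2) / (m * r\<^sup>2) * (1/2 - 2 * ?e\<^sup>2 / V)
     = (((?g / r)\<^sup>2 + (G / r)\<^sup>2) / 2 - 2 * ?e\<^sup>2 * (?g\<^sup>2 + G\<^sup>2) / r\<^sup>2 / V) / m"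
    using assms(1,2) r by (simp add: power_divide divide_simps) (simp add: algebra_simps)
  have t7: "(r\<^sup>2 * A * q0) / (m * r\<^sup>2 * V * (A * r)) * (?e * ?g * ?k + z * (s\<^sup>2 + ?e\<^sup>2) * ?f)
     = (q0 * (?e * ?g * ?k + z * (s\<^sup>2 + ?e\<^sup>2) * ?f) / r) / V / m"
    using r A by simp
  have t8: "1 / (m * r\<^sup>2 * V) * (z * ?e * ?g + ?k * G)\<^sup>2
     = ((z * ?e * ?g + ?k * G)\<^sup>2 / r\<^sup>2) / V / m"
    by simp
  have W: "spin_quad_red ?e s z ?k q0 (A * p) (- (?g / r)) (G / r) =
       (2 * z\<^sup>2 * s\<^sup>2 + s\<^sup>2) * (A * p)\<^sup>2
     + A * s * (?e * ?g * (z\<^sup>2 - 1) - ?k * ?f * z) * p / r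
     + s\<^sup>2 * (r * G\<^sup>2 + \<mu> * (z\<^sup>2 * (s\<^sup>2 + ?e\<^sup>2))) / r ^ 3
     + q0\<^sup>2 * (z\<^sup>2 * (s\<^sup>2 + ?e\<^sup>2) + ?k\<^sup>2 - 3 * (z * s)\<^sup>2)
     + s * (?k * (z * s - 2 * r * \<E>) * p - z * (s\<^sup>2 + ?e\<^sup>2) * \<E>) / r
     - 2 * ?e\<^sup>2 * (?g\<^sup>2 + G\<^sup>2) / r\<^sup>2
     - q0 * (?e * ?g * ?k + z * (s\<^sup>2 + ?e\<^sup>2) * ?f) / r
     - (z * ?e * ?g + ?k * G)\<^sup>2 / r\<^sup>2"
  proof -
    \<comment> \<open>\<open>\<mu>\<close>, \<open>\<E>\<close> and \<open>E_2\<close> occur only on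
      the right of \<open>W\<close>. Once they are expressed by \<open>A\<close>, \<open>q0\<close>
      and \<open>G\<close>, what remains is an identity of rational functions in independent
      variables.\<close>
    have mu: "\<mu> = r * (1 - A\<^sup>2) / 2" using rA by (simp add: field_simps)
    have en: "\<E> = (1 - A\<^sup>2) * z * s / (2 * r) - A * q0"
    proof -
      have "r * (2 * r * \<E>) = r * ((1 - A\<^sup>2) * z * s - 2 * r * (A * q0))"
        using q0 unfolding mu by (simp add: field_simps power2_eq_square)
      then have "2 * r * \<E> = (1 - A\<^sup>2) * z * s - 2 * r * (A * q0)" using r by simp
      then show ?thesis using r by (simp add: field_simps)
    qed
    have f: "?f = A * s - G" using assms(11) by simp
    show ?thesis
      unfolding spin_quad_red_def en f using r
      by (subst mu) (simp add: field_simps eval_nat_numeral)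
  qed
  show "Ham_new \<mu> m \<E> V E Z r p =
     ((- q0\<^sup>2 + (A * p)\<^sup>2 + (E $ 3 / r)\<^sup>2 + (G / r)\<^sup>2) / 2
      + spin_quad_red (E $ 1) s z (Z $ 3) q0 (A * p) (- (E $ 3 / r)) (G / r) / V) / m"
    unfolding H t1 t2 t3 t4 t5 t6 t7 t8 W
    by (simp add: add_divide_distrib diff_divide_distrib)
qed


text \<open>The domain on which the new variables are smooth. The further condition
  \<open>Q \<noteq> 0\<close> of \<open>chart_region\<close> enters through
  \<open>F \<noteq> 0\<close>, which the rank requires.\<close>

definition regular_region :: "real \<Rightarrow> phase set" where
  "regular_region \<mu> = {x. phy x \<in> exterior \<mu> \<and> (phL x $ 2)\<^sup>2 + (phL x $ 3)\<^sup>2 \<noteq> 0}"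

lemma chart_region_regular: "chart_region \<mu> \<subseteq> regular_region \<mu>"
  by (auto simp: chart_region_def regular_region_def exterior_def)

lemma newvars_simps:
  fixes x :: phase
  defines "s \<equiv> sqrt ((phL x $ 2)\<^sup>2 + (phL x $ 3)\<^sup>2)"
  shows "newE x $ 1 = phL x $ 1"
    "newE x $ 2 = phL x $ 3 * phP x $ 2 / s + phL x $ 2 * ((phL x $ 1 * cos (phy x $ 2) - phP x $ 3) / (sin (phy x $ 2) * s))"
    "newE x $ 3 = - phL x $ 2 * phP x $ 2 / s + phL x $ 3 * ((phL x $ 1 * cos (phy x $ 2) - phP x $ 3) / (sin (phy x $ 2) * s))"
    "newZ x $ 1 = - phM x $ 1 * sqrt (phL x \<bullet> phL x) / s"
    "newZ x $ 2 = sqrt (phL x \<bullet> phL x)"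
    "newZ x $ 3 = (phM x $ 2 * phL x $ 3 - phM x $ 3 * phL x $ 2) / s"
  by (simp_all add: newE_def newZ_def s_def Let_def)

text \<open>The rotation that aligns the transversal part of \<open>L\<close> with direction 2 is
  applied at the given phase point, and the rotated data meet the hypotheses of
  \<open>Ham_new_eq\<close>. The second identity turns membership in \<open>ham_domain\<close> into
  \<open>V \<noteq> 0\<close>.\<close>

lemma reduced_Hamiltonian:
  fixes x :: phase
  assumes x: "x \<in> regular_region \<mu>" and "\<mu> > 0" "m > 0" and C: "C_star x = 0"
  shows "- p_sq \<mu> x = mass_sq \<mu> (energy x) (newE x) (newZ x) (rad x) (radP x)"
    and "d_scal \<mu> x + 2 * p_sq \<mu> x = - (2 * \<mu> / (rad x) ^ 3) *
      Vfun \<mu> (mass_sq \<mu> (energy x) (newE x) (newZ x) (rad x) (radP x)) (newE x) (newZ x) (rad x)"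
    and "x \<in> ham_domain \<mu> \<Longrightarrow>
      Ham \<mu> m x = Ham_red \<mu> m (energy x) (newE x) (newZ x) (rad x) (radP x)"
proof -
  define L M P where "L = phL x" and "M = phM x" and "P = phP x"
  define \<theta> r where "\<theta> = phy x $ 2" and "r = rad x"
  define s where "s = sqrt ((L $ 2)\<^sup>2 + (L $ 3)\<^sup>2)"
  define u v where "u = L $ 2 / s" and "v = L $ 3 / s"
  define E Z where "E = newE x" and "Z = newZ x"
  have ext: "phy x \<in> exterior \<mu>" and s0: "(L $ 2)\<^sup>2 + (L $ 3)\<^sup>2 \<noteq> 0"
    using x by (auto simp: regular_region_def L_def)
  have r: "r > 2 * \<mu>" "r > 0" and sin: "sin \<theta> \<noteq> 0"
    using ext \<open>\<mu> > 0\<close> by (auto simp: exterior_def r_def rad_def \<theta>_def)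
  have s: "s > 0" using s0 by (simp add: s_def less_le sum_power2_eq_zero_iff)
  have s2: "s\<^sup>2 = (L $ 2)\<^sup>2 + (L $ 3)\<^sup>2" by (simp add: s_def)
  have L: "L $ 2 = s * u" "L $ 3 = s * v" using s by (simp_all add: u_def v_def)
  have uv: "u\<^sup>2 + v\<^sup>2 = 1" using s s2 by (simp add: L power_mult_distrib flip: distrib_left)
  have LL: "L \<bullet> L = (L $ 1)\<^sup>2 + s\<^sup>2" unfolding s2 by (simp add: inner_vec_def sum_3 power2_eq_square)
  have Z2: "Z $ 2 = sqrt (L \<bullet> L)" "Z $ 2 > 0" "(Z $ 2)\<^sup>2 = (L $ 1)\<^sup>2 + s\<^sup>2"
    using s unfolding Z_def newvars_simps L_def[symmetric] LL by (auto intro: add_nonneg_pos)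
  \<comment> \<open>\<open>(E_2, E_3)\<close> is the vector \<open>(P_\<theta>, \<kappa>)\<close>
    rotated by means of the direction \<open>(u, v)\<close>.\<close>
  define \<kappa> where "\<kappa> = (L $ 1 * cos \<theta> - P $ 3) / sin \<theta>"
  have E: "E $ 1 = L $ 1" "E $ 2 = v * P $ 2 + u * \<kappa>" "E $ 3 = - u * P $ 2 + v * \<kappa>"
    using s unfolding E_def newvars_simps L_def[symmetric] P_def[symmetric] \<theta>_def[symmetric] s_def[symmetric]
    by (simp_all add: u_def v_def \<kappa>_def)
  define z where "z = Z $ 1 / Z $ 2"
  have z: "z = - M $ 1 / s"
    using Z2(2) unfolding z_def Z2(1) unfolding Z_def newvars_simps L_def[symmetric] M_def[symmetric] s_def[symmetric]
    by simp
  have Z3: "Z $ 3 = M $ 2 * v - M $ 3 * u"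
    unfolding Z_def newvars_simps L_def[symmetric] M_def[symmetric] s_def[symmetric]
    by (simp add: u_def v_def diff_divide_distrib)
  \<comment> \<open>Here the level set enters: \<open>(L, M) = 0\<close> makes the component of
    \<open>M\<close> along \<open>(u, v)\<close> equal to \<open>e z\<close> with
    \<open>e = L_1\<close>. \<open>Z_3\<close> is the orthogonal component, so both transversal
    components of \<open>M\<close> are expressed by new variables and \<open>(u, v)\<close>.\<close>
  have "L $ 1 * M $ 1 + s * (u * M $ 2 + v * M $ 3) = 0"
    using C by (simp add: C_star_def inner_vec_def sum_3 flip: L_def M_def) (simp add: L algebra_simps)
  then have ez: "L $ 1 * z = u * M $ 2 + v * M $ 3"
    using s unfolding z by (simp add: field_simps)
  define A where "A = sqrt (schw_a \<mu> r)"
  define G where "G = A * s - E $ 2"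
  define q where "q = frame_momentum \<mu> x"
  have q: "q 0 = (\<mu> * z * s - r\<^sup>2 * energy x) / (r\<^sup>2 * A)" "q 1 = A * radP x"
     "q 2 = (P $ 2 - A * L $ 3) / r" "q 3 = (A * L $ 2 - \<kappa>) / r"
    unfolding q_def frame_momentum_values r_def[symmetric] A_def[symmetric] energy_def P_def[symmetric]
      L_def[symmetric] M_def[symmetric] \<theta>_def[symmetric] z \<kappa>_def
    using r sin s by (simp_all add: field_simps)
  have *: "M $ 1 = - (z * s)" "M $ 2 = L $ 1 * z * u + Z $ 3 * v" "M $ 3 = L $ 1 * z * v - Z $ 3 * u"
    "q 2 = u * (- (E $ 3 / r)) + v * (- (G / r))" "q 3 = v * (- (E $ 3 / r)) - u * (- (G / r))"
  proof -
    show "M $ 1 = - (z * s)" using z s by simp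
    show "M $ 2 = L $ 1 * z * u + Z $ 3 * v" unfolding ez Z3 using uv by algebra
    show "M $ 3 = L $ 1 * z * v - Z $ 3 * u" unfolding ez Z3 using uv by algebra
    have "P $ 2 - A * (s * v) = - u * E $ 3 - v * G" "A * (s * u) - \<kappa> = - v * E $ 3 + u * G"
      unfolding G_def E using uv by algebra+
    then show "q 2 = u * (- (E $ 3 / r)) + v * (- (G / r))" "q 3 = v * (- (E $ 3 / r)) - u * (- (G / r))"
      unfolding q L by (simp_all add: diff_divide_distrib add_divide_distrib)
  qed
  note rot = spin_quad_rotate[where L = L and M = M and q = q, OF uv refl L *]
  have V: "Vfun \<mu> msq E Z r = msq / \<mu> * r ^ 3 - spin_trace L M"
    and ms: "mass_sq \<mu> (energy x) E Z r (radP x) = - p_sq \<mu> x"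
    and H: "V \<noteq> 0 \<Longrightarrow> Ham_new \<mu> m (energy x) V E Z r (radP x) = (p_sq \<mu> x / 2 + spin_quad L M q / V) / m"
    for msq V
  proof -
    have s2': "s\<^sup>2 = (Z $ 2)\<^sup>2 - (E $ 1)\<^sup>2" using Z2 by (simp add: E)
    have psq: "p_sq \<mu> x = - (q 0)\<^sup>2 + (A * radP x)\<^sup>2 + (E $ 3 / r)\<^sup>2 + (G / r)\<^sup>2"
      using rot(3) unfolding p_sq_frame[OF ext \<open>\<mu> > 0\<close>] q_def[symmetric] q(2) by simp
    \<comment> \<open>The nonvanishing premises on \<open>V\<close> and \<open>m\<close> are met
      here, and for \<open>mass_sq\<close> below, with the value 1 for both.\<close>
    show "Vfun \<mu> msq E Z r = msq / \<mu> * r ^ 3 - spin_trace L M"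
      using Ham_new_eq(3)[OF zero_neq_one[symmetric] zero_neq_one[symmetric] \<open>\<mu> > 0\<close> r(1) s s2' Z2(2) z_def A_def q(1) G_def]
      unfolding rot(2) by (simp add: E)
    show "mass_sq \<mu> (energy x) E Z r (radP x) = - p_sq \<mu> x"
      using Ham_new_eq(2)[OF zero_neq_one[symmetric] zero_neq_one[symmetric] \<open>\<mu> > 0\<close> r(1) s s2' Z2(2) z_def A_def q(1) G_def]
      unfolding psq by simp
    assume "V \<noteq> 0"
    show "Ham_new \<mu> m (energy x) V E Z r (radP x) = (p_sq \<mu> x / 2 + spin_quad L M q / V) / m"
      using Ham_new_eq(1)[OF \<open>V \<noteq> 0\<close> _ \<open>\<mu> > 0\<close> r(1) s s2' Z2(2) z_def A_def q(1) G_def, of m "radP x"] \<open>m > 0\<close>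
      unfolding psq rot(1) by (simp add: E q(2))
  qed
  note fold = E_def[symmetric] Z_def[symmetric] r_def[symmetric]
  show ms': "- p_sq \<mu> x = mass_sq \<mu> (energy x) (newE x) (newZ x) (rad x) (radP x)"
    unfolding fold ms by simp
  show den: "d_scal \<mu> x + 2 * p_sq \<mu> x = - (2 * \<mu> / (rad x) ^ 3) *
      Vfun \<mu> (mass_sq \<mu> (energy x) (newE x) (newZ x) (rad x) (radP x)) (newE x) (newZ x) (rad x)"
    unfolding d_scal_eq[OF ext \<open>\<mu> > 0\<close>] fold V ms L_def[symmetric] M_def[symmetric]
    using r \<open>\<mu> > 0\<close> by (simp add: field_simps)
  show "Ham \<mu> m x = Ham_red \<mu> m (energy x) (newE x) (newZ x) (rad x) (radP x)" if "x \<in> ham_domain \<mu>"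
  proof -
    define W where "W = Vfun \<mu> (mass_sq \<mu> (energy x) E Z r (radP x)) E Z r"
    \<comment> \<open>By \<open>den\<close>, a zero of \<open>V\<close> would be a zero of the
      denominator \<open>d + 2 p^2\<close>.\<close>
    have "W \<noteq> 0" using that den by (auto simp: ham_domain_def W_def fold)
    then show ?thesis
      unfolding Ham_red_def Ham_frame[OF ext \<open>\<mu> > 0\<close>] den fold W_def[symmetric] H[OF \<open>W \<noteq> 0\<close>]
        q_def[symmetric] L_def[symmetric] M_def[symmetric]
      using r \<open>\<mu> > 0\<close> \<open>m > 0\<close> by (simp add: field_simps)
  qed
qed


section \<open>The brackets of the new variables\<close>

lemma phase_components [simp]:
  "phL (l, q, p, y) = l" "phM (l, q, p, y) = q" "phP (l, q, p, y) = p" "phy (l, q, p, y) = y"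
  by (simp_all add: phL_def phM_def phP_def phy_def)

lemma phase_eq: "x = (phL x, phM x, phP x, phy x)"
  by (simp add: phL_def phM_def phP_def phy_def)

lemma bounded_linear_phase_components:
  "bounded_linear phL" "bounded_linear phM" "bounded_linear phP" "bounded_linear phy"
  unfolding phL_def[abs_def] phM_def[abs_def] phP_def[abs_def] phy_def[abs_def]
  by (intro bounded_linear_compose[OF bounded_linear_fst] bounded_linear_compose[OF bounded_linear_snd]
      bounded_linear_fst bounded_linear_snd)+

lemmas has_derivative_phase_components [derivative_intros] =
  bounded_linear_phase_components[THEN bounded_linear.has_derivative]

lemmas continuous_on_phase_components [continuous_intros] =
  bounded_linear_phase_components[THEN bounded_linear.continuous_on]

lemma phase_gradients:
  assumes "(f has_derivative D) (at x)"
  shows "gradL f x = (\<chi> i. D (axis i 1, 0, 0, 0))" "gradM f x = (\<chi> i. D (0, axis i 1, 0, 0))"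
    "gradP f x = (\<chi> i. D (0, 0, axis i 1, 0))" "grady f x = (\<chi> i. D (0, 0, 0, axis i 1))"
proof -
  have f: "(f has_derivative D) (at (phL x, phM x, phP x, phy x))"
    using assms phase_eq[of x] by simp
  have "((\<lambda>l. f (l, phM x, phP x, phy x)) has_derivative (\<lambda>h. D (h, 0, 0, 0))) (at (phL x))"
    by (rule has_derivative_compose[where f = "\<lambda>l. (l, phM x, phP x, phy x)" and g = f, OF _ f])
      (auto intro!: derivative_eq_intros simp: zero_prod_def)
  then show "gradL f x = (\<chi> i. D (axis i 1, 0, 0, 0))"
    by (simp add: gradL_def vec_eq_iff gradient_nth)
  have "((\<lambda>q. f (phL x, q, phP x, phy x)) has_derivative (\<lambda>h. D (0, h, 0, 0))) (at (phM x))"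
    by (rule has_derivative_compose[where f = "\<lambda>q. (phL x, q, phP x, phy x)" and g = f, OF _ f])
      (auto intro!: derivative_eq_intros simp: zero_prod_def)
  then show "gradM f x = (\<chi> i. D (0, axis i 1, 0, 0))"
    by (simp add: gradM_def vec_eq_iff gradient_nth)
  have "((\<lambda>p. f (phL x, phM x, p, phy x)) has_derivative (\<lambda>h. D (0, 0, h, 0))) (at (phP x))"
    by (rule has_derivative_compose[where f = "\<lambda>p. (phL x, phM x, p, phy x)" and g = f, OF _ f])
      (auto intro!: derivative_eq_intros simp: zero_prod_def)
  then show "gradP f x = (\<chi> i. D (0, 0, axis i 1, 0))"
    by (simp add: gradP_def vec_eq_iff gradient_nth)
  have "((\<lambda>y. f (phL x, phM x, phP x, y)) has_derivative (\<lambda>h. D (0, 0, 0, h))) (at (phy x))"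
    by (rule has_derivative_compose[where f = "\<lambda>y. (phL x, phM x, phP x, y)" and g = f, OF _ f])
      (auto intro!: derivative_eq_intros simp: zero_prod_def)
  then show "grady f x = (\<chi> i. D (0, 0, 0, axis i 1))"
    by (simp add: grady_def vec_eq_iff gradient_nth)
qed

lemma derivative_phase_gradients:
  assumes "(f has_derivative D) (at x)"
  shows "D h = gradL f x \<bullet> phL h + gradM f x \<bullet> phM h + gradP f x \<bullet> phP h + grady f x \<bullet> phy h"
proof -
  have lin: "linear D" using assms by (rule has_derivative_linear)
  have "D h = D ((phL h, 0, 0, 0) + (0, phM h, 0, 0) + (0, 0, phP h, 0) + (0, 0, 0, phy h))"
    using phase_eq[of h] by simp
  also have "\<dots> = D (phL h, 0, 0, 0) + D (0, phM h, 0, 0) + D (0, 0, phP h, 0) + D (0, 0, 0, phy h)"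
    by (simp only: linear_add[OF lin])
  also have "D (phL h, 0, 0, 0) = gradL f x \<bullet> phL h"
    unfolding phase_gradients[OF assms] inner_vec_def
    by (subst linear_axis_sum[OF linear_compose[OF _ lin, of "\<lambda>l. (l, 0, 0, 0)", unfolded o_def]])
      (auto intro!: linearI)
  also have "D (0, phM h, 0, 0) = gradM f x \<bullet> phM h"
    unfolding phase_gradients[OF assms] inner_vec_def
    by (subst linear_axis_sum[OF linear_compose[OF _ lin, of "\<lambda>l. (0, l, 0, 0)", unfolded o_def]])
      (auto intro!: linearI)
  also have "D (0, 0, phP h, 0) = gradP f x \<bullet> phP h"
    unfolding phase_gradients[OF assms] inner_vec_def
    by (subst linear_axis_sum[OF linear_compose[OF _ lin, of "\<lambda>l. (0, 0, l, 0)", unfolded o_def]])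
      (auto intro!: linearI)
  also have "D (0, 0, 0, phy h) = grady f x \<bullet> phy h"
    unfolding phase_gradients[OF assms] inner_vec_def
    by (subst linear_axis_sum[OF linear_compose[OF _ lin, of "\<lambda>l. (0, 0, 0, l)", unfolded o_def]])
      (auto intro!: linearI)
  finally show ?thesis .
qed

text \<open>The Hamiltonian vector field of \<open>g\<close>: by cyclicity of the triple product,
  \<open>{f, g}\<close> is the pairing of the gradients of \<open>f\<close> with it. For
  differentiable \<open>f\<close> the bracket is thus the derivative of \<open>f\<close> at one
  vector, which makes the chain rule available for brackets.\<close>

definition hamvec :: "(phase \<Rightarrow> real) \<Rightarrow> phase \<Rightarrow> phase" where
  "hamvec g x = (cross3 (gradL g x) (phL x) + cross3 (gradM g x) (phM x),
     cross3 (gradL g x) (phM x) - cross3 (gradM g x) (phL x), - grady g x, gradP g x)"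

lemma pbracket_gradients:
  "pbracket f g x = gradL f x \<bullet> phL (hamvec g x) + gradM f x \<bullet> phM (hamvec g x)
     + gradP f x \<bullet> phP (hamvec g x) + grady f x \<bullet> phy (hamvec g x)"
  unfolding pbracket_def hamvec_def phase_components
  by (simp add: cross3_def inner_vec_def sum_3 algebra_simps sum_negf)

lemma pbracket_hamvec:
  assumes "(f has_derivative D) (at x)"
  shows "pbracket f g x = D (hamvec g x)"
  unfolding pbracket_gradients derivative_phase_gradients[OF assms] ..

lemma pbracket_skew: "pbracket g f x = - pbracket f g x"
  unfolding pbracket_def
  by (simp add: cross3_def inner_vec_def sum_3 algebra_simps sum_subtractf sum_negf)

lemma pbracket_self: "pbracket f f x = 0"
  using pbracket_skew[of f f x] by simp

section \<open>Derivatives of the new variables\<close>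

definition spin_transversal :: "phase \<Rightarrow> real" where
  "spin_transversal x = sqrt ((phL x $ 2)\<^sup>2 + (phL x $ 3)\<^sup>2)"
definition kappa :: "phase \<Rightarrow> real" where
  "kappa x = (phL x $ 1 * cos (phy x $ 2) - phP x $ 3) / sin (phy x $ 2)"

text \<open>\<open>E_2\<close> and \<open>E_3\<close> depend on the transversal part of \<open>L\<close> only through its direction, and
  a rotation of that direction rotates \<open>(E_2, E_3)\<close>; this is the term with \<open>rot\<close>.\<close>

definition newvars_deriv :: "phase \<Rightarrow> 8 \<Rightarrow> phase \<Rightarrow> real" where
  "newvars_deriv x i h = (let L = phL x; M = phM x; \<theta> = phy x $ 2; s = spin_transversal x;
      l = sqrt (L \<bullet> L); u = L $ 2 / s; v = L $ 3 / s;
      rot = (v * phL h $ 2 - u * phL h $ 3) / s;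
      d\<kappa> = (cos \<theta> * phL h $ 1 - phP h $ 3) / sin \<theta> - (L $ 1 + kappa x * cos \<theta> / sin \<theta>) * phy h $ 2 in
     if i = 1 then phL h $ 1
     else if i = 2 then newE x $ 3 * rot + v * phP h $ 2 + u * d\<kappa>
     else if i = 3 then - (newE x $ 2 * rot) - u * phP h $ 2 + v * d\<kappa>
     else if i = 4 then - (l / s) * phM h $ 1 - M $ 1 / (s * l) * (L \<bullet> phL h)
        + M $ 1 * l / s\<^sup>2 * (u * phL h $ 2 + v * phL h $ 3)
     else if i = 5 then (L \<bullet> phL h) / l
     else if i = 6 then v * phM h $ 2 - u * phM h $ 3 - (M $ 2 * u + M $ 3 * v) * rot
     else if i = 7 then phy h $ 1 else phP h $ 1)"

lemma newvars_has_derivative: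
  assumes "x \<in> regular_region \<mu>"
  shows "((\<lambda>z. newvars z $ i) has_derivative newvars_deriv x i) (at x)"
proof -
  define s where "s = spin_transversal x"
  define u v where "u = phL x $ 2 / s" and "v = phL x $ 3 / s"
  define l where "l = sqrt (phL x \<bullet> phL x)"
  have s0: "(phL x $ 2)\<^sup>2 + (phL x $ 3)\<^sup>2 > 0" and sin: "sin (phy x $ 2) \<noteq> 0"
    using assms by (auto simp: regular_region_def exterior_def less_le sum_power2_eq_zero_iff)
  then have s: "s > 0" by (simp add: s_def spin_transversal_def)
  have s2: "s\<^sup>2 = (phL x $ 2)\<^sup>2 + (phL x $ 3)\<^sup>2" by (simp add: s_def spin_transversal_def)
  have LL: "phL x \<bullet> phL x > 0"
    using s0 by (simp add: inner_vec_def sum_3 power2_eq_square add.assoc add_nonneg_pos)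
  then have l: "l > 0" by (simp add: l_def)
  have L: "phL x $ 2 = s * u" "phL x $ 3 = s * v" using s by (simp_all add: u_def v_def)
  have "(s * s) * (u * u + v * v) = (s * s) * 1"
    using s2 unfolding L by algebra
  then have uv: "u * u + v * v = 1" using s by simp
  have ds: "(spin_transversal has_derivative (\<lambda>h. u * phL h $ 2 + v * phL h $ 3)) (at x)"
  proof -
    have "((\<lambda>z. (phL z $ 2)\<^sup>2 + (phL z $ 3)\<^sup>2) has_derivative
        (\<lambda>h. 2 * (phL x $ 2 * phL h $ 2 + phL x $ 3 * phL h $ 3))) (at x)"
      by (auto intro!: derivative_eq_intros ext)
    from has_derivative_compose[OF this DERIV_real_sqrt[OF s0, unfolded has_field_derivative_def]]
    have "(spin_transversal has_derivative
        (\<lambda>h. inverse s / 2 * (2 * (phL x $ 2 * phL h $ 2 + phL x $ 3 * phL h $ 3)))) (at x)"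
      by (simp add: spin_transversal_def[abs_def] s_def)
    then show ?thesis
      by (rule has_derivative_eq_rhs) (use s in \<open>auto simp: u_def v_def field_simps intro!: ext\<close>)
  qed
  \<comment> \<open>A variation \<open>dL\<close> turns the direction \<open>(u, v)\<close> by the
    angle \<open>(u dL_3 - v dL_2) / s\<close>; its radial part cancels by
    \<open>u^2 + v^2 = 1\<close>. The same angle appears in \<open>dv\<close>.\<close>
  have du: "((\<lambda>z. phL z $ 2 / spin_transversal z) has_derivative
      (\<lambda>h. v * ((v * phL h $ 2 - u * phL h $ 3) / s))) (at x)"
  proof (rule has_derivative_eq_rhs[OF has_derivative_divide[OF _ ds]])
    show "((\<lambda>z. phL z $ 2) has_derivative (\<lambda>h. phL h $ 2)) (at x)" by (auto intro!: derivative_eq_intros)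
    show "(\<lambda>h. - (phL x $ 2) * (inverse (spin_transversal x) * (u * phL h $ 2 + v * phL h $ 3) * inverse (spin_transversal x))
        + phL h $ 2 / spin_transversal x) = (\<lambda>h. v * ((v * phL h $ 2 - u * phL h $ 3) / s))"
    proof
      fix h :: phase
      have "- (s * u) * (u * phL h $ 2 + v * phL h $ 3) + s * phL h $ 2 = s * (v * (v * phL h $ 2 - u * phL h $ 3))"
        using uv by algebra
      then show "- (phL x $ 2) * (inverse (spin_transversal x) * (u * phL h $ 2 + v * phL h $ 3) * inverse (spin_transversal x))
        + phL h $ 2 / spin_transversal x = v * ((v * phL h $ 2 - u * phL h $ 3) / s)"
        unfolding s_def[symmetric] L using s by (simp add: field_simps)
    qed
  qed (use s in \<open>simp add: s_def\<close>)
  have dv: "((\<lambda>z. phL z $ 3 / spin_transversal z) has_derivative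
      (\<lambda>h. - u * ((v * phL h $ 2 - u * phL h $ 3) / s))) (at x)"
  proof (rule has_derivative_eq_rhs[OF has_derivative_divide[OF _ ds]])
    show "((\<lambda>z. phL z $ 3) has_derivative (\<lambda>h. phL h $ 3)) (at x)" by (auto intro!: derivative_eq_intros)
    show "(\<lambda>h. - (phL x $ 3) * (inverse (spin_transversal x) * (u * phL h $ 2 + v * phL h $ 3) * inverse (spin_transversal x))
        + phL h $ 3 / spin_transversal x) = (\<lambda>h. - u * ((v * phL h $ 2 - u * phL h $ 3) / s))"
    proof
      fix h :: phase
      have "- (s * v) * (u * phL h $ 2 + v * phL h $ 3) + s * phL h $ 3 = s * (- u * (v * phL h $ 2 - u * phL h $ 3))"
        using uv by algebra
      then show "- (phL x $ 3) * (inverse (spin_transversal x) * (u * phL h $ 2 + v * phL h $ 3) * inverse (spin_transversal x))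
        + phL h $ 3 / spin_transversal x = - u * ((v * phL h $ 2 - u * phL h $ 3) / s)"
        unfolding s_def[symmetric] L using s by (simp add: field_simps)
    qed
  qed (use s in \<open>simp add: s_def\<close>)
  have dk: "(kappa has_derivative (\<lambda>h. (cos (phy x $ 2) * phL h $ 1 - phP h $ 3) / sin (phy x $ 2)
      - (phL x $ 1 + kappa x * cos (phy x $ 2) / sin (phy x $ 2)) * phy h $ 2)) (at x)"
    unfolding kappa_def[abs_def] using sin
    by (auto intro!: derivative_eq_intros ext simp: field_simps)
  have dl: "((\<lambda>z. sqrt (phL z \<bullet> phL z)) has_derivative (\<lambda>h. (phL x \<bullet> phL h) / l)) (at x)"
    using LL by (auto intro!: derivative_eq_intros ext simp: l_def inner_commute field_simps)
  have E: "newE z $ 2 = phL z $ 3 / spin_transversal z * phP z $ 2 + phL z $ 2 / spin_transversal z * kappa z"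
    "newE z $ 3 = - (phL z $ 2 / spin_transversal z * phP z $ 2) + phL z $ 3 / spin_transversal z * kappa z" for z
    by (simp_all add: newvars_simps spin_transversal_def kappa_def mult.commute)
  note fold = s_def[symmetric] u_def[symmetric] v_def[symmetric] l_def[symmetric]
  have dP: "((\<lambda>z. phP z $ j) has_derivative (\<lambda>h. phP h $ j)) (at x)"
    and dM: "((\<lambda>z. phM z $ k) has_derivative (\<lambda>h. phM h $ k)) (at x)" for j k
    by (auto intro!: derivative_eq_intros)
  show ?thesis
  proof (cases i rule: exhaust_8)
    case 1
    then show ?thesis unfolding newvars_deriv_def[abs_def] newvars_def
      by (auto intro!: derivative_eq_intros simp: newvars_simps)
  next
    case 2
    have "((\<lambda>z. phL z $ 3 / spin_transversal z * phP z $ 2 + phL z $ 2 / spin_transversal z * kappa z) has_derivative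
       newvars_deriv x 2) (at x)"
      by (rule has_derivative_eq_rhs[OF has_derivative_add[OF has_derivative_mult[OF dv dP] has_derivative_mult[OF du dk]]])
        (use s in \<open>auto simp: newvars_deriv_def Let_def fold L E algebra_simps add_divide_distrib diff_divide_distrib intro!: ext\<close>)
    then show ?thesis using 2 by (simp add: newvars_def E)
  next
    case 3
    have "((\<lambda>z. - (phL z $ 2 / spin_transversal z * phP z $ 2) + phL z $ 3 / spin_transversal z * kappa z) has_derivative
       newvars_deriv x 3) (at x)"
      by (rule has_derivative_eq_rhs[OF has_derivative_add[OF
            has_derivative_minus[OF has_derivative_mult[OF du dP]] has_derivative_mult[OF dv dk]]])
        (use s in \<open>auto simp: newvars_deriv_def Let_def fold L E algebra_simps add_divide_distrib diff_divide_distrib intro!: ext\<close>)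
    then show ?thesis using 3 by (simp add: newvars_def E)
  next
    case 4
    have "((\<lambda>z. - phM z $ 1 * sqrt (phL z \<bullet> phL z) / spin_transversal z) has_derivative newvars_deriv x 4) (at x)"
    proof (rule has_derivative_eq_rhs[OF has_derivative_divide[OF has_derivative_mult[OF has_derivative_minus[OF dM] dl] ds]])
      have "- (- M * l) * (inverse s * Y * inverse s) + (- M * (X / l) + - N * l) / s
          = - (l / s) * N - M / (s * l) * X + M * l / s\<^sup>2 * Y" for M X Y N
        by (simp add: divide_inverse algebra_simps power2_eq_square)
      then show "(\<lambda>h. - (- phM x $ 1 * sqrt (phL x \<bullet> phL x)) *
           (inverse (spin_transversal x) * (u * phL h $ 2 + v * phL h $ 3) * inverse (spin_transversal x)) +
           (- phM x $ 1 * (phL x \<bullet> phL h / l) + - phM h $ 1 * sqrt (phL x \<bullet> phL x)) / spin_transversal x)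
         = newvars_deriv x 4"
        unfolding newvars_deriv_def Let_def fold by simp
    qed (use s in \<open>simp add: s_def\<close>)
    then show ?thesis using 4 by (simp add: newvars_def newvars_simps spin_transversal_def)
  next
    case 5
    then show ?thesis using dl unfolding newvars_deriv_def[abs_def] newvars_def
      by (simp add: newvars_simps l_def Let_def)
  next
    case 6
    have "((\<lambda>z. phM z $ 2 * (phL z $ 3 / spin_transversal z) - phM z $ 3 * (phL z $ 2 / spin_transversal z)) has_derivative
       newvars_deriv x 6) (at x)"
      by (rule has_derivative_eq_rhs[OF has_derivative_diff[OF has_derivative_mult[OF dM dv] has_derivative_mult[OF dM du]]])
        (use s in \<open>auto simp: newvars_deriv_def Let_def fold L algebra_simps add_divide_distrib diff_divide_distrib intro!: ext\<close>)
    then show ?thesis using 6 by (simp add: newvars_def newvars_simps spin_transversal_def diff_divide_distrib)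
  next
    case 7
    then show ?thesis unfolding newvars_deriv_def[abs_def] newvars_def rad_def
      by (auto intro!: derivative_eq_intros)
  next
    case 8
    then show ?thesis unfolding newvars_deriv_def[abs_def] newvars_def radP_def
      by (auto intro!: derivative_eq_intros)
  qed
qed


lemma pbracket_newvars:
  assumes x: "x \<in> regular_region \<mu>" and C: "C_star x = 0"
  shows "pbracket (\<lambda>z. newvars z $ i) (\<lambda>z. newvars z $ j) x = poisson_matrix (newvars x) $ i $ j"
proof -
  define s where "s = spin_transversal x"
  \<comment> \<open>\<open>k\<close>, \<open>n\<close> and \<open>w\<close> name reciprocals, so
    that the brackets become polynomials modulo the relations \<open>sk\<close>, \<open>ln\<close>,
    \<open>sw\<close>, \<open>uv\<close>, \<open>ll\<close>, \<open>sc\<close> and the relation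
    \<open>Cs\<close> of the level set.\<close>
  define k where "k = 1 / s"
  define u v where "u = phL x $ 2 * k" and "v = phL x $ 3 * k"
  define l where "l = sqrt (phL x \<bullet> phL x)"
  define n where "n = 1 / l"
  define c \<sigma> w where "c = cos (phy x $ 2)" and "\<sigma> = sin (phy x $ 2)" and "w = 1 / sin (phy x $ 2)"
  define e where "e = phL x $ 1"
  define p q g where "p = phM x $ 1" and "q = phM x $ 2" and "g = phM x $ 3"
  define E2 E3 where "E2 = newE x $ 2" and "E3 = newE x $ 3"
  have s0: "(phL x $ 2)\<^sup>2 + (phL x $ 3)\<^sup>2 > 0" and sin: "sin (phy x $ 2) \<noteq> 0"
    using x by (auto simp: regular_region_def exterior_def less_le sum_power2_eq_zero_iff)
  then have s: "s > 0" by (simp add: s_def spin_transversal_def)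
  have s2: "s\<^sup>2 = (phL x $ 2)\<^sup>2 + (phL x $ 3)\<^sup>2" by (simp add: s_def spin_transversal_def)
  have sk: "s * k = 1" using s by (simp add: k_def)
  have L: "phL x $ 1 = e" "phL x $ 2 = s * u" "phL x $ 3 = s * v"
    using sk by (simp_all add: u_def v_def e_def)
  have "(s * s) * (u * u + v * v) = (s * s) * 1"
    using s2 unfolding L by algebra
  then have uv: "u * u + v * v = 1" using s by simp
  have LL: "phL x \<bullet> phL x = e * e + s * s"
    using s2 by (simp add: inner_vec_def sum_3 e_def power2_eq_square)
  have ll: "l * l = e * e + s * s" unfolding l_def LL by simp
  have "e * e + s * s > 0" using s by (simp add: add_nonneg_pos)
  then have l0: "l > 0" by (simp add: l_def LL)
  have ln: "l * n = 1" using l0 by (simp add: n_def)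
  have sw: "\<sigma> * w = 1" using sin by (simp add: \<sigma>_def w_def)
  have sc: "\<sigma> * \<sigma> + c * c = 1"
    using sin_cos_squared_add[of "phy x $ 2"] by (simp add: \<sigma>_def c_def power2_eq_square)
  have Cs: "e * p + s * (u * q + v * g) = 0"
    using C by (simp add: C_star_def inner_vec_def sum_3 L p_def q_def g_def algebra_simps)
  \<comment> \<open>Inverting the rotation eliminates \<open>\<kappa>\<close> and
    \<open>P_\<theta>\<close> in favour of \<open>E_2\<close> and \<open>E_3\<close>, in which the
    results are to be expressed.\<close>
  have kappa: "kappa x = u * E2 + v * E3" "phP x $ 2 = v * E2 - u * E3"
  proof -
    have "E2 = v * phP x $ 2 + u * kappa x" "E3 = - u * phP x $ 2 + v * kappa x"
      by (simp_all add: E2_def E3_def newvars_simps kappa_def u_def v_def k_def s_def spin_transversal_def mult.commute)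
    then show "kappa x = u * E2 + v * E3" "phP x $ 2 = v * E2 - u * E3"
      using uv by algebra+
  qed
  define D where "D i h =
    (if i = 1 then phL h $ 1
     else if i = 2 then E3 * ((v * phL h $ 2 - u * phL h $ 3) * k) + v * phP h $ 2
       + u * (w * (c * phL h $ 1 - phP h $ 3) - (e + (u * E2 + v * E3) * c * w) * phy h $ 2)
     else if i = 3 then - (E2 * ((v * phL h $ 2 - u * phL h $ 3) * k)) - u * phP h $ 2
       + v * (w * (c * phL h $ 1 - phP h $ 3) - (e + (u * E2 + v * E3) * c * w) * phy h $ 2)
     else if i = 4 then - (l * k) * phM h $ 1 - p * k * n * (e * phL h $ 1 + s * (u * phL h $ 2 + v * phL h $ 3))
        + p * l * k * k * (u * phL h $ 2 + v * phL h $ 3)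
     else if i = 5 then (e * phL h $ 1 + s * (u * phL h $ 2 + v * phL h $ 3)) * n
     else if i = 6 then v * phM h $ 2 - u * phM h $ 3 - (q * u + g * v) * ((v * phL h $ 2 - u * phL h $ 3) * k)
     else if i = 7 then phy h $ 1 else phP h $ 1)" for i :: 8 and h :: phase
  have LX: "phL x \<bullet> phL h = e * phL h $ 1 + s * (u * phL h $ 2 + v * phL h $ 3)" for h
    by (simp add: inner_vec_def sum_3 L algebra_simps)
  have uv_eq: "phL x $ 2 / s = u" "phL x $ 3 / s = v"
    by (simp_all add: u_def v_def k_def)
  have D_eq: "newvars_deriv x i = D i" for i
  proof
    fix h
    show "newvars_deriv x i h = D i h"
      unfolding newvars_deriv_def Let_def D_def s_def[symmetric] l_def[symmetric] LX[of h] uv_eq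
         E2_def[symmetric] E3_def[symmetric] kappa(1) p_def[symmetric] q_def[symmetric] g_def[symmetric] e_def[symmetric] c_def[symmetric]
      by (simp add: k_def n_def w_def power2_eq_square)
  qed
  have der: "((\<lambda>z. newvars z $ i) has_derivative D i) (at x)" for i
    using newvars_has_derivative[OF x] unfolding D_eq .
  have Z: "newE x $ 1 = e" "newZ x $ 1 = - p * l * k" "newZ x $ 2 = l" "newZ x $ 3 = q * v - g * u"
    by (simp_all add: newvars_simps e_def p_def q_def g_def l_def k_def s_def spin_transversal_def u_def v_def diff_divide_distrib)
  define B where "B i j = pbracket (\<lambda>z. newvars z $ i) (\<lambda>z. newvars z $ j) x" for i j
  have B: "B i j = D i (hamvec (\<lambda>z. newvars z $ j) x)" for i j
    unfolding B_def by (rule pbracket_hamvec[OF der])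
  note unf = B hamvec_def phase_gradients[OF der] phase_components
  note D_simps = D_def axis_def cross3_def L p_def[symmetric] q_def[symmetric] g_def[symmetric]
  \<comment> \<open>Antisymmetry leaves the pairs \<open>i < j\<close>. The columns 7 and 8 are
    settled at once by \<open>b7\<close> and \<open>b8\<close>, because \<open>r\<close> and
    \<open>P_r\<close> are conjugate to each other and absent from the other new variables.\<close>
  have b12: "B 1 2 = E3" unfolding unf using uv sk by (simp add: D_simps; algebra)
  have b13: "B 1 3 = - E2" unfolding unf using uv sk by (simp add: D_simps; algebra)
  have b23: "B 2 3 = e" unfolding unf using uv sk sw sc by (simp add: D_simps; algebra)
  have b14: "B 1 4 = 0" unfolding unf using uv sk by (simp add: D_simps; simp add: algebra_simps)
  have b15: "B 1 5 = 0" unfolding unf using uv sk by (simp add: D_simps)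
  have b16: "B 1 6 = 0" unfolding unf using uv sk by (simp add: D_simps; algebra)
  have b24: "B 2 4 = 0" unfolding unf using uv sk ln ll Cs by (simp add: D_simps; algebra)
  have b25: "B 2 5 = 0" unfolding unf using uv sk ln ll Cs by (simp add: D_simps; algebra)
  have b26: "B 2 6 = 0" unfolding unf using uv sk ln ll Cs by (simp add: D_simps; algebra)
  have b34: "B 3 4 = 0" unfolding unf using uv sk ln ll Cs by (simp add: D_simps; algebra)
  have b35: "B 3 5 = 0" unfolding unf using uv sk ln ll Cs by (simp add: D_simps; algebra)
  have b36: "B 3 6 = 0" unfolding unf using uv sk ln ll Cs by (simp add: D_simps; algebra)
  have b45: "B 4 5 = q * v - g * u" unfolding unf using uv sk ln ll Cs by (simp add: D_simps; algebra)
  have b46: "B 4 6 = l" unfolding unf using uv sk ln ll Cs by (simp add: D_simps; algebra)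
  have b56: "B 5 6 = - p * l * k" unfolding unf using uv sk ln ll Cs by (simp add: D_simps; algebra)
  have b7: "B i 7 = (if i = 8 then - 1 else 0)" for i unfolding unf
    by (cases i rule: exhaust_8) (simp_all add: D_simps)
  have b8: "B i 8 = (if i = 7 then 1 else 0)" for i unfolding unf
    by (cases i rule: exhaust_8) (simp_all add: D_simps)
  note b = b12 b13 b23 b14 b15 b16 b24 b25 b26 b34 b35 b36 b45 b46 b56 b7 b8
  have flip: "B j i = - t" if "B i j = t" for i j t
    using that pbracket_skew[of "\<lambda>z. newvars z $ i" "\<lambda>z. newvars z $ j" x] by (simp add: B_def)
  have self: "B i i = 0" for i unfolding B_def by (rule pbracket_self)
  have "B i j = poisson_matrix (newvars x) $ i $ j"
    by (cases i rule: exhaust_8; cases j rule: exhaust_8)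
      (simp_all add: poisson_matrix_def newvars_def Z b self E2_def[symmetric] E3_def[symmetric] b[THEN flip])
  then show ?thesis by (simp add: B_def)
qed


section \<open>Rank and Casimir functions of the reduced bracket\<close>

lemma poisson_matrix_mult_nth:
  "(poisson_matrix w *v x) $ 1 = w $ 3 * x $ 2 - w $ 2 * x $ 3"
  "(poisson_matrix w *v x) $ 2 = w $ 1 * x $ 3 - w $ 3 * x $ 1"
  "(poisson_matrix w *v x) $ 3 = w $ 2 * x $ 1 - w $ 1 * x $ 2"
  "(poisson_matrix w *v x) $ 4 = w $ 6 * x $ 5 + w $ 5 * x $ 6"
  "(poisson_matrix w *v x) $ 5 = w $ 4 * x $ 6 - w $ 6 * x $ 4"
  "(poisson_matrix w *v x) $ 6 = - w $ 5 * x $ 4 - w $ 4 * x $ 5"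
  "(poisson_matrix w *v x) $ 7 = x $ 8"
  "(poisson_matrix w *v x) $ 8 = - x $ 7"
  by (simp_all add: matrix_vector_mult_def sum_8 poisson_matrix_def)

lemma poisson_matrix_skew: "x \<bullet> (poisson_matrix w *v y) = - (y \<bullet> (poisson_matrix w *v x))"
  unfolding inner_vec_def sum_8 poisson_matrix_mult_nth by (simp add: algebra_simps)

lemma red_bracket_inner: "red_bracket f g w = gradient f w \<bullet> (poisson_matrix w *v gradient g w)"
  by (simp add: red_bracket_def inner_vec_def matrix_vector_mult_def sum_distrib_left mult_ac)

lemma C_circ_red_has_derivative:
  "(C_circ_red has_derivative (\<lambda>h. - 2 * w $ 4 * h $ 4 + 2 * w $ 5 * h $ 5 - 2 * w $ 6 * h $ 6)) (at w)"
  unfolding C_circ_red_def[abs_def] by (auto intro!: derivative_eq_intros ext)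

lemma F_red_has_derivative:
  "(F_red has_derivative (\<lambda>h. 2 * w $ 1 * h $ 1 + 2 * w $ 2 * h $ 2 + 2 * w $ 3 * h $ 3)) (at w)"
  unfolding F_red_def[abs_def] by (auto intro!: derivative_eq_intros ext)

lemma gradient_casimirs:
  "gradient C_circ_red w = pack 0 (vector [- 2 * w $ 4, 2 * w $ 5, - 2 * w $ 6]) 0 0"
  "gradient F_red w = pack (vector [2 * w $ 1, 2 * w $ 2, 2 * w $ 3]) 0 0 0"
  by (simp_all add: vec_eq_iff forall_8 gradient_nth[OF C_circ_red_has_derivative]
      gradient_nth[OF F_red_has_derivative] axis_def)

lemma poisson_matrix_casimirs:
  "poisson_matrix w *v gradient C_circ_red w = 0" "poisson_matrix w *v gradient F_red w = 0"
  by (simp_all add: vec_eq_iff forall_8 poisson_matrix_mult_nth gradient_casimirs)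

lemma inner_gradient_casimirs:
  "gradient C_circ_red w \<bullet> (poisson_matrix w *v g) = 0"
  "gradient F_red w \<bullet> (poisson_matrix w *v g) = 0"
  by (subst poisson_matrix_skew, simp add: poisson_matrix_casimirs)+

lemma differentiable_casimirs: "C_circ_red differentiable (at w)" "F_red differentiable (at w)"
  by (rule differentiableI[OF C_circ_red_has_derivative] differentiableI[OF F_red_has_derivative])+

lemma red_bracket_casimirs: "red_bracket C_circ_red f w = 0" "red_bracket F_red f w = 0"
  by (simp_all add: red_bracket_inner inner_gradient_casimirs)

text \<open>The matrix is block diagonal. On the \<open>E\<close> block the kernel condition says
  that the vector product with \<open>E\<close> vanishes, so the block of \<open>x\<close> is
  parallel to \<open>E\<close>; on the \<open>Z\<close> block it forces \<open>x\<close> to be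
  parallel to \<open>(- Z_1, Z_2, - Z_3)\<close>; the block of \<open>(r, P_r)\<close> is
  invertible.\<close>

lemma poisson_matrix_kernel:
  assumes Z: "w $ 5 \<noteq> 0" and E: "F_red w \<noteq> 0" and x: "poisson_matrix w *v x = 0"
  shows "x \<in> span {gradient C_circ_red w, gradient F_red w}"
proof -
  have c: "w $ 3 * x $ 2 = w $ 2 * x $ 3" "w $ 1 * x $ 3 = w $ 3 * x $ 1" "w $ 2 * x $ 1 = w $ 1 * x $ 2"
    "w $ 5 * x $ 6 = - (w $ 6 * x $ 5)" "w $ 5 * x $ 4 = - (w $ 4 * x $ 5)" "x $ 8 = 0" "x $ 7 = 0"
    using poisson_matrix_mult_nth[of w x] unfolding x by simp_all
  \<comment> \<open>\<open>t\<close> is read off from component 5, where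
    \<open>Z_2 \<noteq> 0\<close>, and \<open>q\<close> is the coefficient of the projection onto
    \<open>E\<close>. The factor 2 comes from the gradients of squares.\<close>
  define t where "t = x $ 5 / (2 * w $ 5)"
  define q where "q = (w $ 1 * x $ 1 + w $ 2 * x $ 2 + w $ 3 * x $ 3) / (2 * F_red w)"
  have "F_red w * x $ 1 = w $ 1 * (w $ 1 * x $ 1 + w $ 2 * x $ 2 + w $ 3 * x $ 3)"
    "F_red w * x $ 2 = w $ 2 * (w $ 1 * x $ 1 + w $ 2 * x $ 2 + w $ 3 * x $ 3)"
    "F_red w * x $ 3 = w $ 3 * (w $ 1 * x $ 1 + w $ 2 * x $ 2 + w $ 3 * x $ 3)"
    unfolding F_red_def using c(1-3) by algebra+
  then have 1: "x $ 1 = q * (2 * w $ 1)" "x $ 2 = q * (2 * w $ 2)" "x $ 3 = q * (2 * w $ 3)"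
    unfolding q_def using E by (simp_all add: field_simps)
  have 2: "x $ 4 = t * (- 2 * w $ 4)" "x $ 5 = t * (2 * w $ 5)" "x $ 6 = t * (- 2 * w $ 6)"
    unfolding t_def using Z c(4,5) by (simp_all add: field_simps)
  have "x = t *\<^sub>R gradient C_circ_red w + q *\<^sub>R gradient F_red w"
    by (simp add: vec_eq_iff forall_8 gradient_casimirs 1 2 c(6,7))
  also have "\<dots> \<in> span {gradient C_circ_red w, gradient F_red w}"
    by (intro span_add span_scale span_base) auto
  finally show ?thesis .
qed

text \<open>The two gradients are supported on disjoint sets of coordinates, hence
  orthogonal.\<close>

lemma dim_casimir_gradients:
  assumes "w $ 5 \<noteq> 0" "F_red w \<noteq> 0"
  shows "dim {gradient C_circ_red w, gradient F_red w} = 2"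
proof -
  let ?C = "gradient C_circ_red w" and ?F = "gradient F_red w"
  have C0: "?C \<noteq> 0" using assms(1) by (simp add: vec_eq_iff forall_8 gradient_casimirs)
  have F0: "?F \<noteq> 0" using assms(2) by (auto simp: vec_eq_iff forall_8 gradient_casimirs F_red_def)
  have orth: "orthogonal ?C ?F"
    unfolding orthogonal_def inner_vec_def sum_8 by (simp add: gradient_casimirs)
  with C0 have "?C \<noteq> ?F" by (auto simp: orthogonal_self)
  moreover have "independent {?C, ?F}"
    using orth C0 F0 by (intro pairwise_orthogonal_independent) (auto simp: pairwise_def orthogonal_commute)
  ultimately show ?thesis by (simp add: dim_eq_card_independent)
qed

text \<open>The row space is the orthogonal complement of the kernel, which the two Casimir
  gradients span: \<open>8 - 2 = 6\<close>.\<close>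

lemma rank_poisson_matrix:
  assumes "w $ 5 \<noteq> 0" "F_red w \<noteq> 0"
  shows "rank (poisson_matrix w) = 6"
proof -
  let ?R = "span (rows (poisson_matrix w))" and ?K = "span {gradient C_circ_red w, gradient F_red w}"
  have "(\<forall>x\<in>?R. orthogonal x y) \<longleftrightarrow> poisson_matrix w *v y = 0" for y
  proof
    assume "\<forall>x\<in>?R. orthogonal x y"
    then have "orthogonal (row i (poisson_matrix w)) y" for i
      by (auto simp: rows_def intro!: span_base)
    then show "poisson_matrix w *v y = 0"
      by (simp add: vec_eq_iff matrix_vector_mul_component row_def orthogonal_def)
  next
    assume "poisson_matrix w *v y = 0"
    then show "\<forall>x\<in>?R. orthogonal x y"
      using orthogonal_nullspace_rowspace orthogonal_commute by blast
  qed
  moreover have "poisson_matrix w *v y = 0 \<longleftrightarrow> y \<in> ?K" for y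
  proof
    show "y \<in> ?K" if "poisson_matrix w *v y = 0"
      by (rule poisson_matrix_kernel[OF assms that])
    have "subspace {y. poisson_matrix w *v y = 0}"
      by (auto simp: subspace_def matrix_vector_right_distrib matrix_vector_mult_scaleR)
    moreover have "{gradient C_circ_red w, gradient F_red w} \<subseteq> {y. poisson_matrix w *v y = 0}"
      using poisson_matrix_casimirs by auto
    ultimately have "?K \<subseteq> {y. poisson_matrix w *v y = 0}" by (rule span_minimal[rotated])
    then show "poisson_matrix w *v y = 0" if "y \<in> ?K" using that by auto
  qed
  ultimately have "{y \<in> UNIV. \<forall>x\<in>?R. orthogonal x y} = ?K" by auto
  then have "dim ?K + dim ?R = dim (UNIV :: (real^8) set)"
    using dim_subspace_orthogonal_to_vectors[of ?R UNIV] by simp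
  then show ?thesis
    by (simp add: row_rank_def dim_casimir_gradients[OF assms])
qed

text \<open>The brackets with the coordinate functions are already all components of the kernel
  condition. This is the infinitesimal form of the claim that every Casimir function depends on the
  two known ones.\<close>

lemma casimir_gradient_in_span:
  assumes "w $ 5 \<noteq> 0" "F_red w \<noteq> 0"
    and K: "\<And>f. f differentiable (at w) \<Longrightarrow> red_bracket K f w = 0"
  shows "gradient K w \<in> span {gradient C_circ_red w, gradient F_red w}"
proof (rule poisson_matrix_kernel[OF assms(1,2)])
  have "(poisson_matrix w *v gradient K w) $ j = 0" for j
  proof -
    have "(\<lambda>w::real^8. w $ j) differentiable (at w)"
      by (rule bounded_linear_imp_differentiable[OF bounded_linear_vec_nth])
    from K[OF this] show ?thesis
      unfolding red_bracket_inner gradient_component poisson_matrix_skew[of "gradient K w"]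
      by (simp add: inner_axis' )
  qed
  then show "poisson_matrix w *v gradient K w = 0" by (simp add: vec_eq_iff)
qed

section \<open>The Casimir functions in the new variables\<close>

text \<open>\<open>(Q_1, Q_2)\<close> is \<open>(X, P_\<theta>)\<close> rotated by the angle
  \<open>\<phi>\<close>, so \<open>\<phi>\<close> drops out of the length.\<close>

lemma F_int_eq:
  assumes "sin (phy x $ 2) \<noteq> 0"
  shows "F_int x = (phP x $ 2)\<^sup>2 + (phP x $ 3)\<^sup>2
    + (phL x $ 1 - phP x $ 3 * cos (phy x $ 2))\<^sup>2 / (sin (phy x $ 2))\<^sup>2"
proof -
  define X where "X = (phL x $ 1 - phP x $ 3 * cos (phy x $ 2)) / sin (phy x $ 2)"
  define c s where "c = cos (phy x $ 3)" and "s = sin (phy x $ 3)"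
  have cs: "s\<^sup>2 + c\<^sup>2 = 1" by (simp add: c_def s_def)
  have "F_int x = (c * X - phP x $ 2 * s)\<^sup>2 + (s * X + phP x $ 2 * c)\<^sup>2 + (phP x $ 3)\<^sup>2"
    by (simp add: F_int_def Qvec_def Let_def inner_vec_def sum_3 X_def c_def s_def power2_eq_square)
  also have "\<dots> = (phP x $ 2)\<^sup>2 + (phP x $ 3)\<^sup>2 + X\<^sup>2" using cs by algebra
  finally show ?thesis by (simp add: X_def power_divide)
qed

lemma casimirs_newvars:
  assumes x: "x \<in> regular_region \<mu>"
  shows "F_int x = F_red (newvars x)"
    and "C_star x = 0 \<Longrightarrow> C_circ x = C_circ_red (newvars x)"
    and "newvars x $ 5 > 0"
proof -
  define s where "s = spin_transversal x"
  define u v where "u = phL x $ 2 / s" and "v = phL x $ 3 / s"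
  have s0: "(phL x $ 2)\<^sup>2 + (phL x $ 3)\<^sup>2 > 0" and sin: "sin (phy x $ 2) \<noteq> 0"
    using x by (auto simp: regular_region_def exterior_def less_le sum_power2_eq_zero_iff)
  then have s: "s > 0" by (simp add: s_def spin_transversal_def)
  have s2: "s\<^sup>2 = (phL x $ 2)\<^sup>2 + (phL x $ 3)\<^sup>2" by (simp add: s_def spin_transversal_def)
  have L: "phL x $ 2 = s * u" "phL x $ 3 = s * v" using s by (simp_all add: u_def v_def)
  have "(s * s) * (u * u + v * v) = (s * s) * 1"
    using s2 unfolding L by algebra
  then have uv: "u\<^sup>2 + v\<^sup>2 = 1" using s by (simp add: power2_eq_square)
  have LL: "phL x \<bullet> phL x = (phL x $ 1)\<^sup>2 + s\<^sup>2"
    unfolding s2 by (simp add: inner_vec_def sum_3 power2_eq_square)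
  then have pos: "phL x \<bullet> phL x > 0" using s by (simp add: add_nonneg_pos)
  then show "newvars x $ 5 > 0" by (simp add: newvars_def newvars_simps)
  show "F_int x = F_red (newvars x)"
  proof -
    have E: "newE x $ 2 = v * phP x $ 2 + u * kappa x" "newE x $ 3 = - u * phP x $ 2 + v * kappa x"
      by (simp_all add: newvars_simps kappa_def u_def v_def s_def spin_transversal_def mult.commute)
    have "F_red (newvars x) = (phL x $ 1)\<^sup>2 + (phP x $ 2)\<^sup>2 + (kappa x)\<^sup>2"
      unfolding F_red_def newvars_def pack_nth E newvars_simps(1) using uv by algebra
    \<comment> \<open>After multiplication by the square of the sine both sides are
      \<open>e^2 + p^2 - 2 e p cos \<theta>\<close>, where \<open>e = L_1\<close> and
      \<open>p\<close> is the third component of the total angular momentum.\<close>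
    moreover have "(phL x $ 1)\<^sup>2 + (kappa x)\<^sup>2 = (phP x $ 3)\<^sup>2
       + ((phL x $ 1 - phP x $ 3 * cos (phy x $ 2)) / sin (phy x $ 2))\<^sup>2"
    proof -
      define c \<sigma> where "c = cos (phy x $ 2)" and "\<sigma> = sin (phy x $ 2)"
      define w where "w = 1 / \<sigma>"
      have "\<sigma>\<^sup>2 + c\<^sup>2 = 1" "\<sigma> * w = 1" using sin by (simp_all add: c_def \<sigma>_def w_def)
      then have "e\<^sup>2 + ((e * c - p) * w)\<^sup>2 = p\<^sup>2 + ((e - p * c) * w)\<^sup>2" for e p
        by algebra
      then show ?thesis by (simp add: kappa_def c_def \<sigma>_def w_def)
    qed
    ultimately show ?thesis unfolding F_int_eq[OF sin] by (simp add: power_divide)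
  qed
  assume C: "C_star x = 0"
  show "C_circ x = C_circ_red (newvars x)"
  proof -
    define k where "k = 1 / s"
    define l where "l = sqrt (phL x \<bullet> phL x)"
    define e where "e = phL x $ 1"
    define p q g where "p = phM x $ 1" and "q = phM x $ 2" and "g = phM x $ 3"
    have l: "l\<^sup>2 = e\<^sup>2 + s\<^sup>2" using pos LL by (simp add: l_def e_def)
    have sk: "s * k = 1" using s by (simp add: k_def)
    have Cs: "e * p + s * (u * q + v * g) = 0"
      using C by (simp add: C_star_def inner_vec_def sum_3 L p_def q_def g_def e_def algebra_simps)
    have Z: "newZ x $ 1 = - p * l * k" "newZ x $ 2 = l" "newZ x $ 3 = q * v - g * u"
      by (simp_all add: newvars_simps p_def q_def g_def l_def k_def s_def spin_transversal_def u_def v_def diff_divide_distrib)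
    have "C_circ x = e\<^sup>2 + s\<^sup>2 - (p\<^sup>2 + q\<^sup>2 + g\<^sup>2)"
      unfolding C_circ_def LL by (simp add: e_def inner_vec_def sum_3 p_def q_def g_def power2_eq_square)
    \<comment> \<open>By \<open>Cs\<close> the component \<open>u q + v g\<close> of
      \<open>M\<close> along the transversal part of \<open>L\<close> is \<open>- e p k\<close>; its
      square and \<open>p^2\<close> add up to \<open>p^2 (1 + e^2 k^2) = (p l k)^2\<close>.\<close>
    also have "\<dots> = - (- p * l * k)\<^sup>2 + l\<^sup>2 - (q * v - g * u)\<^sup>2"
      using uv sk Cs l by algebra
    finally show ?thesis
      by (simp add: C_circ_red_def newvars_def Z)
  qed
qed


section \<open>Reduction of the equations of motion\<close>

lemma differentiable_vec_nth [derivative_intros]: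
  assumes "f differentiable F"
  shows "(\<lambda>x. f x $ i) differentiable F"
  using assms unfolding differentiable_def by (blast intro: derivative_intros)

lemma differentiable_phase_components [derivative_intros]:
  "(\<lambda>z. phL z) differentiable (at x)" "(\<lambda>z. phM z) differentiable (at x)"
  "(\<lambda>z. phP z) differentiable (at x)" "(\<lambda>z. phy z) differentiable (at x)"
  by (simp_all add: bounded_linear_phase_components[THEN bounded_linear_imp_differentiable])

lemma differentiable_real_sqrt [derivative_intros]:
  fixes f :: "'a::real_normed_vector \<Rightarrow> real"
  assumes "f differentiable (at x)" "f x > 0"
  shows "(\<lambda>x. sqrt (f x)) differentiable (at x)"
proof -
  from assms(1) obtain D where "(f has_derivative D) (at x)" by (auto simp: differentiable_def)
  from has_derivative_compose[OF this DERIV_real_sqrt[OF assms(2), unfolded has_field_derivative_def]]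
  show ?thesis by (auto simp: differentiable_def)
qed

lemma differentiable_sin_cos [derivative_intros]:
  fixes f :: "'a::real_normed_vector \<Rightarrow> real"
  assumes "f differentiable (at x)"
  shows "(\<lambda>x. sin (f x)) differentiable (at x)" "(\<lambda>x. cos (f x)) differentiable (at x)"
proof -
  from assms obtain D where D: "(f has_derivative D) (at x)" by (auto simp: differentiable_def)
  from has_derivative_compose[OF D DERIV_sin[unfolded has_field_derivative_def]]
    has_derivative_compose[OF D DERIV_cos[unfolded has_field_derivative_def]]
  show "(\<lambda>x. sin (f x)) differentiable (at x)" "(\<lambda>x. cos (f x)) differentiable (at x)"
    by (auto simp: differentiable_def)
qed

lemma open_regular_region: "open (regular_region \<mu>)"
proof -
  have "regular_region \<mu> = phy -` exterior \<mu> \<inter> {x. (phL x $ 2)\<^sup>2 + (phL x $ 3)\<^sup>2 \<noteq> 0}"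
    by (auto simp: regular_region_def)
  moreover have "open (phy -` exterior \<mu>)"
    by (rule continuous_open_vimage[OF open_exterior])
      (simp add: bounded_linear_phase_components linear_continuous_at)
  moreover have "open {x. (phL x $ 2)\<^sup>2 + (phL x $ 3)\<^sup>2 \<noteq> 0}"
    by (intro open_Collect_neq continuous_intros)
  ultimately show ?thesis by (simp only: open_Int)
qed

lemma frame_momentum_differentiable:
  assumes "phy x \<in> exterior \<mu>" "\<mu> > 0"
  shows "(\<lambda>z. frame_momentum \<mu> z i) differentiable (at x)"
proof -
  have r: "phy x $ 1 > 2 * \<mu>" "phy x $ 1 \<noteq> 0" "sin (phy x $ 2) \<noteq> 0"
    using assms by (auto simp: exterior_def)
  then have a: "1 - 2 * \<mu> / phy x $ 1 > 0" using assms(2) by (simp add: field_simps)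
  show ?thesis
    by (cases i rule: exhaust_4_0)
      (use r a in \<open>auto simp: frame_momentum_values rad_def radP_def schw_a_def intro!: derivative_intros\<close>)
qed

text \<open>\<open>Ham\<close> is defined through a matrix inverse and gradients of metric
  coefficients. On the open set \<open>regular_region\<close> it equals the explicit expression
  \<open>?H\<close> in the frame momentum, to which the rules of differentiation apply.\<close>

lemma Ham_differentiable:
  assumes x: "x \<in> regular_region \<mu> \<inter> ham_domain \<mu>" and "\<mu> > 0" "m > 0"
  shows "Ham \<mu> m differentiable (at x)"
    and "open (regular_region \<mu> \<inter> ham_domain \<mu>)"
proof -
  define psq where "psq z = - (frame_momentum \<mu> z 0)\<^sup>2 + (frame_momentum \<mu> z 1)\<^sup>2
     + (frame_momentum \<mu> z 2)\<^sup>2 + (frame_momentum \<mu> z 3)\<^sup>2" for z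
  define den where "den z = 2 * \<mu> / (rad z) ^ 3 * spin_trace (phL z) (phM z) + 2 * psq z" for z
  have ext: "phy z \<in> exterior \<mu>" if "z \<in> regular_region \<mu>" for z
    using that by (simp add: regular_region_def)
  have den: "d_scal \<mu> z + 2 * p_sq \<mu> z = den z" if "z \<in> regular_region \<mu>" for z
    using ext[OF that] \<open>\<mu> > 0\<close> by (simp add: den_def d_scal_eq p_sq_frame psq_def)
  have den_diff: "den differentiable (at z)" if "z \<in> regular_region \<mu>" for z
  proof -
    have "phy z $ 1 \<noteq> 0" using ext[OF that] \<open>\<mu> > 0\<close> by (auto simp: exterior_def)
    then show ?thesis
      unfolding den_def[abs_def] psq_def[abs_def] spin_trace_def rad_def
      by (auto intro!: derivative_intros frame_momentum_differentiable[OF ext[OF that] \<open>\<mu> > 0\<close>])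
  qed
  have "continuous_on (regular_region \<mu>) den"
    by (intro continuous_at_imp_continuous_on ballI differentiable_imp_continuous_within den_diff)
  then have "open (den -` (- {0}) \<inter> regular_region \<mu>)"
    using open_regular_region continuous_on_open_vimage by blast
  also have "den -` (- {0}) \<inter> regular_region \<mu> = regular_region \<mu> \<inter> ham_domain \<mu>"
    by (auto simp: ham_domain_def den)
  finally show "open (regular_region \<mu> \<inter> ham_domain \<mu>)" .
  have x': "x \<in> regular_region \<mu>" "phy x \<in> exterior \<mu>" using x ext by auto
  have nz: "phy x $ 1 \<noteq> 0" "den x \<noteq> 0" using x x' den[of x] \<open>\<mu> > 0\<close> by (auto simp: exterior_def ham_domain_def)
  let ?H = "\<lambda>z. psq z / (2 * m) - 2 * \<mu> / (rad z) ^ 3 * spin_quad (phL z) (phM z) (frame_momentum \<mu> z) / (m * den z)"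
  have "?H differentiable (at x)"
    unfolding psq_def[abs_def] spin_quad_def rad_def
    using nz \<open>m > 0\<close> by (auto intro!: derivative_intros frame_momentum_differentiable[OF x'(2) \<open>\<mu> > 0\<close>] den_diff[OF x'(1)])
  then obtain D where D: "(?H has_derivative D) (at x)" by (auto simp: differentiable_def)
  have "(Ham \<mu> m has_derivative D) (at x)"
  proof (rule has_derivative_transform_within_open[OF D open_regular_region x'(1)])
    fix z assume z: "z \<in> regular_region \<mu>"
    show "?H z = Ham \<mu> m z"
      unfolding Ham_frame[OF ext[OF z] \<open>\<mu> > 0\<close>] den[OF z]
      unfolding p_sq_frame[OF ext[OF z] \<open>\<mu> > 0\<close>] psq_def ..
  qed
  then show "Ham \<mu> m differentiable (at x)" by (auto simp: differentiable_def)
qed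

text \<open>\<open>t\<close> enters neither the metric nor the frame momentum, so \<open>Ham\<close>
  is constant along the \<open>t\<close> lines. Conservation of the energy rests on this.\<close>

lemma Ham_time_independent:
  assumes x: "x \<in> regular_region \<mu> \<inter> ham_domain \<mu>" and "\<mu> > 0" "m > 0"
  shows "grady (Ham \<mu> m) x $ 0 = 0"
proof -
  obtain D where D: "(Ham \<mu> m has_derivative D) (at x)"
    using Ham_differentiable[OF assms] by (auto simp: differentiable_def)
  let ?e = "(0, 0, 0, axis 0 1) :: phase"
  have const: "Ham \<mu> m (x + t *\<^sub>R ?e) = Ham \<mu> m x" for t
  proof -
    define z where "z = x + t *\<^sub>R ?e"
    have ph: "phL z = phL x" "phM z = phM x" "phP z = phP x"
      "phy z = phy x + t *\<^sub>R axis 0 1"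
      by (simp_all add: z_def phL_def phM_def phP_def phy_def)
    have r: "rad z = rad x" "radP z = radP x"
      unfolding rad_def radP_def ph by (simp_all add: axis_def)
    have y: "phy z $ 1 = phy x $ 1" "phy z $ 2 = phy x $ 2"
      unfolding ph by (simp_all add: axis_def)
    have ext: "phy x \<in> exterior \<mu>" "phy z \<in> exterior \<mu>"
      using x unfolding regular_region_def exterior_def by (simp_all add: y)
    have fm: "frame_momentum \<mu> z i = frame_momentum \<mu> x i" for i
      by (cases i rule: exhaust_4_0) (simp_all only: frame_momentum_values r ph(1-3) y)
    have "frame_momentum \<mu> z = frame_momentum \<mu> x" using fm by blast
    then have "Ham \<mu> m z = Ham \<mu> m x"
      using \<open>\<mu> > 0\<close> by (simp add: Ham_frame[OF ext(1)] Ham_frame[OF ext(2)] d_scal_eq[OF ext(1)]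
        d_scal_eq[OF ext(2)] p_sq_frame[OF ext(1)] p_sq_frame[OF ext(2)] r ph)
    then show ?thesis by (simp only: z_def)
  qed
  have "((\<lambda>t. x + t *\<^sub>R ?e) has_derivative (\<lambda>t. t *\<^sub>R ?e)) (at (0::real))"
    by (auto intro!: derivative_eq_intros)
  then have "((\<lambda>t. Ham \<mu> m (x + t *\<^sub>R ?e)) has_derivative (\<lambda>t. D (t *\<^sub>R ?e))) (at (0::real))"
    by (rule has_derivative_compose) (simp add: D flip: zero_prod_def)
  then have "((\<lambda>t::real. Ham \<mu> m x) has_derivative (\<lambda>t. D (t *\<^sub>R ?e))) (at 0)"
    by (simp only: const)
  then have "(\<lambda>t. D (t *\<^sub>R ?e)) = (\<lambda>t::real. 0)"
    using has_derivative_const has_derivative_unique by blast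
  then have "D (1 *\<^sub>R ?e) = 0" by (rule fun_cong)
  then show ?thesis by (simp add: phase_gradients[OF D])
qed

section \<open>Brackets of the new variables with the Hamiltonian\<close>

lemma C_star_has_derivative:
  "(C_star has_derivative (\<lambda>h. phL x \<bullet> phM h + phL h \<bullet> phM x)) (at x)"
  unfolding C_star_def[abs_def] by (auto intro!: derivative_eq_intros)

text \<open>The gradients of \<open>C_star\<close> in \<open>L\<close> and \<open>M\<close> are
  \<open>M\<close> and \<open>L\<close>, and with these the triple products cancel
  identically.\<close>

lemma pbracket_C_star: "pbracket C_star g x = 0"
proof -
  have "gradL C_star x = phM x" "gradM C_star x = phL x" "gradP C_star x = 0" "grady C_star x = 0"
    by (simp_all add: phase_gradients[OF C_star_has_derivative] vec_eq_iff inner_axis inner_axis' zero_prod_def)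
  then show ?thesis
    unfolding pbracket_gradients hamvec_def phase_components
    by (simp add: cross3_def inner_vec_def sum_3 algebra_simps)
qed

lemma energy_has_derivative: "(energy has_derivative (\<lambda>h. - phP h $ 0)) (at x)"
  unfolding energy_def[abs_def] by (auto intro!: derivative_eq_intros)

text \<open>One function of all eight variables, so that a single \<open>gradient\<close> and
  \<open>poisson_matrix\<close> describe the flow; the energy stays a parameter.\<close>

definition Ham_red8 :: "real \<Rightarrow> real \<Rightarrow> real \<Rightarrow> real^8 \<Rightarrow> real" where
  "Ham_red8 \<mu> m \<E> w = Ham_red \<mu> m \<E> (unpackE w) (unpackZ w) (w $ 7) (w $ 8)"

lemma unpack_nth:
  "unpackE w $ 1 = w $ 1" "unpackE w $ 2 = w $ 2" "unpackE w $ 3 = w $ 3"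
  "unpackZ w $ 1 = w $ 4" "unpackZ w $ 2 = w $ 5" "unpackZ w $ 3 = w $ 6"
  by (simp_all add: unpackE_def unpackZ_def)

lemma unpack_pack: "unpackE (pack E Z r p) = E" "unpackZ (pack E Z r p) = Z"
  by (simp_all add: vec_eq_iff forall_3 unpack_nth)

lemma Ham_red8_newvars:
  "Ham_red8 \<mu> m \<E> (newvars x) = Ham_red \<mu> m \<E> (newE x) (newZ x) (rad x) (radP x)"
  by (simp add: Ham_red8_def newvars_def unpack_pack)

lemma Ham_red8_differentiable:
  assumes "\<mu> > 0" "m > 0" "w $ 7 > 2 * \<mu>" "w $ 5 > 0" "(w $ 5)\<^sup>2 - (w $ 1)\<^sup>2 > 0"
    and V: "Vfun \<mu> (mass_sq \<mu> \<E> (unpackE w) (unpackZ w) (w $ 7) (w $ 8)) (unpackE w) (unpackZ w) (w $ 7) \<noteq> 0"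
  shows "Ham_red8 \<mu> m \<E> differentiable (at w)"
proof -
  have r: "w $ 7 \<noteq> 0" "w $ 7 - 2 * \<mu> \<noteq> 0" "w $ 7 * (w $ 7 - 2 * \<mu>) > 0" "w $ 5 \<noteq> 0" "1 - 2 * \<mu> / w $ 7 > 0"
    using assms by (auto simp: field_simps)
  have Th: "(\<lambda>w. Theta (unpackE w) (unpackZ w)) differentiable (at w)"
    unfolding Theta_def unpack_nth using assms r by (auto intro!: derivative_intros)
  have a: "(\<lambda>w. schw_a \<mu> (w $ 7)) differentiable (at w)"
    unfolding schw_a_def using r by (auto intro!: derivative_intros)
  have Gm: "(\<lambda>w. Gam \<mu> (unpackE w) (unpackZ w) (w $ 7)) differentiable (at w)"
    unfolding Gam_def unpack_nth using assms r by (auto intro!: derivative_intros a simp: schw_a_def)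
  have ms: "(\<lambda>w. mass_sq \<mu> \<E> (unpackE w) (unpackZ w) (w $ 7) (w $ 8)) differentiable (at w)"
    unfolding mass_sq_def unpack_nth using assms r by (auto intro!: derivative_intros Th Gm a)
  define W where "W w = Vfun \<mu> (mass_sq \<mu> \<E> (unpackE w) (unpackZ w) (w $ 7) (w $ 8)) (unpackE w) (unpackZ w) (w $ 7)" for w
  have W: "W differentiable (at w)"
    unfolding W_def[abs_def] Vfun_def unpack_nth using assms r by (auto intro!: derivative_intros ms)
  have "W w \<noteq> 0" using V by (simp add: W_def)
  then show ?thesis
    unfolding Ham_red8_def[abs_def] Ham_red_def W_def[symmetric] Ham_new_def Let_def unpack_nth
    using assms r by (auto intro!: derivative_intros Th Gm a W)
qed

lemma has_derivative_vec_componentwise: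
  fixes f :: "'a::euclidean_space \<Rightarrow> real^'n"
  shows "(f has_derivative f') (at x) \<longleftrightarrow> (\<forall>i. ((\<lambda>x. f x $ i) has_derivative (\<lambda>h. f' h $ i)) (at x))"
  unfolding has_derivative_componentwise_within[of f] by (auto simp: Basis_vec_def inner_axis)

lemma newvars_vec_has_derivative:
  assumes "x \<in> regular_region \<mu>"
  shows "(newvars has_derivative (\<lambda>h. \<chi> i. newvars_deriv x i h)) (at x)"
  unfolding has_derivative_vec_componentwise using newvars_has_derivative[OF assms] by simp

lemma Ham_red8_differentiable_newvars:
  assumes x: "x \<in> regular_region \<mu> \<inter> ham_domain \<mu>" and "\<mu> > 0" "m > 0" "C_star x = 0"
  shows "Ham_red8 \<mu> m (energy x) differentiable (at (newvars x))"
proof (rule Ham_red8_differentiable[OF assms(2,3)])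
  have x': "x \<in> regular_region \<mu>" using x by simp
  show "newvars x $ 7 > 2 * \<mu>"
    using x' by (simp add: newvars_def rad_def regular_region_def exterior_def)
  show "newvars x $ 5 > 0" by (rule casimirs_newvars[OF x'])
  have pos: "phL x \<bullet> phL x > 0" using casimirs_newvars(3)[OF x'] by (simp add: newvars_def newvars_simps)
  have "(phL x $ 2)\<^sup>2 + (phL x $ 3)\<^sup>2 > 0"
    using x' by (auto simp: regular_region_def less_le sum_power2_eq_zero_iff)
  then show "(newvars x $ 5)\<^sup>2 - (newvars x $ 1)\<^sup>2 > 0"
    using pos by (simp add: newvars_def newvars_simps) (simp add: inner_vec_def sum_3 power2_eq_square)
  show "Vfun \<mu> (mass_sq \<mu> (energy x) (unpackE (newvars x)) (unpackZ (newvars x)) (newvars x $ 7) (newvars x $ 8))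
      (unpackE (newvars x)) (unpackZ (newvars x)) (newvars x $ 7) \<noteq> 0"
    using reduced_Hamiltonian(2)[OF x' assms(2-4)] x
    by (auto simp: ham_domain_def newvars_def unpack_pack)
qed

lemma pbracket_newvars_Ham:
  assumes x: "x \<in> regular_region \<mu> \<inter> ham_domain \<mu>" and \<mu>: "\<mu> > 0" and m: "m > 0" and C: "C_star x = 0"
  shows "pbracket (\<lambda>z. newvars z $ i) (Ham \<mu> m) x
    = (poisson_matrix (newvars x) *v gradient (Ham_red8 \<mu> m (energy x)) (newvars x)) $ i"
proof -
  have x': "x \<in> regular_region \<mu>" using x by simp
  \<comment> \<open>The two Hamiltonians agree only on the level set of \<open>C_star\<close> and of the energy. The projection
    \<open>\<pi>\<close> onto it fixes the vector field of \<open>newvars $ i\<close>, which is tangent to it, so that the derivative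
    of \<open>Ham\<close> along this field is that of \<open>Ham \<circ> \<pi>\<close>.\<close>
  define \<pi> where "\<pi> z = (phL z, phM z - ((phL z \<bullet> phM z) / (phL z \<bullet> phL z)) *\<^sub>R phL z,
      phP z + (phP x $ 0 - phP z $ 0) *\<^sub>R axis 0 1, phy z)" for z :: phase
  have L0: "phL z \<noteq> 0" if "z \<in> regular_region \<mu>" for z
    using that by (auto simp: regular_region_def)
  have LL: "phL x \<bullet> phL x \<noteq> 0" using L0[OF x'] by simp
  have LM: "phL x \<bullet> phM x = 0" using C by (simp add: C_star_def)
  have \<pi>x: "\<pi> x = x" using phase_eq[of x] by (simp add: \<pi>_def LM)
  \<comment> \<open>The derivative of \<open>\<pi>\<close> at \<open>x\<close>. The numerator
    \<open>(L, M)\<close> vanishes at \<open>x\<close>, so the quotient contributes only through the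
    derivative of its numerator.\<close>
  define \<pi>' where "\<pi>' h = (phL h, phM h - ((phL x \<bullet> phM h + phL h \<bullet> phM x) / (phL x \<bullet> phL x)) *\<^sub>R phL x,
      phP h - phP h $ 0 *\<^sub>R axis 0 1, phy h)" for h :: phase
  have d\<pi>: "(\<pi> has_derivative \<pi>') (at x)"
    unfolding \<pi>_def[abs_def] \<pi>'_def[abs_def]
    by (rule derivative_eq_intros refl LL | simp add: LL LM)+
  have reg: "\<pi> z \<in> regular_region \<mu>" if "z \<in> regular_region \<mu>" for z
    using that by (simp add: regular_region_def \<pi>_def)
  have C\<pi>: "C_star (\<pi> z) = 0" if "z \<in> regular_region \<mu>" for z
    using L0[OF that] by (simp add: C_star_def \<pi>_def inner_diff_right)
  have en: "energy (\<pi> z) = energy x" for z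
    by (simp add: energy_def \<pi>_def)
  obtain DH where DH: "(Ham \<mu> m has_derivative DH) (at x)"
    using Ham_differentiable[OF x \<mu> m] by (auto simp: differentiable_def)
  let ?G = "gradient (Ham_red8 \<mu> m (energy x)) (newvars x)"
  have DR: "(Ham_red8 \<mu> m (energy x) has_derivative (\<lambda>h. ?G \<bullet> h)) (at (newvars x))"
    by (rule has_derivative_gradient[OF Ham_red8_differentiable_newvars[OF x \<mu> m C]])
  have 1: "((\<lambda>z. Ham \<mu> m (\<pi> z)) has_derivative (\<lambda>h. DH (\<pi>' h))) (at x)"
    by (rule has_derivative_compose[OF d\<pi>]) (simp add: \<pi>x DH)
  have "((\<lambda>z. newvars (\<pi> z)) has_derivative (\<lambda>h. \<chi> i. newvars_deriv x i (\<pi>' h))) (at x)"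
    by (rule has_derivative_compose[OF d\<pi>, where g = newvars]) (simp add: \<pi>x newvars_vec_has_derivative[OF x'])
  then have 2: "((\<lambda>z. Ham_red8 \<mu> m (energy x) (newvars (\<pi> z))) has_derivative
      (\<lambda>h. ?G \<bullet> (\<chi> i. newvars_deriv x i (\<pi>' h)))) (at x)"
    by (rule has_derivative_compose[where g = "Ham_red8 \<mu> m (energy x)"]) (simp add: \<pi>x DR)
  let ?U = "regular_region \<mu> \<inter> ham_domain \<mu>"
  \<comment> \<open>For \<open>z\<close> near \<open>x\<close> the point \<open>\<pi> z\<close>
    stays in the domain on which the two Hamiltonians agree, so both compositions with
    \<open>\<pi>\<close> have the same derivative at \<open>x\<close>.\<close>
  have "isCont \<pi> x" using d\<pi> has_derivative_continuous by blast
  then have "\<forall>\<^sub>F z in at x. \<pi> z \<in> ?U"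
    using Ham_differentiable(2)[OF x \<mu> m] x
    by (intro topological_tendstoD[of \<pi> "\<pi> x"]) (simp_all add: isCont_def \<pi>x)
  moreover have "\<forall>\<^sub>F z in at x. z \<in> regular_region \<mu>"
    using open_regular_region x' by (auto simp: eventually_at_topological)
  ultimately have ev: "\<forall>\<^sub>F z in at x. Ham_red8 \<mu> m (energy x) (newvars (\<pi> z)) = Ham \<mu> m (\<pi> z)"
    by eventually_elim
      (use reduced_Hamiltonian(3) reg C\<pi> en \<mu> m in \<open>simp add: Ham_red8_newvars\<close>)
  have 3: "((\<lambda>z. Ham \<mu> m (\<pi> z)) has_derivative
      (\<lambda>h. ?G \<bullet> (\<chi> i. newvars_deriv x i (\<pi>' h)))) (at x)"
    using reduced_Hamiltonian(3)[OF x' \<mu> m C] x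
    by (intro has_derivative_transform_eventually[OF 2 ev]) (simp_all add: \<pi>x Ham_red8_newvars)
  have eq: "DH (\<pi>' h) = ?G \<bullet> (\<chi> i. newvars_deriv x i (\<pi>' h))" for h
    using has_derivative_unique[OF 1 3] by metis
  let ?Y = "hamvec (\<lambda>z. newvars z $ i) x"
  note der = newvars_has_derivative[OF x']
  \<comment> \<open>Tangency to the level set: \<open>C_star\<close> is a Casimir function, and the
    \<open>P_t\<close> component of the field is minus the derivative of a new variable in
    \<open>t\<close>, which is 0.\<close>
  have "phL x \<bullet> phM ?Y + phL ?Y \<bullet> phM x = 0"
    using pbracket_hamvec[OF C_star_has_derivative] pbracket_C_star by metis
  moreover have "phP ?Y $ 0 = 0"
    unfolding hamvec_def phase_components phase_gradients[OF der] newvars_deriv_def Let_def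
    by (simp add: axis_def zero_prod_def)
  ultimately have Y: "\<pi>' ?Y = ?Y"
    using phase_eq[of ?Y] by (simp add: \<pi>'_def)
  have "pbracket (Ham \<mu> m) (\<lambda>z. newvars z $ i) x = DH ?Y"
    by (rule pbracket_hamvec[OF DH])
  also have "\<dots> = ?G \<bullet> (\<chi> j. newvars_deriv x j ?Y)" using eq[of ?Y] unfolding Y .
  \<comment> \<open>The derivatives of the new variables along the field of
    \<open>newvars $ i\<close> are their brackets with it, that is, column \<open>i\<close> of the
    matrix.\<close>
  also have "(\<chi> j. newvars_deriv x j ?Y) = poisson_matrix (newvars x) *v axis i 1"
    using pbracket_newvars[OF x' C]
    by (simp add: vec_eq_iff matrix_vector_mult_basis column_def pbracket_hamvec[OF der])
  also have "?G \<bullet> \<dots> = - (poisson_matrix (newvars x) *v ?G) $ i"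
    unfolding poisson_matrix_skew[of ?G] by (simp add: inner_axis')
  finally show ?thesis
    using pbracket_skew[of "\<lambda>z. newvars z $ i" "Ham \<mu> m" x] by simp
qed

section \<open>Trajectories in the new variables\<close>

lemma has_vector_derivative_componentwise:
  fixes f :: "real \<Rightarrow> real^'n"
  shows "(f has_vector_derivative v) (at \<tau>) \<longleftrightarrow>
    (\<forall>i. ((\<lambda>s. f s $ i) has_real_derivative v $ i) (at \<tau>))"
  unfolding has_vector_derivative_def has_derivative_vec_componentwise
  by (simp add: has_field_derivative_def mult_commute_abs)

lemma solves_eom_has_vector_derivative:
  assumes "solves_eom \<mu> m T X" "\<tau> \<in> T"
  shows "(X has_vector_derivative hamvec (Ham \<mu> m) (X \<tau>)) (at \<tau>)"
proof -
  let ?h = "hamvec (Ham \<mu> m) (X \<tau>)"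
  have L: "((\<lambda>x. phL x $ i) has_derivative (\<lambda>h. phL h $ i)) (at x)"
    "((\<lambda>x. phM x $ i) has_derivative (\<lambda>h. phM h $ i)) (at x)"
    "((\<lambda>x. phP x $ a) has_derivative (\<lambda>h. phP h $ a)) (at x)"
    "((\<lambda>x. phy x $ a) has_derivative (\<lambda>h. phy h $ a)) (at x)" for i a x
    by (auto intro!: derivative_eq_intros)
  have "((\<lambda>s. phL (X s)) has_vector_derivative phL ?h) (at \<tau>)"
    "((\<lambda>s. phM (X s)) has_vector_derivative phM ?h) (at \<tau>)"
    "((\<lambda>s. phP (X s)) has_vector_derivative phP ?h) (at \<tau>)"
    "((\<lambda>s. phy (X s)) has_vector_derivative phy ?h) (at \<tau>)"
    using assms by (auto simp: has_vector_derivative_componentwise solves_eom_def pbracket_hamvec[OF L(1)]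
        pbracket_hamvec[OF L(2)] pbracket_hamvec[OF L(3)] pbracket_hamvec[OF L(4)])
  then have "((\<lambda>s. (phL (X s), phM (X s), phP (X s), phy (X s))) has_vector_derivative
      (phL ?h, phM ?h, phP ?h, phy ?h)) (at \<tau>)"
    by (intro has_vector_derivative_Pair)
  then show ?thesis by (simp flip: phase_eq)
qed

text \<open>\<open>solves_eom\<close> speaks of the phase coordinates only; the chain rule extends
  it to every function differentiable at the point.\<close>

lemma solves_eom_compose:
  assumes "solves_eom \<mu> m T X" "\<tau> \<in> T" and f: "(f has_derivative D) (at (X \<tau>))"
  shows "((\<lambda>s. f (X s)) has_real_derivative pbracket f (Ham \<mu> m) (X \<tau>)) (at \<tau>)"
proof -
  have X: "(X has_derivative (\<lambda>t. t *\<^sub>R hamvec (Ham \<mu> m) (X \<tau>))) (at \<tau>)"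
    using solves_eom_has_vector_derivative[OF assms(1,2)] by (simp add: has_vector_derivative_def)
  have "((\<lambda>s. f (X s)) has_derivative (\<lambda>t. D (t *\<^sub>R hamvec (Ham \<mu> m) (X \<tau>)))) (at \<tau>)"
    by (rule has_derivative_compose[OF X f])
  then show ?thesis
    unfolding has_field_derivative_def pbracket_hamvec[OF f]
    by (simp add: linear_cmul[OF has_derivative_linear[OF f]] mult_commute_abs)
qed

lemma zero_derivative_constant_on_interval:
  fixes f :: "real \<Rightarrow> real"
  assumes "is_interval T" "\<And>\<tau>. \<tau> \<in> T \<Longrightarrow> (f has_real_derivative 0) (at \<tau>)" "\<tau> \<in> T" "\<tau>0 \<in> T"
  shows "f \<tau> = f \<tau>0"
proof -
  have "(f has_derivative (\<lambda>h. 0)) (at x within T)" if "x \<in> T" for x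
    by (rule has_derivative_at_withinI)
      (use assms(2)[OF that] in \<open>simp add: has_field_derivative_def lambda_zero\<close>)
  then obtain k where "\<And>x. x \<in> T \<Longrightarrow> f x = k"
    using has_derivative_zero_constant[of T f] is_interval_convex[OF assms(1)] by blast
  with assms(3,4) show ?thesis by simp
qed

text \<open>Inserting one group of variables by \<open>pack\<close> is affine, so the partial
  gradients of \<open>H\<close> are blocks of the gradient on \<open>real^8\<close>. The signs of
  \<open>Jmat\<close> reproduce the \<open>Z\<close> block of \<open>poisson_matrix\<close>.\<close>

lemma reduced_eomI:
  assumes D: "(\<lambda>w. H (unpackE w) (unpackZ w) (w $ 7) (w $ 8)) differentiable (at (pack (E \<tau>) (Z \<tau>) (r \<tau>) (p \<tau>)))"
    and flow: "((\<lambda>s. pack (E s) (Z s) (r s) (p s)) has_vector_derivative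
       poisson_matrix (pack (E \<tau>) (Z \<tau>) (r \<tau>) (p \<tau>)) *v
       gradient (\<lambda>w. H (unpackE w) (unpackZ w) (w $ 7) (w $ 8)) (pack (E \<tau>) (Z \<tau>) (r \<tau>) (p \<tau>))) (at \<tau>)"
  shows "reduced_eom H E Z r p \<tau>"
proof -
  define w where "w = pack (E \<tau>) (Z \<tau>) (r \<tau>) (p \<tau>)"
  define h where "h = (\<lambda>w. H (unpackE w) (unpackZ w) (w $ 7) (w $ 8))"
  define G where "G = gradient h w"
  have h: "(h has_derivative (\<lambda>v. G \<bullet> v)) (at w)"
    unfolding G_def using D by (intro has_derivative_gradient) (simp add: h_def w_def)
  have hp: "h (pack e z s q) = H e z s q" for e z s q
    by (simp add: h_def unpack_pack)
  have dE: "((\<lambda>e. pack e (Z \<tau>) (r \<tau>) (p \<tau>)) has_derivative (\<lambda>v. pack v 0 0 0)) (at (E \<tau>))"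
    and dZ: "((\<lambda>z. pack (E \<tau>) z (r \<tau>) (p \<tau>)) has_derivative (\<lambda>v. pack 0 v 0 0)) (at (Z \<tau>))"
    and dr: "((\<lambda>s. pack (E \<tau>) (Z \<tau>) s (p \<tau>)) has_derivative (\<lambda>v. pack 0 0 v 0)) (at (r \<tau>))"
    and dp: "((\<lambda>s. pack (E \<tau>) (Z \<tau>) (r \<tau>) s) has_derivative (\<lambda>v. pack 0 0 0 v)) (at (p \<tau>))"
    unfolding has_derivative_vec_componentwise forall_8 pack_nth
    by (auto intro!: derivative_eq_intros)
  have gE: "gradient (\<lambda>e. H e (Z \<tau>) (r \<tau>) (p \<tau>)) (E \<tau>) = vector [G $ 1, G $ 2, G $ 3]"
  proof (rule gradient_eqI)
    have "((\<lambda>e. h (pack e (Z \<tau>) (r \<tau>) (p \<tau>))) has_derivative (\<lambda>v. G \<bullet> pack v 0 0 0)) (at (E \<tau>))"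
      using has_derivative_compose[OF dE, of h] h by (simp add: w_def)
    then show "((\<lambda>e. H e (Z \<tau>) (r \<tau>) (p \<tau>)) has_derivative (\<bullet>) (vector [G $ 1, G $ 2, G $ 3])) (at (E \<tau>))"
      unfolding hp by (rule has_derivative_eq_rhs) (simp add: fun_eq_iff inner_vec_def sum_8 sum_3)
  qed
  have gZ: "gradient (\<lambda>z. H (E \<tau>) z (r \<tau>) (p \<tau>)) (Z \<tau>) = vector [G $ 4, G $ 5, G $ 6]"
  proof (rule gradient_eqI)
    have "((\<lambda>z. h (pack (E \<tau>) z (r \<tau>) (p \<tau>))) has_derivative (\<lambda>v. G \<bullet> pack 0 v 0 0)) (at (Z \<tau>))"
      using has_derivative_compose[OF dZ, of h] h by (simp add: w_def)
    then show "((\<lambda>z. H (E \<tau>) z (r \<tau>) (p \<tau>)) has_derivative (\<bullet>) (vector [G $ 4, G $ 5, G $ 6])) (at (Z \<tau>))"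
      unfolding hp by (rule has_derivative_eq_rhs) (simp add: fun_eq_iff inner_vec_def sum_8 sum_3)
  qed
  have gr: "deriv (\<lambda>s. H (E \<tau>) (Z \<tau>) s (p \<tau>)) (r \<tau>) = G $ 7"
  proof (rule DERIV_imp_deriv)
    have "((\<lambda>s. h (pack (E \<tau>) (Z \<tau>) s (p \<tau>))) has_derivative (\<lambda>v. G \<bullet> pack 0 0 v 0)) (at (r \<tau>))"
      using has_derivative_compose[OF dr, of h] h by (simp add: w_def)
    then show "((\<lambda>s. H (E \<tau>) (Z \<tau>) s (p \<tau>)) has_real_derivative G $ 7) (at (r \<tau>))"
      unfolding hp has_field_derivative_def
      by (rule has_derivative_eq_rhs) (simp add: fun_eq_iff inner_vec_def sum_8)
  qed
  have gp: "deriv (\<lambda>s. H (E \<tau>) (Z \<tau>) (r \<tau>) s) (p \<tau>) = G $ 8"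
  proof (rule DERIV_imp_deriv)
    have "((\<lambda>s. h (pack (E \<tau>) (Z \<tau>) (r \<tau>) s)) has_derivative (\<lambda>v. G \<bullet> pack 0 0 0 v)) (at (p \<tau>))"
      using has_derivative_compose[OF dp, of h] h by (simp add: w_def)
    then show "((\<lambda>s. H (E \<tau>) (Z \<tau>) (r \<tau>) s) has_real_derivative G $ 8) (at (p \<tau>))"
      unfolding hp has_field_derivative_def
      by (rule has_derivative_eq_rhs) (simp add: fun_eq_iff inner_vec_def sum_8)
  qed
  have "\<forall>i. ((\<lambda>s. pack (E s) (Z s) (r s) (p s) $ i) has_real_derivative (poisson_matrix w *v G) $ i) (at \<tau>)"
    using flow unfolding has_vector_derivative_componentwise G_def h_def w_def .
  then have f: "((\<lambda>s. E s $ 1) has_real_derivative E \<tau> $ 3 * G $ 2 - E \<tau> $ 2 * G $ 3) (at \<tau>)"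
    "((\<lambda>s. E s $ 2) has_real_derivative E \<tau> $ 1 * G $ 3 - E \<tau> $ 3 * G $ 1) (at \<tau>)"
    "((\<lambda>s. E s $ 3) has_real_derivative E \<tau> $ 2 * G $ 1 - E \<tau> $ 1 * G $ 2) (at \<tau>)"
    "((\<lambda>s. Z s $ 1) has_real_derivative Z \<tau> $ 3 * G $ 5 + Z \<tau> $ 2 * G $ 6) (at \<tau>)"
    "((\<lambda>s. Z s $ 2) has_real_derivative Z \<tau> $ 1 * G $ 6 - Z \<tau> $ 3 * G $ 4) (at \<tau>)"
    "((\<lambda>s. Z s $ 3) has_real_derivative - Z \<tau> $ 2 * G $ 4 - Z \<tau> $ 1 * G $ 5) (at \<tau>)"
    "(r has_real_derivative G $ 8) (at \<tau>)" "(p has_real_derivative - G $ 7) (at \<tau>)"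
    unfolding forall_8 poisson_matrix_mult_nth by (simp_all add: w_def)
  have J: "Jmat *v Z \<tau> = vector [Z \<tau> $ 1, - Z \<tau> $ 2, Z \<tau> $ 3]"
    by (simp add: vec_eq_iff forall_3 matrix_vector_mult_def sum_3 Jmat_def)
  show ?thesis
    unfolding reduced_eom_def gE gZ gr gp J
    using f by (simp add: has_vector_derivative_componentwise forall_3 cross3_def mult.commute)
qed

text \<open>Constancy of \<open>C_star\<close> and of the energy on all of \<open>T\<close>
  underlies the rest: it lets one reduced Hamiltonian, with the parameter
  \<open>energy (X \<tau>0)\<close>, govern the motion at every time.\<close>

lemma trajectory_reduction:
  assumes \<mu>: "\<mu> > 0" and m: "m > 0" and T: "is_interval T" "\<tau>0 \<in> T" "\<tau> \<in> T"
    and dom: "X ` T \<subseteq> regular_region \<mu> \<inter> ham_domain \<mu>"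
    and eom: "solves_eom \<mu> m T X"
    and C: "C_star (X \<tau>0) = 0"
  shows "C_star (X \<tau>) = 0" "energy (X \<tau>) = energy (X \<tau>0)"
    and "((\<lambda>s. newvars (X s)) has_vector_derivative poisson_matrix (newvars (X \<tau>)) *v
       gradient (Ham_red8 \<mu> m (energy (X \<tau>0))) (newvars (X \<tau>))) (at \<tau>)"
    and "C_circ_red (newvars (X \<tau>)) = C_circ_red (newvars (X \<tau>0))"
    and "F_red (newvars (X \<tau>)) = F_red (newvars (X \<tau>0))"
proof -
  have reg: "X s \<in> regular_region \<mu> \<inter> ham_domain \<mu>" if "s \<in> T" for s
    using dom that by blast
  have Cs: "C_star (X s) = 0" if "s \<in> T" for s
    using zero_derivative_constant_on_interval[OF T(1) _ that T(2), of "\<lambda>s. C_star (X s)"] C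
      solves_eom_compose[OF eom _ C_star_has_derivative] unfolding pbracket_C_star C by blast
  have en: "energy (X s) = energy (X \<tau>0)" if "s \<in> T" for s
  proof (rule zero_derivative_constant_on_interval[OF T(1) _ that T(2), of "\<lambda>s. energy (X s)"])
    fix s assume s: "s \<in> T"
    have "pbracket energy (Ham \<mu> m) (X s) = 0"
      unfolding pbracket_hamvec[OF energy_has_derivative]
      by (simp add: hamvec_def Ham_time_independent[OF reg[OF s] \<mu> m])
    then show "((\<lambda>s. energy (X s)) has_real_derivative 0) (at s)"
      using solves_eom_compose[OF eom s energy_has_derivative] by simp
  qed
  show "C_star (X \<tau>) = 0" "energy (X \<tau>) = energy (X \<tau>0)"
    by (rule Cs[OF T(3)], rule en[OF T(3)])
  have flow: "((\<lambda>s. newvars (X s)) has_vector_derivative poisson_matrix (newvars (X s)) *v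
       gradient (Ham_red8 \<mu> m (energy (X \<tau>0))) (newvars (X s))) (at s)" if s: "s \<in> T" for s
    unfolding has_vector_derivative_componentwise
  proof
    fix i
    have "X s \<in> regular_region \<mu>" using reg[OF s] by simp
    from solves_eom_compose[OF eom s newvars_has_derivative[OF this, of i]]
    show "((\<lambda>s. newvars (X s) $ i) has_real_derivative (poisson_matrix (newvars (X s)) *v
       gradient (Ham_red8 \<mu> m (energy (X \<tau>0))) (newvars (X s))) $ i) (at s)"
      unfolding pbracket_newvars_Ham[OF reg[OF s] \<mu> m Cs[OF s]] en[OF s] .
  qed
  then show "((\<lambda>s. newvars (X s)) has_vector_derivative poisson_matrix (newvars (X \<tau>)) *v
       gradient (Ham_red8 \<mu> m (energy (X \<tau>0))) (newvars (X \<tau>))) (at \<tau>)" using T by blast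
  \<comment> \<open>The second assumption on \<open>f\<close> says that its gradient is orthogonal
    to the range of the Poisson matrix, as for both Casimir functions.\<close>
  have const: "f (newvars (X \<tau>)) = f (newvars (X \<tau>0))"
    if f: "\<And>w. f differentiable (at w)" "\<And>w g. gradient f w \<bullet> (poisson_matrix w *v g) = 0" for f :: "real^8 \<Rightarrow> real"
  proof (rule zero_derivative_constant_on_interval[OF T(1) _ T(3,2), of "\<lambda>s. f (newvars (X s))"])
    fix s assume s: "s \<in> T"
    from flow[OF s] have "((\<lambda>s. newvars (X s)) has_derivative (\<lambda>t. t *\<^sub>R (poisson_matrix (newvars (X s)) *v
       gradient (Ham_red8 \<mu> m (energy (X \<tau>0))) (newvars (X s))))) (at s)"
      by (simp add: has_vector_derivative_def)
    from has_derivative_compose[OF this has_derivative_gradient[OF f(1)]]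
    show "((\<lambda>s. f (newvars (X s))) has_real_derivative 0) (at s)"
      by (simp add: has_field_derivative_def f(2) lambda_zero)
  qed
  show "C_circ_red (newvars (X \<tau>)) = C_circ_red (newvars (X \<tau>0))"
    by (rule const[OF differentiable_casimirs(1) inner_gradient_casimirs(1)])
  show "F_red (newvars (X \<tau>)) = F_red (newvars (X \<tau>0))"
    by (rule const[OF differentiable_casimirs(2) inner_gradient_casimirs(2)])
qed


section \<open>Symplectic leaves\<close>

lemma leaf_level_eq: "leaf_level c l = {w. C_circ_red w = c\<^sup>2 \<and> F_red w = l}"
proof -
  have "w = pack (unpackE w) (unpackZ w) (w $ 7) (w $ 8)" for w
    by (simp add: vec_eq_iff forall_8 unpack_nth)
  then show ?thesis unfolding leaf_level_def by (auto, metis)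
qed

text \<open>Whatever the Hamiltonian of the arc is, its velocity lies in the range of the Poisson
  matrix, to which the Casimir gradients are orthogonal. Derivatives are taken within
  \<open>{0..1}\<close>, one-sided at the ends.\<close>

lemma ham_arcE:
  assumes "ham_arc w w'"
  obtains \<gamma> :: "real \<Rightarrow> real^8" where "\<gamma> 0 = w" "\<gamma> 1 = w'" "continuous_on {0..1} \<gamma>"
    "\<And>t. t \<in> {0..1} \<Longrightarrow> C_circ_red (\<gamma> t) = C_circ_red w \<and> F_red (\<gamma> t) = F_red w"
proof -
  from assms obtain h \<gamma> where \<gamma>: "\<gamma> 0 = w" "\<gamma> 1 = w'"
    and flow: "\<And>t. t \<in> {0..1} \<Longrightarrow>
      (\<gamma> has_vector_derivative poisson_matrix (\<gamma> t) *v gradient h (\<gamma> t)) (at t within {0..1})"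
    unfolding ham_arc_def by blast
  have const: "f (\<gamma> t) = f w"
    if f: "\<And>w. f differentiable (at w)" "\<And>w g. gradient f w \<bullet> (poisson_matrix w *v g) = 0"
      and t: "t \<in> {0..1}" for f :: "real^8 \<Rightarrow> real" and t :: real
  proof -
    have "((\<lambda>t. f (\<gamma> t)) has_derivative (\<lambda>h. 0)) (at t within {0..1})" if "t \<in> {0..1}" for t
      using has_derivative_compose[OF flow[OF that, unfolded has_vector_derivative_def] has_derivative_gradient[OF f(1)]]
      by (simp add: f(2))
    then obtain k where "\<And>t. t \<in> {0..1} \<Longrightarrow> f (\<gamma> t) = k"
      using has_derivative_zero_constant[of "{0..1::real}" "\<lambda>t. f (\<gamma> t)"] by auto
    then show ?thesis using t \<gamma>(1) by (metis atLeastAtMost_iff order_refl zero_le_one)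
  qed
  show thesis
  proof (rule that[OF \<gamma>])
    show "continuous_on {0..1} \<gamma>"
      unfolding continuous_on_eq_continuous_within
      using has_vector_derivative_continuous[OF flow] by blast
    show "C_circ_red (\<gamma> t) = C_circ_red w \<and> F_red (\<gamma> t) = F_red w" if "t \<in> {0..1}" for t
      using const[OF differentiable_casimirs(1) inner_gradient_casimirs(1) that]
        const[OF differentiable_casimirs(2) inner_gradient_casimirs(2) that] ..
  qed
qed

lemma ham_arc_connected_component:
  assumes "ham_arc w w'" "w \<in> leaf_level c l"
  shows "connected_component (leaf_level c l) w w'"
proof -
  obtain \<gamma> :: "real \<Rightarrow> real^8" where \<gamma>: "\<gamma> 0 = w" "\<gamma> 1 = w'" "continuous_on {0..1} \<gamma>"
    "\<And>t. t \<in> {0..1} \<Longrightarrow> C_circ_red (\<gamma> t) = C_circ_red w \<and> F_red (\<gamma> t) = F_red w"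
    using ham_arcE[OF assms(1)] by blast
  have "connected (\<gamma> ` {0..1})"
    by (rule connected_continuous_image[OF \<gamma>(3)]) simp
  moreover have "\<gamma> ` {0..1} \<subseteq> leaf_level c l"
    using \<gamma>(4) assms(2) by (auto simp: leaf_level_eq)
  moreover have "w \<in> \<gamma> ` {0..1}" "w' \<in> \<gamma> ` {0..1}"
    using \<gamma>(1,2) by (auto simp: image_iff intro: bexI[of _ 0] bexI[of _ 1])
  ultimately show ?thesis unfolding connected_component_def by blast
qed

lemma symplectic_leaf_subset:
  assumes "w \<in> leaf_level c l"
  shows "symplectic_leaf w \<subseteq> connected_component_set (leaf_level c l) w"
proof
  fix w' assume "w' \<in> symplectic_leaf w"
  then have "ham_arc\<^sup>*\<^sup>* w w'" by (simp add: symplectic_leaf_def)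
  then have "connected_component (leaf_level c l) w w'"
  proof induction
    case base
    then show ?case using assms by simp
  next
    case (step y z)
    then have "y \<in> leaf_level c l" using connected_component_in by blast
    with step show ?case using ham_arc_connected_component connected_component_trans by blast
  qed
  then show "w' \<in> connected_component_set (leaf_level c l) w" by simp
qed

section \<open>Transitivity of the flows of linear Hamiltonians\<close>

text \<open>\<open>g\<close> is the constant gradient of a linear Hamiltonian. Reversing time
  replaces \<open>g\<close> by \<open>- g\<close>, again the gradient of a linear function, so the
  arc can be traversed in both directions.\<close>

lemma linear_ham_arc:
  assumes "\<And>t. (\<gamma> has_vector_derivative poisson_matrix (\<gamma> t) *v g) (at t)"
  shows "ham_arc (\<gamma> 0) (\<gamma> 1)" "ham_arc (\<gamma> 1) (\<gamma> 0)"
proof -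
  have lin: "((\<lambda>w. k \<bullet> w) has_derivative (\<lambda>v. k \<bullet> v)) (at u)" for k u :: "real^8"
    by (auto intro!: derivative_eq_intros)
  have grad: "gradient ((\<bullet>) k) = (\<lambda>u. k)" for k :: "real^8"
    using gradient_eqI[OF lin] by blast
  have arc: "ham_arc (\<beta> 0) (\<beta> 1)"
    if "\<And>t. (\<beta> has_vector_derivative poisson_matrix (\<beta> t) *v k) (at t)" for \<beta> k
    unfolding ham_arc_def
    by (rule exI[of _ "(\<bullet>) k"], rule exI[of _ \<beta>])
      (use that lin in \<open>auto simp: grad intro: differentiableI has_vector_derivative_at_within\<close>)
  show "ham_arc (\<gamma> 0) (\<gamma> 1)" by (rule arc[OF assms])
  have "((\<lambda>t. \<gamma> (1 - t)) has_vector_derivative poisson_matrix (\<gamma> (1 - t)) *v (- g)) (at t)" for t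
  proof -
    have "((\<lambda>t::real. 1 - t) has_real_derivative - 1) (at t)"
      by (auto intro!: derivative_eq_intros)
    from vector_diff_chain_at[OF this[unfolded has_real_derivative_iff_has_vector_derivative] assms]
    moreover have "poisson_matrix w *v (- g) = - (poisson_matrix w *v g)" for w
      by (simp add: vec_eq_iff forall_8 poisson_matrix_mult_nth)
    ultimately show ?thesis by (simp add: o_def)
  qed
  from arc[OF this] show "ham_arc (\<gamma> 1) (\<gamma> 0)" by simp
qed

text \<open>\<open>symplectic_leaf\<close> is defined by directed arcs. Both directions are recorded
  because two points will be connected through a common base point, with the second leg
  reversed.\<close>

definition joined :: "real^8 \<Rightarrow> real^8 \<Rightarrow> bool" where
  "joined w w' \<longleftrightarrow> ham_arc\<^sup>*\<^sup>* w w' \<and> ham_arc\<^sup>*\<^sup>* w' w"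

lemma joined_trans [trans]: "joined u v \<Longrightarrow> joined v w \<Longrightarrow> joined u w"
  by (auto simp: joined_def)

lemma joined_linear:
  assumes "\<And>t. (\<gamma> has_vector_derivative poisson_matrix (\<gamma> t) *v g) (at t)" "\<gamma> 0 = w" "\<gamma> 1 = w'"
  shows "joined w w'"
  using linear_ham_arc[OF assms(1)] assms(2,3) by (auto simp: joined_def)

lemma rotation_exists:
  fixes x y :: real
  obtains \<theta> where "x * cos \<theta> - y * sin \<theta> = sqrt (x\<^sup>2 + y\<^sup>2)" "y * cos \<theta> + x * sin \<theta> = 0"
proof (cases "x\<^sup>2 + y\<^sup>2 = 0")
  case True
  then have "x = 0" "y = 0" by (auto simp: sum_power2_eq_zero_iff)
  then show ?thesis using that[of 0] by simp
next
  case False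
  define \<rho> where "\<rho> = sqrt (x\<^sup>2 + y\<^sup>2)"
  have \<rho>: "\<rho> > 0" using False by (simp add: \<rho>_def less_le sum_power2_eq_zero_iff)
  have \<rho>2: "\<rho>\<^sup>2 = x\<^sup>2 + y\<^sup>2" by (simp add: \<rho>_def)
  have "(x / \<rho>)\<^sup>2 + (y / \<rho>)\<^sup>2 = (x\<^sup>2 + y\<^sup>2) / \<rho>\<^sup>2"
    by (simp add: power_divide add_divide_distrib)
  then have "(x / \<rho>)\<^sup>2 + (y / \<rho>)\<^sup>2 = 1"
    using \<rho> by (simp flip: \<rho>2)
  then obtain t where "x / \<rho> = cos t" "y / \<rho> = sin t" using sincos_total_2pi by metis
  then have xy: "x = \<rho> * cos t" "y = \<rho> * sin t" using \<rho> by (simp_all add: field_simps)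
  have "x * cos t + y * sin t = \<rho> * ((sin t)\<^sup>2 + (cos t)\<^sup>2)"
    unfolding xy by algebra
  then have "x * cos t + y * sin t = \<rho>" by simp
  moreover have "y * cos t - x * sin t = 0" unfolding xy by simp
  ultimately show ?thesis using that[of "- t"] by (simp add: \<rho>_def)
qed

text \<open>A Lorentz boost takes a timelike vector to its rest frame and keeps the sign of its time
  component \<open>y\<close>.\<close>

lemma boost_exists:
  fixes x y :: real
  assumes "x\<^sup>2 < y\<^sup>2"
  obtains \<phi> where "x * cosh \<phi> + y * sinh \<phi> = 0" "(y * cosh \<phi> + x * sinh \<phi>) * y > 0"
proof -
  have "(y - x) * (y + x) > 0" using assms by (simp add: algebra_simps power2_eq_square)
  then have q: "(y - x) / (y + x) > 0" "y + x \<noteq> 0"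
    by (auto simp: zero_less_divide_iff zero_less_mult_iff)
  \<comment> \<open>The rapidity with \<open>tanh \<phi> = - x / y\<close>.\<close>
  define \<phi> where "\<phi> = ln ((y - x) / (y + x)) / 2"
  have "exp \<phi> * exp \<phi> = (y - x) / (y + x)"
    using q by (simp add: \<phi>_def flip: exp_add)
  then have e: "exp \<phi> * exp \<phi> * (y + x) = y - x" using q(2) by (simp add: field_simps)
  have "2 * exp \<phi> * (x * cosh \<phi> + y * sinh \<phi>) = exp \<phi> * exp \<phi> * (y + x) - (y - x)"
    by (simp add: cosh_def sinh_def exp_minus field_simps)
  then have 0: "x * cosh \<phi> + y * sinh \<phi> = 0" using e by simp
  have c: "(cosh \<phi>)\<^sup>2 - (sinh \<phi>)\<^sup>2 = 1" by (simp add: cosh_square_eq)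
  have "cosh \<phi> * ((y * cosh \<phi> + x * sinh \<phi>) * y) = y\<^sup>2"
  proof -
    have "y * sinh \<phi> = - (x * cosh \<phi>)" using 0 by simp
    then have "cosh \<phi> * ((y * cosh \<phi> + x * sinh \<phi>) * y) = y\<^sup>2 * (cosh \<phi>)\<^sup>2 - (y * sinh \<phi>)\<^sup>2"
      by (simp add: algebra_simps power2_eq_square)
    also have "\<dots> = y\<^sup>2 * ((cosh \<phi>)\<^sup>2 - (sinh \<phi>)\<^sup>2)" by (simp add: algebra_simps power_mult_distrib)
    finally show ?thesis using c by simp
  qed
  moreover have "y\<^sup>2 > 0" using assms by (smt (verit) zero_le_power2)
  ultimately have "(y * cosh \<phi> + x * sinh \<phi>) * y > 0"
    using cosh_real_pos[of \<phi>] by (metis zero_less_mult_pos)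
  with 0 that show thesis by blast
qed

lemma joined_base:
  assumes "c > 0" "w \<in> leaf_level c l"
  shows "joined w (pack (vector [sqrt l, 0, 0]) (vector [0, sgn (w $ 5) * c, 0]) 0 0)"
proof -
  define E1 E2 E3 Z1 Z2 Z3 where "E1 = w $ 1" and "E2 = w $ 2" and "E3 = w $ 3"
    and "Z1 = w $ 4" and "Z2 = w $ 5" and "Z3 = w $ 6"
  have C: "- Z1\<^sup>2 + Z2\<^sup>2 - Z3\<^sup>2 = c\<^sup>2" and F: "E1\<^sup>2 + E2\<^sup>2 + E3\<^sup>2 = l"
    using assms(2) by (simp_all add: leaf_level_eq C_circ_red_def F_red_def E1_def E2_def E3_def Z1_def Z2_def Z3_def)
  define W where "W e1 e2 e3 z1 z2 z3 r p = pack (vector [e1, e2, e3]) (vector [z1, z2, z3]) r p"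
    for e1 e2 e3 z1 z2 z3 r p
  have w: "w = W E1 E2 E3 Z1 Z2 Z3 (w $ 7) (w $ 8)"
    by (simp add: W_def vec_eq_iff forall_8 E1_def E2_def E3_def Z1_def Z2_def Z3_def)
  note der = has_vector_derivative_componentwise forall_8 poisson_matrix_mult_nth W_def pack_nth vector_3
  \<comment> \<open>Up to factors the generators are \<open>E_1\<close>, \<open>E_3\<close>,
    \<open>Z_2\<close> and \<open>Z_3\<close>. The flow of \<open>Z_2\<close> turns
    \<open>(Z_1, Z_3)\<close> in the opposite sense, hence \<open>- \<theta>\<close> in
    \<open>rot5\<close>; the flow of \<open>Z_3\<close> is hyperbolic.\<close>
  have rot1: "joined (W e1 e2 e3 z1 z2 z3 r p)
      (W e1 (e2 * cos \<theta> - e3 * sin \<theta>) (e3 * cos \<theta> + e2 * sin \<theta>) z1 z2 z3 r p)" for e1 e2 e3 z1 z2 z3 r p \<theta>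
    by (rule joined_linear[where g = "\<theta> *\<^sub>R axis 1 1" and
        \<gamma> = "\<lambda>t. W e1 (e2 * cos (t * \<theta>) - e3 * sin (t * \<theta>)) (e3 * cos (t * \<theta>) + e2 * sin (t * \<theta>)) z1 z2 z3 r p"])
      (auto simp: der axis_def algebra_simps intro!: derivative_eq_intros)
  have rot3: "joined (W e1 e2 e3 z1 z2 z3 r p)
      (W (e1 * cos \<theta> - e2 * sin \<theta>) (e2 * cos \<theta> + e1 * sin \<theta>) e3 z1 z2 z3 r p)" for e1 e2 e3 z1 z2 z3 r p \<theta>
    by (rule joined_linear[where g = "\<theta> *\<^sub>R axis 3 1" and
        \<gamma> = "\<lambda>t. W (e1 * cos (t * \<theta>) - e2 * sin (t * \<theta>)) (e2 * cos (t * \<theta>) + e1 * sin (t * \<theta>)) e3 z1 z2 z3 r p"])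
      (auto simp: der axis_def algebra_simps intro!: derivative_eq_intros)
  have rot5: "joined (W e1 e2 e3 z1 z2 z3 r p)
      (W e1 e2 e3 (z1 * cos \<theta> - z3 * sin \<theta>) z2 (z3 * cos \<theta> + z1 * sin \<theta>) r p)" for e1 e2 e3 z1 z2 z3 r p \<theta>
    by (rule joined_linear[where g = "- \<theta> *\<^sub>R axis 5 1" and
        \<gamma> = "\<lambda>t. W e1 e2 e3 (z1 * cos (t * \<theta>) - z3 * sin (t * \<theta>)) z2 (z3 * cos (t * \<theta>) + z1 * sin (t * \<theta>)) r p"])
      (auto simp: der axis_def algebra_simps intro!: derivative_eq_intros)
  have boost: "joined (W e1 e2 e3 z1 z2 z3 r p)
      (W e1 e2 e3 (z1 * cosh \<theta> + z2 * sinh \<theta>) (z2 * cosh \<theta> + z1 * sinh \<theta>) z3 r p)" for e1 e2 e3 z1 z2 z3 r p \<theta>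
    by (rule joined_linear[where g = "\<theta> *\<^sub>R axis 6 1" and
        \<gamma> = "\<lambda>t. W e1 e2 e3 (z1 * cosh (t * \<theta>) + z2 * sinh (t * \<theta>)) (z2 * cosh (t * \<theta>) + z1 * sinh (t * \<theta>)) z3 r p"])
      (auto simp: der axis_def algebra_simps intro!: derivative_eq_intros)
  \<comment> \<open>The gradient \<open>(p, - r)\<close> in the coordinates 7 and 8 has the constant
    velocity \<open>(- r, - p)\<close>, which reaches the origin at time one.\<close>
  have shift: "joined (W e1 e2 e3 z1 z2 z3 r p) (W e1 e2 e3 z1 z2 z3 0 0)" for e1 e2 e3 z1 z2 z3 r p
    by (rule joined_linear[where g = "p *\<^sub>R axis 7 1 - r *\<^sub>R axis 8 1" and
        \<gamma> = "\<lambda>t. W e1 e2 e3 z1 z2 z3 (r - t * r) (p - t * p)"])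
      (auto simp: der axis_def algebra_simps intro!: derivative_eq_intros)
  obtain \<theta>1 where \<theta>1: "E2 * cos \<theta>1 - E3 * sin \<theta>1 = sqrt (E2\<^sup>2 + E3\<^sup>2)" "E3 * cos \<theta>1 + E2 * sin \<theta>1 = 0"
    by (rule rotation_exists)
  obtain \<theta>3 where \<theta>3: "E1 * cos \<theta>3 - sqrt (E2\<^sup>2 + E3\<^sup>2) * sin \<theta>3 = sqrt (E1\<^sup>2 + (sqrt (E2\<^sup>2 + E3\<^sup>2))\<^sup>2)"
    "sqrt (E2\<^sup>2 + E3\<^sup>2) * cos \<theta>3 + E1 * sin \<theta>3 = 0"
    by (rule rotation_exists)
  have l: "sqrt (E1\<^sup>2 + (sqrt (E2\<^sup>2 + E3\<^sup>2))\<^sup>2) = sqrt l" using F by (simp add: add.assoc)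
  obtain \<theta>5 where \<theta>5: "Z1 * cos \<theta>5 - Z3 * sin \<theta>5 = sqrt (Z1\<^sup>2 + Z3\<^sup>2)" "Z3 * cos \<theta>5 + Z1 * sin \<theta>5 = 0"
    by (rule rotation_exists)
  have "(sqrt (Z1\<^sup>2 + Z3\<^sup>2))\<^sup>2 < Z2\<^sup>2"
  proof -
    have "c\<^sup>2 > 0" using assms(1) by simp
    moreover have "(sqrt (Z1\<^sup>2 + Z3\<^sup>2))\<^sup>2 = Z1\<^sup>2 + Z3\<^sup>2" by simp
    ultimately show ?thesis using C by linarith
  qed
  then obtain \<phi> where \<phi>: "sqrt (Z1\<^sup>2 + Z3\<^sup>2) * cosh \<phi> + Z2 * sinh \<phi> = 0"
    "(Z2 * cosh \<phi> + sqrt (Z1\<^sup>2 + Z3\<^sup>2) * sinh \<phi>) * Z2 > 0"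
    by (rule boost_exists)
  define z where "z = Z2 * cosh \<phi> + sqrt (Z1\<^sup>2 + Z3\<^sup>2) * sinh \<phi>"
  have "joined w (W E1 (sqrt (E2\<^sup>2 + E3\<^sup>2)) 0 Z1 Z2 Z3 (w $ 7) (w $ 8))"
    using rot1[of E1 E2 E3 Z1 Z2 Z3 "w $ 7" "w $ 8" \<theta>1] unfolding \<theta>1 w[symmetric] .
  also have "joined \<dots> (W (sqrt l) 0 0 Z1 Z2 Z3 (w $ 7) (w $ 8))"
    using rot3[of E1 "sqrt (E2\<^sup>2 + E3\<^sup>2)" 0 Z1 Z2 Z3 "w $ 7" "w $ 8" \<theta>3] unfolding \<theta>3 l .
  also have "joined \<dots> (W (sqrt l) 0 0 (sqrt (Z1\<^sup>2 + Z3\<^sup>2)) Z2 0 (w $ 7) (w $ 8))"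
    using rot5[of "sqrt l" 0 0 Z1 Z2 Z3 "w $ 7" "w $ 8" \<theta>5] unfolding \<theta>5 .
  also have "joined \<dots> (W (sqrt l) 0 0 0 z 0 (w $ 7) (w $ 8))"
    using boost[of "sqrt l" 0 0 "sqrt (Z1\<^sup>2 + Z3\<^sup>2)" Z2 0 "w $ 7" "w $ 8" \<phi>] unfolding \<phi> z_def[symmetric] .
  also have "joined \<dots> (W (sqrt l) 0 0 0 z 0 0 0)" by (rule shift)
  finally have j: "joined w (W (sqrt l) 0 0 0 z 0 0 0)" .
  \<comment> \<open>The boost preserves \<open>Z_2^2 - Z_1^2\<close>.\<close>
  have "z\<^sup>2 = c\<^sup>2"
  proof -
    have "z\<^sup>2 - (sqrt (Z1\<^sup>2 + Z3\<^sup>2) * cosh \<phi> + Z2 * sinh \<phi>)\<^sup>2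
        = (Z2\<^sup>2 - (sqrt (Z1\<^sup>2 + Z3\<^sup>2))\<^sup>2) * ((cosh \<phi>)\<^sup>2 - (sinh \<phi>)\<^sup>2)"
      unfolding z_def by algebra
    then show ?thesis using C by (simp add: \<phi>(1) cosh_square_eq)
  qed
  then have "\<bar>z\<bar> = \<bar>c\<bar>" by (simp add: power2_eq_iff abs_eq_iff)
  then have "\<bar>z\<bar> = c" using assms(1) by simp
  moreover have "sgn z = sgn Z2"
    using \<phi>(2) unfolding z_def[symmetric] by (auto simp: zero_less_mult_iff)
  ultimately have "z = sgn Z2 * c" by (metis sgn_mult_abs)
  then show ?thesis using j by (simp add: W_def Z2_def)
qed

text \<open>On the level set \<open>Z_2^2 = c^2 + Z_1^2 + Z_3^2 > 0\<close>, so by the intermediate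
  value theorem \<open>Z_2\<close> keeps its sign on connected subsets.\<close>

lemma connected_component_same_sheet:
  assumes "c > 0" "connected_component (leaf_level c l) w w'"
  shows "sgn (w' $ 5) = sgn (w $ 5)"
proof -
  from assms(2) obtain S where S: "connected S" "S \<subseteq> leaf_level c l" "w \<in> S" "w' \<in> S"
    unfolding connected_component_def by blast
  have nz: "v $ 5 \<noteq> 0" if "v \<in> S" for v
  proof
    assume "v $ 5 = 0"
    moreover have "C_circ_red v = c\<^sup>2" using that S(2) by (auto simp: leaf_level_eq)
    ultimately have "c\<^sup>2 + (v $ 4)\<^sup>2 + (v $ 6)\<^sup>2 = 0" by (simp add: C_circ_red_def)
    then show False using assms(1) by (smt (verit) zero_less_power zero_le_power2)
  qed
  have "connected ((\<lambda>v. v $ 5) ` S)"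
    by (intro connected_continuous_image S(1) continuous_intros)
  then have iv: "is_interval ((\<lambda>v. v $ 5) ` S)" by (simp add: is_interval_connected_1)
  have "\<not> (u $ 5 < 0 \<and> 0 < v $ 5)" if "u \<in> S" "v \<in> S" for u v
  proof
    assume "u $ 5 < 0 \<and> 0 < v $ 5"
    then have "0 \<in> (\<lambda>v. v $ 5) ` S"
      by (intro mem_is_interval_1_I[OF iv imageI[OF that(1)] imageI[OF that(2)]]) simp_all
    then obtain v where "v \<in> S" "v $ 5 = 0" by force
    then show False using nz by blast
  qed
  then have "\<not> (w $ 5 < 0 \<and> 0 < w' $ 5)" "\<not> (w' $ 5 < 0 \<and> 0 < w $ 5)"
    using S(3,4) by blast+
  then show ?thesis using nz[OF S(3)] nz[OF S(4)] by (auto simp: sgn_real_def)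
qed

text \<open>Arcs never leave the component. Conversely, two points of one component have the same
  sign of \<open>Z_2\<close>, hence the same base point in \<open>joined_base\<close>.\<close>

lemma symplectic_leaf_eq_component:
  assumes "c > 0" "w \<in> leaf_level c l"
  shows "symplectic_leaf w = connected_component_set (leaf_level c l) w"
proof
  show "symplectic_leaf w \<subseteq> connected_component_set (leaf_level c l) w"
    by (rule symplectic_leaf_subset[OF assms(2)])
  show "connected_component_set (leaf_level c l) w \<subseteq> symplectic_leaf w"
  proof
    fix w' assume "w' \<in> connected_component_set (leaf_level c l) w"
    then have cc: "connected_component (leaf_level c l) w w'" by simp
    then have "w' \<in> leaf_level c l" using connected_component_in by blast
    from joined_base[OF assms] joined_base[OF assms(1) this]
    have "ham_arc\<^sup>*\<^sup>* w w'"
      unfolding connected_component_same_sheet[OF assms(1) cc] joined_def by auto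
    then show "w' \<in> symplectic_leaf w" by (simp add: symplectic_leaf_def)
  qed
qed


theorem mainTheorem3:
  fixes \<mu> m :: real
  assumes "\<mu> > 0" and "m > 0"
  shows
    "(\<forall>x\<in>chart_region \<mu>. C_star x = 0 \<longrightarrow>
        (\<forall>i j. pbracket (\<lambda>z. newvars z $ i) (\<lambda>z. newvars z $ j) x
               = poisson_matrix (newvars x) $ i $ j))
   \<and> (\<forall>x\<in>chart_region \<mu>. C_star x = 0 \<longrightarrow>
        (let w = newvars x; P = phP x; \<theta> = phy x $ 2 in
          rank (poisson_matrix w) = 6 \<and>
          C_circ x = C_circ_red w \<and>
          F_int x = (P $ 2)\<^sup>2 + (P $ 3)\<^sup>2 + (phL x $ 1 - P $ 3 * cos \<theta>)\<^sup>2 / (sin \<theta>)\<^sup>2 \<and>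
          F_int x = F_red w \<and>
          (\<forall>f. f differentiable (at w) \<longrightarrow>
             red_bracket C_circ_red f w = 0 \<and> red_bracket F_red f w = 0) \<and>
          dim {gradient C_circ_red w, gradient F_red w} = 2 \<and>
          (\<forall>K. K differentiable (at w) \<and>
               (\<forall>f. f differentiable (at w) \<longrightarrow> red_bracket K f w = 0) \<longrightarrow>
             gradient K w \<in> span {gradient C_circ_red w, gradient F_red w})))
   \<and> (\<forall>x\<in>chart_region \<mu> \<inter> ham_domain \<mu>. C_star x = 0 \<longrightarrow>
        (let E = newE x; Z = newZ x; r = rad x; p = radP x; \<E> = energy x in
          - p_sq \<mu> x = mass_sq \<mu> \<E> E Z r p \<and>
          (m\<^sup>2 = - p_sq \<mu> x \<longrightarrow>
             Ham \<mu> m x = Ham_new \<mu> m \<E> (Vfun \<mu> (m\<^sup>2) E Z r) E Z r p) \<and>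
          Ham \<mu> m x = Ham_red \<mu> m \<E> E Z r p))
   \<and> (\<forall>T X \<tau>0 c l \<E>.
        open T \<and> is_interval T \<and> \<tau>0 \<in> T \<and>
        (\<forall>\<tau>\<in>T. X \<tau> \<in> chart_region \<mu> \<inter> ham_domain \<mu>) \<and> solves_eom \<mu> m T X \<and>
        C_star (X \<tau>0) = 0 \<and> C_circ (X \<tau>0) = c\<^sup>2 \<and> c > 0 \<and>
        F_int (X \<tau>0) = l \<and> energy (X \<tau>0) = \<E> \<longrightarrow>
        (\<forall>\<tau>\<in>T.
          reduced_eom (Ham_red \<mu> m \<E>)
            (\<lambda>s. newE (X s)) (\<lambda>s. newZ (X s)) (\<lambda>s. rad (X s)) (\<lambda>s. radP (X s)) \<tau> \<and>
          ((\<lambda>s. newvars (X s)) has_vector_derivative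
             poisson_matrix (newvars (X \<tau>)) *v
               gradient (\<lambda>w. Ham_red \<mu> m \<E> (unpackE w) (unpackZ w) (w $ 7) (w $ 8))
                 (newvars (X \<tau>))) (at \<tau>) \<and>
          newvars (X \<tau>) \<in> leaf_level c l))
   \<and> (\<forall>c l. c > 0 \<and> l > 0 \<longrightarrow>
        (\<forall>w\<in>leaf_level c l.
           symplectic_leaf w = connected_component_set (leaf_level c l) w))"
proof -
  have reg: "x \<in> regular_region \<mu>" if "x \<in> chart_region \<mu>" for x
    using chart_region_regular that by blast
  \<comment> \<open>Here \<open>Q \<noteq> 0\<close> enters: \<open>F\<close> is the squared length
    of \<open>Q\<close>.\<close>
  have F0: "F_red (newvars x) \<noteq> 0" if "x \<in> chart_region \<mu>" for x
    using that unfolding casimirs_newvars(1)[OF reg[OF that], symmetric]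
    by (simp add: F_int_def chart_region_def)
  have part2: "let w = newvars x; P = phP x; \<theta> = phy x $ 2 in
          rank (poisson_matrix w) = 6 \<and>
          C_circ x = C_circ_red w \<and>
          F_int x = (P $ 2)\<^sup>2 + (P $ 3)\<^sup>2 + (phL x $ 1 - P $ 3 * cos \<theta>)\<^sup>2 / (sin \<theta>)\<^sup>2 \<and>
          F_int x = F_red w \<and>
          (\<forall>f. f differentiable (at w) \<longrightarrow>
             red_bracket C_circ_red f w = 0 \<and> red_bracket F_red f w = 0) \<and>
          dim {gradient C_circ_red w, gradient F_red w} = 2 \<and>
          (\<forall>K. K differentiable (at w) \<and>
               (\<forall>f. f differentiable (at w) \<longrightarrow> red_bracket K f w = 0) \<longrightarrow>
             gradient K w \<in> span {gradient C_circ_red w, gradient F_red w})"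
    if x: "x \<in> chart_region \<mu>" and C: "C_star x = 0" for x
  proof -
    note casimirs = casimirs_newvars[OF reg[OF x]]
    have Z: "newvars x $ 5 \<noteq> 0" using casimirs(3) by simp
    have "sin (phy x $ 2) \<noteq> 0" using x by (simp add: chart_region_def)
    from F_int_eq[OF this] show ?thesis
      unfolding Let_def
      by (intro conjI allI impI rank_poisson_matrix[OF Z F0[OF x]] casimirs(1) casimirs(2)[OF C]
          red_bracket_casimirs dim_casimir_gradients[OF Z F0[OF x]] casimir_gradient_in_span[OF Z F0[OF x]]) blast+
  qed
  have part3: "let E = newE x; Z = newZ x; r = rad x; p = radP x; \<E> = energy x in
          - p_sq \<mu> x = mass_sq \<mu> \<E> E Z r p \<and>
          (m\<^sup>2 = - p_sq \<mu> x \<longrightarrow>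
             Ham \<mu> m x = Ham_new \<mu> m \<E> (Vfun \<mu> (m\<^sup>2) E Z r) E Z r p) \<and>
          Ham \<mu> m x = Ham_red \<mu> m \<E> E Z r p"
    if x: "x \<in> chart_region \<mu> \<inter> ham_domain \<mu>" and C: "C_star x = 0" for x
  proof -
    have "x \<in> regular_region \<mu>" "x \<in> ham_domain \<mu>" using x reg by auto
    note H = reduced_Hamiltonian[OF this(1) assms C] this(2)
    \<comment> \<open>On the mass shell \<open>m^2\<close> is the value of \<open>mass_sq\<close>,
      so the formula with the constant \<open>m^2\<close> in \<open>V\<close> is an instance of the
      one for \<open>Ham_red\<close>.\<close>
    show ?thesis
      unfolding Let_def using H(1) H(3)[OF H(4)] by (simp add: Ham_red_def)
  qed
  have part4: "reduced_eom (Ham_red \<mu> m \<E>)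
            (\<lambda>s. newE (X s)) (\<lambda>s. newZ (X s)) (\<lambda>s. rad (X s)) (\<lambda>s. radP (X s)) \<tau> \<and>
          ((\<lambda>s. newvars (X s)) has_vector_derivative
             poisson_matrix (newvars (X \<tau>)) *v
               gradient (\<lambda>w. Ham_red \<mu> m \<E> (unpackE w) (unpackZ w) (w $ 7) (w $ 8))
                 (newvars (X \<tau>))) (at \<tau>) \<and>
          newvars (X \<tau>) \<in> leaf_level c l"
    if T: "is_interval T" "\<tau>0 \<in> T" and X: "\<forall>\<tau>\<in>T. X \<tau> \<in> chart_region \<mu> \<inter> ham_domain \<mu>"
      and eom: "solves_eom \<mu> m T X" and C: "C_star (X \<tau>0) = 0" "C_circ (X \<tau>0) = c\<^sup>2"
      and F: "F_int (X \<tau>0) = l" and en: "energy (X \<tau>0) = \<E>" and \<tau>: "\<tau> \<in> T" for T X \<tau>0 c l \<E> \<tau>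
  proof -
    have dom: "X ` T \<subseteq> regular_region \<mu> \<inter> ham_domain \<mu>"
      using X reg by blast
    note red = trajectory_reduction[OF assms T \<tau> dom eom C(1), unfolded en]
    have H8: "Ham_red8 \<mu> m \<E> = (\<lambda>w. Ham_red \<mu> m \<E> (unpackE w) (unpackZ w) (w $ 7) (w $ 8))"
      by (rule ext) (simp add: Ham_red8_def)
    have diff: "Ham_red8 \<mu> m \<E> differentiable (at (newvars (X \<tau>)))"
      using Ham_red8_differentiable_newvars[OF subsetD[OF dom imageI[OF \<tau>]] assms red(1)] unfolding red(2) .
    have "reduced_eom (Ham_red \<mu> m \<E>)
            (\<lambda>s. newE (X s)) (\<lambda>s. newZ (X s)) (\<lambda>s. rad (X s)) (\<lambda>s. radP (X s)) \<tau>"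
      using diff red(3) unfolding H8 newvars_def by (rule reduced_eomI)
    moreover have "newvars (X \<tau>) \<in> leaf_level c l"
    proof -
      have "X \<tau>0 \<in> regular_region \<mu>" using dom T(2) by blast
      note casimirs = casimirs_newvars[OF this]
      show ?thesis
        unfolding leaf_level_eq mem_Collect_eq red(4,5) casimirs(1)[symmetric] casimirs(2)[OF C(1), symmetric]
        using C(2) F by simp
    qed
    ultimately show ?thesis using red(3) unfolding H8 by blast
  qed
  show ?thesis
    using pbracket_newvars reg part2 part3 part4 symplectic_leaf_eq_component
    by (intro conjI ballI allI impI; (elim conjE)?; blast)
qed

end
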